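(* Let $\mathcal{T}$ be a triangulated category, $\mathcal{S}$ a thick subcategory of $\mathcal{T}$, and $\mathcal{U}=\mathcal{T}/\mathcal{S}$ the Verdier quotient. Assume that $\mathcal{S}$ has a torsion pair $\mathcal{S}=\mathcal{X}\perp\mathcal{Y}$, and that $\mathcal{T}$ has torsion pairs $\mathcal{T}=\mathcal{X}\perp\mathcal{X}^\perp={}^\perp\mathcal{Y}\perp\mathcal{Y}$. Define full subcategories of $\mathcal{T}$ by \[\mathcal{Z}:=\mathcal{X}^\perp\cap{}^\perp(\mathcal{Y}[1]),\qquad \mathcal{P}:=\mathcal{X}[1]\cap\mathcal{Y}.\] Then the composition $\mathcal{Z}\subset\mathcal{T}\to\mathcal{U}$ of natural functors induces an equivalence of additive categories $\mathcal{Z}/[\mathcal{P}]\simeq\mathcal{U}$. In particular, the category $\mathcal{Z}/[\mathcal{P}]$ has a structure of a triangulated category.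
   Context: For full subcategories $\mathcal{X},\mathcal{Y}$ of a triangulated category $\mathcal{T}$ with shift $[1]$, $\mathcal{X}*\mathcal{Y}$ is the full subcategory of objects $T\in\mathcal{T}$ for which there is a triangle $X\to T\to Y\to X[1]$ with $X\in\mathcal{X}$, $Y\in\mathcal{Y}$. When $\mathrm{Hom}_{\mathcal{T}}(\mathcal{X},\mathcal{Y})=0$, one writes $\mathcal{X}\perp\mathcal{Y}$ for $\mathcal{X}*\mathcal{Y}$. Put $\mathcal{X}^\perp:=\{T\in\mathcal{T}\mid\mathrm{Hom}_{\mathcal{T}}(\mathcal{X},T)=0\}$ and ${}^\perp\mathcal{X}:=\{T\in\mathcal{T}\mid\mathrm{Hom}_{\mathcal{T}}(T,\mathcal{X})=0\}$ (these perpendicular categories, in the claim, are formed in $\mathcal{T}$). A torsion pair $\mathcal{T}=\mathcal{X}\perp\mathcal{Y}$ of a triangulated category $\mathcal{T}$ means that $\mathcal{T}=\mathcal{X}\perp\mathcal{Y}$, $\mathcal{X}={}^\perp\mathcal{Y}$ and $\mathcal{Y}=\mathcal{X}^\perp$ hold, with perpendiculars formed in the category being decomposed (so for $\mathcal{S}=\mathcal{X}\perp\mathcal{Y}$ they are formed in $\mathcal{S}$). The subcategories $\mathcal{X},\mathcal{Y}$ are not required to be triangulated. $\mathcal{Z}/[\mathcal{P}]$ is the additive category with the same objects as $\mathcal{Z}$ and $\mathrm{Hom}_{\mathcal{Z}/[\mathcal{P}]}(X,Y)=\mathrm{Hom}_{\mathcal{T}}(X,Y)/[\mathcal{P}](X,Y)$,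 where $[\mathcal{P}](X,Y)$ is the subgroup of morphisms factoring through objects of $\mathcal{P}$. *)

theory Defs
  imports "HOL-Algebra.Coset"
begin

section \<open>Additive categories\<close>

record ('o, 'm) cat =
  Ob :: "'o set"
  Arr :: "'m set"
  Src :: "'m \<Rightarrow> 'o"
  Tgt :: "'m \<Rightarrow> 'o"
  Ident :: "'o \<Rightarrow> 'm"
  Comp :: "'m \<Rightarrow> 'm \<Rightarrow> 'm" (infixl "\<cdot>\<index>" 70)

record ('o, 'm) add_cat = "('o, 'm) cat" +
  Add :: "'m \<Rightarrow> 'm \<Rightarrow> 'm" (infixl "\<boxplus>\<index>" 65)
  Zero :: "'o \<Rightarrow> 'o \<Rightarrow> 'm"

definition Hom :: "('o, 'm, 'x) cat_scheme \<Rightarrow> 'o \<Rightarrow> 'o \<Rightarrow> 'm set" where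
  "Hom C X Y = {f \<in> Arr C. Src C f = X \<and> Tgt C f = Y}"

text \<open>Composition is written in the order of functions: \<open>g \<cdot> f\<close> is \<open>f\<close> followed by \<open>g\<close>.\<close>

locale category =
  fixes C :: "('o, 'm, 'x) cat_scheme" (structure)
  assumes Src_in_Ob: "f \<in> Arr C \<Longrightarrow> Src C f \<in> Ob C"
    and Tgt_in_Ob: "f \<in> Arr C \<Longrightarrow> Tgt C f \<in> Ob C"
    and Ident_in_Hom: "X \<in> Ob C \<Longrightarrow> Ident C X \<in> Hom C X X"
    and Comp_in_Hom: "\<lbrakk>f \<in> Hom C X Y; g \<in> Hom C Y Z\<rbrakk> \<Longrightarrow> g \<cdot> f \<in> Hom C X Z"
    and Comp_Ident: "f \<in> Hom C X Y \<Longrightarrow> f \<cdot> Ident C X = f"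
    and Ident_Comp: "f \<in> Hom C X Y \<Longrightarrow> Ident C Y \<cdot> f = f"
    and Comp_assoc: "\<lbrakk>f \<in> Hom C W X; g \<in> Hom C X Y; h \<in> Hom C Y Z\<rbrakk>
      \<Longrightarrow> (h \<cdot> g) \<cdot> f = h \<cdot> (g \<cdot> f)"

definition is_iso :: "('o, 'm, 'x) cat_scheme \<Rightarrow> 'm \<Rightarrow> bool" where
  "is_iso C f \<longleftrightarrow> f \<in> Arr C \<and>
     (\<exists>g \<in> Hom C (Tgt C f) (Src C f).
        g \<cdot>\<^bsub>C\<^esub> f = Ident C (Src C f) \<and> f \<cdot>\<^bsub>C\<^esub> g = Ident C (Tgt C f))"

definition isomorphic :: "('o, 'm, 'x) cat_scheme \<Rightarrow> 'o \<Rightarrow> 'o \<Rightarrow> bool" where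
  "isomorphic C X Y \<longleftrightarrow> (\<exists>f \<in> Hom C X Y. is_iso C f)"

definition hom_group :: "('o, 'm, 'x) add_cat_scheme \<Rightarrow> 'o \<Rightarrow> 'o \<Rightarrow> 'm monoid" where
  "hom_group C X Y = \<lparr>carrier = Hom C X Y, mult = Add C, one = Zero C X Y\<rparr>"

locale preadditive_category = category C
  for C :: "('o, 'm, 'x) add_cat_scheme" (structure) +
  assumes comm_group_Hom: "\<lbrakk>X \<in> Ob C; Y \<in> Ob C\<rbrakk> \<Longrightarrow> comm_group (hom_group C X Y)"
    and Comp_Add_left: "\<lbrakk>f \<in> Hom C X Y; g \<in> Hom C Y Z; h \<in> Hom C Y Z\<rbrakk>
      \<Longrightarrow> (g \<boxplus> h) \<cdot> f = g \<cdot> f \<boxplus> h \<cdot> f"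
    and Comp_Add_right: "\<lbrakk>f \<in> Hom C X Y; g \<in> Hom C X Y; h \<in> Hom C Y Z\<rbrakk>
      \<Longrightarrow> h \<cdot> (f \<boxplus> g) = h \<cdot> f \<boxplus> h \<cdot> g"

definition Neg :: "('o, 'm, 'x) add_cat_scheme \<Rightarrow> 'm \<Rightarrow> 'm" where
  "Neg C f = inv\<^bsub>hom_group C (Src C f) (Tgt C f)\<^esub> f"

definition zero_object :: "('o, 'm, 'x) cat_scheme \<Rightarrow> 'o \<Rightarrow> bool" where
  "zero_object C Z \<longleftrightarrow> Z \<in> Ob C \<and>
     (\<forall>X \<in> Ob C. (\<exists>!f. f \<in> Hom C X Z) \<and> (\<exists>!f. f \<in> Hom C Z X))"

definition biproduct ::
  "('o, 'm, 'x) add_cat_scheme \<Rightarrow> 'o \<Rightarrow> 'o \<Rightarrow> 'o \<Rightarrow> bool" where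
  "biproduct C X Y B \<longleftrightarrow>
     (\<exists>i \<in> Hom C X B. \<exists>j \<in> Hom C Y B. \<exists>p \<in> Hom C B X. \<exists>q \<in> Hom C B Y.
        p \<cdot>\<^bsub>C\<^esub> i = Ident C X \<and> q \<cdot>\<^bsub>C\<^esub> j = Ident C Y \<and>
        q \<cdot>\<^bsub>C\<^esub> i = Zero C X Y \<and> p \<cdot>\<^bsub>C\<^esub> j = Zero C Y X \<and>
        i \<cdot>\<^bsub>C\<^esub> p \<boxplus>\<^bsub>C\<^esub> j \<cdot>\<^bsub>C\<^esub> q = Ident C B)"

locale additive_category = preadditive_category C
  for C :: "('o, 'm, 'x) add_cat_scheme" (structure) +
  assumes ex_zero_object: "\<exists>Z. zero_object C Z"
    and ex_biproduct: "\<lbrakk>X \<in> Ob C; Y \<in> Ob C\<rbrakk> \<Longrightarrow> \<exists>B \<in> Ob C. biproduct C X Y B"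

definition full_subcat ::
  "('o, 'm, 'x) cat_scheme \<Rightarrow> 'o set \<Rightarrow> ('o, 'm, 'x) cat_scheme" where
  "full_subcat C A = C\<lparr>Ob := Ob C \<inter> A, Arr := {f \<in> Arr C. Src C f \<in> A \<and> Tgt C f \<in> A}\<rparr>"


section \<open>Functors and equivalences\<close>

record ('o, 'm, 'p, 'n) ftor =
  OMap :: "'o \<Rightarrow> 'p"
  AMap :: "'m \<Rightarrow> 'n"

definition is_functor ::
  "('o, 'm, 'x) cat_scheme \<Rightarrow> ('p, 'n, 'y) cat_scheme \<Rightarrow> ('o, 'm, 'p, 'n) ftor \<Rightarrow> bool" where
  "is_functor C D F \<longleftrightarrow> category C \<and> category D \<and>
     (\<forall>X \<in> Ob C. OMap F X \<in> Ob D) \<and>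
     (\<forall>f \<in> Arr C. AMap F f \<in> Hom D (OMap F (Src C f)) (OMap F (Tgt C f))) \<and>
     (\<forall>X \<in> Ob C. AMap F (Ident C X) = Ident D (OMap F X)) \<and>
     (\<forall>f \<in> Arr C. \<forall>g \<in> Arr C. Tgt C f = Src C g \<longrightarrow>
        AMap F (g \<cdot>\<^bsub>C\<^esub> f) = AMap F g \<cdot>\<^bsub>D\<^esub> AMap F f)"

definition additive_functor ::
  "('o, 'm, 'x) add_cat_scheme \<Rightarrow> ('p, 'n, 'y) add_cat_scheme \<Rightarrow> ('o, 'm, 'p, 'n) ftor \<Rightarrow> bool" where
  "additive_functor C D F \<longleftrightarrow> additive_category C \<and> additive_category D \<and> is_functor C D F \<and>
     (\<forall>f \<in> Arr C. \<forall>g \<in> Arr C. Src C f = Src C g \<and> Tgt C f = Tgt C g \<longrightarrow>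
        AMap F (f \<boxplus>\<^bsub>C\<^esub> g) = AMap F f \<boxplus>\<^bsub>D\<^esub> AMap F g)"

text \<open>With a full subcategory as its source, \<open>id_functor\<close> is also the inclusion functor.\<close>

definition id_functor :: "('o, 'm, 'o, 'm) ftor" where
  "id_functor = \<lparr>OMap = (\<lambda>X. X), AMap = (\<lambda>f. f)\<rparr>"

definition comp_functor ::
  "('p, 'n, 'q, 'l) ftor \<Rightarrow> ('o, 'm, 'p, 'n) ftor \<Rightarrow> ('o, 'm, 'q, 'l) ftor" (infixl "\<circ>\<^sub>F" 55) where
  "G \<circ>\<^sub>F F = \<lparr>OMap = OMap G \<circ> OMap F, AMap = AMap G \<circ> AMap F\<rparr>"

text \<open>A functor is determined only by its values on the objects and arrows of its source, so
  equality of functors is relative to the source category.\<close>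

definition functor_eq ::
  "('o, 'm, 'x) cat_scheme \<Rightarrow> ('o, 'm, 'p, 'n) ftor \<Rightarrow> ('o, 'm, 'p, 'n) ftor \<Rightarrow> bool" where
  "functor_eq C F G \<longleftrightarrow>
     (\<forall>X \<in> Ob C. OMap F X = OMap G X) \<and> (\<forall>f \<in> Arr C. AMap F f = AMap G f)"

definition natural_iso ::
  "('o, 'm, 'x) cat_scheme \<Rightarrow> ('p, 'n, 'y) cat_scheme \<Rightarrow>
   ('o, 'm, 'p, 'n) ftor \<Rightarrow> ('o, 'm, 'p, 'n) ftor \<Rightarrow> ('o \<Rightarrow> 'n) \<Rightarrow> bool" where
  "natural_iso C D F G \<eta> \<longleftrightarrow>
     (\<forall>X \<in> Ob C. \<eta> X \<in> Hom D (OMap F X) (OMap G X) \<and> is_iso D (\<eta> X)) \<and>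
     (\<forall>f \<in> Arr C. \<eta> (Tgt C f) \<cdot>\<^bsub>D\<^esub> AMap F f = AMap G f \<cdot>\<^bsub>D\<^esub> \<eta> (Src C f))"

definition equivalence_functor ::
  "('o, 'm, 'x) cat_scheme \<Rightarrow> ('p, 'n, 'y) cat_scheme \<Rightarrow> ('o, 'm, 'p, 'n) ftor \<Rightarrow> bool" where
  "equivalence_functor C D F \<longleftrightarrow> is_functor C D F \<and>
     (\<exists>G \<eta> \<epsilon>. is_functor D C G \<and>
        natural_iso C C id_functor (G \<circ>\<^sub>F F) \<eta> \<and> natural_iso D D (F \<circ>\<^sub>F G) id_functor \<epsilon>)"

definition additive_equivalence ::
  "('o, 'm, 'x) add_cat_scheme \<Rightarrow> ('p, 'n, 'y) add_cat_scheme \<Rightarrow> ('o, 'm, 'p, 'n) ftor \<Rightarrow> bool" where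
  "additive_equivalence C D F \<longleftrightarrow> additive_functor C D F \<and> equivalence_functor C D F"


section \<open>The quotient of an additive category by the ideal of a class of objects\<close>

definition factoring ::
  "('o, 'm, 'x) cat_scheme \<Rightarrow> 'o set \<Rightarrow> 'o \<Rightarrow> 'o \<Rightarrow> 'm set" where
  "factoring C P X Y = {h \<cdot>\<^bsub>C\<^esub> g |g h. \<exists>W \<in> P. g \<in> Hom C X W \<and> h \<in> Hom C W Y}"

definition ideal_coset :: "('o, 'm, 'x) add_cat_scheme \<Rightarrow> 'o set \<Rightarrow> 'm \<Rightarrow> 'm set" where
  "ideal_coset C P f =
     factoring C P (Src C f) (Tgt C f) #>\<^bsub>hom_group C (Src C f) (Tgt C f)\<^esub> f"

text \<open>The Hom groups are the factor groups \<open>hom_group C X Y Mod factoring C P X Y\<close>. The arrows in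
  a coset are parallel, so its source and target can be read off any of its elements.\<close>

definition ideal_quotient ::
  "('o, 'm, 'x) add_cat_scheme \<Rightarrow> 'o set \<Rightarrow> ('o, 'm set) add_cat" where
  "ideal_quotient C P =
     \<lparr>Ob = Ob C,
      Arr = (\<Union>X \<in> Ob C. \<Union>Y \<in> Ob C. rcosets\<^bsub>hom_group C X Y\<^esub> (factoring C P X Y)),
      Src = (\<lambda>A. Src C (SOME f. f \<in> A)),
      Tgt = (\<lambda>A. Tgt C (SOME f. f \<in> A)),
      Ident = (\<lambda>X. ideal_coset C P (Ident C X)),
      Comp = (\<lambda>B A. \<Union>b \<in> B. \<Union>a \<in> A. ideal_coset C P (b \<cdot>\<^bsub>C\<^esub> a)),
      Add = (\<lambda>A B. \<Union>a \<in> A. \<Union>b \<in> B. {a \<boxplus>\<^bsub>C\<^esub> b}),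
      Zero = factoring C P\<rparr>"

definition ideal_projection ::
  "('o, 'm, 'x) add_cat_scheme \<Rightarrow> 'o set \<Rightarrow> ('o, 'm, 'o, 'm set) ftor" where
  "ideal_projection C P = \<lparr>OMap = (\<lambda>X. X), AMap = ideal_coset C P\<rparr>"


section \<open>Triangulated categories\<close>

text \<open>The triple \<open>(u, v, w)\<close> stands for the triangle \<open>X \<rightarrow> Y \<rightarrow> Z \<rightarrow> X[1]\<close> with these three arrows;
  \<open>Tri\<close> is the class of distinguished triangles.\<close>

record ('o, 'm) tri_cat = "('o, 'm) add_cat" +
  ShO :: "'o \<Rightarrow> 'o"
  ShA :: "'m \<Rightarrow> 'm"
  Tri :: "('m \<times> 'm \<times> 'm) set"

definition shift_functor :: "('o, 'm, 'x) tri_cat_scheme \<Rightarrow> ('o, 'm, 'o, 'm) ftor" where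
  "shift_functor T = \<lparr>OMap = ShO T, AMap = ShA T\<rparr>"

fun candidate_triangle :: "('o, 'm, 'x) tri_cat_scheme \<Rightarrow> 'm \<times> 'm \<times> 'm \<Rightarrow> bool" where
  "candidate_triangle T (u, v, w) \<longleftrightarrow> u \<in> Arr T \<and> v \<in> Arr T \<and> w \<in> Arr T \<and>
     Tgt T u = Src T v \<and> Tgt T v = Src T w \<and> Tgt T w = ShO T (Src T u)"

fun triangle_morphism ::
  "('o, 'm, 'x) tri_cat_scheme \<Rightarrow> 'm \<times> 'm \<times> 'm \<Rightarrow> 'm \<times> 'm \<times> 'm \<Rightarrow> 'm \<times> 'm \<times> 'm \<Rightarrow> bool" where
  "triangle_morphism T (u, v, w) (u', v', w') (a, b, c) \<longleftrightarrow>
     a \<in> Hom T (Src T u) (Src T u') \<and> b \<in> Hom T (Src T v) (Src T v') \<and>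
     c \<in> Hom T (Src T w) (Src T w') \<and>
     b \<cdot>\<^bsub>T\<^esub> u = u' \<cdot>\<^bsub>T\<^esub> a \<and> c \<cdot>\<^bsub>T\<^esub> v = v' \<cdot>\<^bsub>T\<^esub> b \<and> ShA T a \<cdot>\<^bsub>T\<^esub> w = w' \<cdot>\<^bsub>T\<^esub> c"

definition isomorphic_triangles ::
  "('o, 'm, 'x) tri_cat_scheme \<Rightarrow> 'm \<times> 'm \<times> 'm \<Rightarrow> 'm \<times> 'm \<times> 'm \<Rightarrow> bool" where
  "isomorphic_triangles T t t' \<longleftrightarrow> candidate_triangle T t \<and> candidate_triangle T t' \<and>
     (\<exists>a b c. is_iso T a \<and> is_iso T b \<and> is_iso T c \<and> triangle_morphism T t t' (a, b, c))"

text \<open>The shift is only required to be an additive autoequivalence, not an automorphism of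
  categories, since only the former notion is transported along equivalences.\<close>

locale triangulated_category = additive_category T
  for T :: "('o, 'm, 'x) tri_cat_scheme" (structure) +
  assumes shift_equivalence: "additive_equivalence T T (shift_functor T)"
    and Tri_candidate: "t \<in> Tri T \<Longrightarrow> candidate_triangle T t"
    and TR1_iso: "\<lbrakk>t \<in> Tri T; isomorphic_triangles T t t'\<rbrakk> \<Longrightarrow> t' \<in> Tri T"
    and TR1_ident: "\<lbrakk>X \<in> Ob T; zero_object T Z\<rbrakk>
      \<Longrightarrow> (Ident T X, Zero T X Z, Zero T Z (ShO T X)) \<in> Tri T"
    and TR1_cone: "u \<in> Arr T \<Longrightarrow> \<exists>v w. (u, v, w) \<in> Tri T"
    and TR2: "candidate_triangle T (u, v, w)
      \<Longrightarrow> (u, v, w) \<in> Tri T \<longleftrightarrow> (v, w, Neg T (ShA T u)) \<in> Tri T"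
    and TR3: "\<lbrakk>(u, v, w) \<in> Tri T; (u', v', w') \<in> Tri T;
        a \<in> Hom T (Src T u) (Src T u'); b \<in> Hom T (Tgt T u) (Tgt T u'); b \<cdot> u = u' \<cdot> a\<rbrakk>
      \<Longrightarrow> \<exists>c. triangle_morphism T (u, v, w) (u', v', w') (a, b, c)"
    and TR4: "\<lbrakk>u \<in> Hom T X Y; v \<in> Hom T Y Z;
        (u, p, d) \<in> Tri T; (v, q, e) \<in> Tri T; (v \<cdot> u, r, k) \<in> Tri T\<rbrakk>
      \<Longrightarrow> \<exists>a b. (a, b, ShA T p \<cdot> e) \<in> Tri T \<and>
            triangle_morphism T (u, p, d) (v \<cdot> u, r, k) (Ident T X, v, a) \<and>
            triangle_morphism T (v \<cdot> u, r, k) (v, q, e) (u, Ident T Z, b)"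

definition has_triangulated_structure :: "('o, 'm) add_cat \<Rightarrow> bool" where
  "has_triangulated_structure C \<longleftrightarrow>
     (\<exists>T :: ('o, 'm) tri_cat. add_cat.truncate T = C \<and> triangulated_category T)"

text \<open>A full subcategory is given by its set of objects. The object set of \<open>\<X>[1]\<close> is closed under
  isomorphism, as the shift need not be bijective on objects.\<close>

definition shift_set :: "('o, 'm, 'x) tri_cat_scheme \<Rightarrow> 'o set \<Rightarrow> 'o set" where
  "shift_set T A = {W \<in> Ob T. \<exists>X \<in> A. isomorphic T W (ShO T X)}"

definition full_tri_subcat ::
  "('o, 'm, 'x) tri_cat_scheme \<Rightarrow> 'o set \<Rightarrow> ('o, 'm, 'x) tri_cat_scheme" where
  "full_tri_subcat T A = (full_subcat T A)
     \<lparr>Tri := {(u, v, w) \<in> Tri T. {u, v, w} \<subseteq> Arr (full_subcat T A)}\<rparr>"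

definition triangulated_subcategory :: "('o, 'm, 'x) tri_cat_scheme \<Rightarrow> 'o set \<Rightarrow> bool" where
  "triangulated_subcategory T S \<longleftrightarrow> S \<subseteq> Ob T \<and> S \<noteq> {} \<and>
     (\<forall>X \<in> S. \<forall>Y \<in> Ob T. isomorphic T X Y \<longrightarrow> Y \<in> S) \<and>
     (\<forall>X \<in> Ob T. ShO T X \<in> S \<longleftrightarrow> X \<in> S) \<and>
     (\<forall>(u, v, w) \<in> Tri T. Src T u \<in> S \<and> Tgt T u \<in> S \<longrightarrow> Tgt T v \<in> S)"

definition thick_subcategory :: "('o, 'm, 'x) tri_cat_scheme \<Rightarrow> 'o set \<Rightarrow> bool" where
  "thick_subcategory T S \<longleftrightarrow> triangulated_subcategory T S \<and>
     (\<forall>X \<in> Ob T. \<forall>Y \<in> Ob T. \<forall>B \<in> S. biproduct T X Y B \<longrightarrow> X \<in> S)"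


section \<open>Torsion pairs\<close>

definition hom_vanish :: "('o, 'm, 'x) add_cat_scheme \<Rightarrow> 'o set \<Rightarrow> 'o set \<Rightarrow> bool" where
  "hom_vanish C A B \<longleftrightarrow> (\<forall>X \<in> A. \<forall>Y \<in> B. Hom C X Y = {Zero C X Y})"

definition right_perp :: "('o, 'm, 'x) add_cat_scheme \<Rightarrow> 'o set \<Rightarrow> 'o set" where
  "right_perp C A = {W \<in> Ob C. hom_vanish C A {W}}"

definition left_perp :: "('o, 'm, 'x) add_cat_scheme \<Rightarrow> 'o set \<Rightarrow> 'o set" where
  "left_perp C A = {W \<in> Ob C. hom_vanish C {W} A}"

definition star :: "('o, 'm, 'x) tri_cat_scheme \<Rightarrow> 'o set \<Rightarrow> 'o set \<Rightarrow> 'o set" where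
  "star T A B = {W \<in> Ob T. \<exists>(u, v, w) \<in> Tri T. Src T u \<in> A \<and> Tgt T u = W \<and> Tgt T v \<in> B}"

definition torsion_pair :: "('o, 'm, 'x) tri_cat_scheme \<Rightarrow> 'o set \<Rightarrow> 'o set \<Rightarrow> bool" where
  "torsion_pair T A B \<longleftrightarrow> A \<subseteq> Ob T \<and> B \<subseteq> Ob T \<and>
     hom_vanish T A B \<and> Ob T = star T A B \<and> A = left_perp T B \<and> B = right_perp T A"


section \<open>The Verdier quotient\<close>

definition cone_in :: "('o, 'm, 'x) tri_cat_scheme \<Rightarrow> 'o set \<Rightarrow> 'm set" where
  "cone_in T S = {s \<in> Arr T. \<exists>v w. (s, v, w) \<in> Tri T \<and> Tgt T v \<in> S}"

text \<open>The roof \<open>(s, f)\<close>, with \<open>s : W \<rightarrow> X\<close> and \<open>f : W \<rightarrow> Y\<close>, represents the fraction \<open>f s\<inverse> : X \<rightarrow> Y\<close>.\<close>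

definition roofs :: "('o, 'm, 'x) tri_cat_scheme \<Rightarrow> 'o set \<Rightarrow> ('m \<times> 'm) set" where
  "roofs T S = {(s, f). s \<in> cone_in T S \<and> f \<in> Arr T \<and> Src T s = Src T f}"

definition roof_rel ::
  "('o, 'm, 'x) tri_cat_scheme \<Rightarrow> 'o set \<Rightarrow> (('m \<times> 'm) \<times> ('m \<times> 'm)) set" where
  "roof_rel T S = {((s, f), (t, g)). (s, f) \<in> roofs T S \<and> (t, g) \<in> roofs T S \<and>
     (\<exists>a \<in> Arr T. \<exists>b \<in> Arr T. Tgt T a = Src T s \<and> Tgt T b = Src T t \<and> Src T a = Src T b \<and>
        s \<cdot>\<^bsub>T\<^esub> a = t \<cdot>\<^bsub>T\<^esub> b \<and> s \<cdot>\<^bsub>T\<^esub> a \<in> cone_in T S \<and> f \<cdot>\<^bsub>T\<^esub> a = g \<cdot>\<^bsub>T\<^esub> b)}"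

definition roof_class ::
  "('o, 'm, 'x) tri_cat_scheme \<Rightarrow> 'o set \<Rightarrow> 'm \<Rightarrow> 'm \<Rightarrow> ('m \<times> 'm) set" where
  "roof_class T S s f = roof_rel T S `` {(s, f)}"

definition verdier_functor ::
  "('o, 'm, 'x) tri_cat_scheme \<Rightarrow> 'o set \<Rightarrow> ('o, 'm, 'o, ('m \<times> 'm) set) ftor" where
  "verdier_functor T S =
     \<lparr>OMap = (\<lambda>X. X), AMap = (\<lambda>f. roof_class T S (Ident T (Src T f)) f)\<rparr>"

text \<open>The operations take the union over all choices of representatives and of Ore completions; the
  classes so obtained coincide. Composition is
  \<open>(g t\<inverse>) (f s\<inverse>) = (g f') (s t')\<inverse>\<close> where \<open>f t' = t f'\<close>, and addition is performed over a common
  denominator \<open>s\<close>. The distinguished triangles, left empty here, are added in the next definition,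
  as they refer to isomorphisms in this category.\<close>

definition verdier_precat ::
  "('o, 'm, 'x) tri_cat_scheme \<Rightarrow> 'o set \<Rightarrow> ('o, ('m \<times> 'm) set) tri_cat" where
  "verdier_precat T S =
     \<lparr>Ob = Ob T,
      Arr = roofs T S // roof_rel T S,
      Src = (\<lambda>A. Tgt T (fst (SOME r. r \<in> A))),
      Tgt = (\<lambda>A. Tgt T (snd (SOME r. r \<in> A))),
      Ident = (\<lambda>X. roof_class T S (Ident T X) (Ident T X)),
      Comp = (\<lambda>B A. \<Union>{roof_class T S (s \<cdot>\<^bsub>T\<^esub> t') (g \<cdot>\<^bsub>T\<^esub> f') |s f t g t' f'.
        (s, f) \<in> A \<and> (t, g) \<in> B \<and> (t', f') \<in> roofs T S \<and>
        Tgt T t' = Src T f \<and> Tgt T f' = Src T t \<and> f \<cdot>\<^bsub>T\<^esub> t' = t \<cdot>\<^bsub>T\<^esub> f'}),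
      Add = (\<lambda>A B. \<Union>{roof_class T S s (f \<boxplus>\<^bsub>T\<^esub> g) |s f g. (s, f) \<in> A \<and> (s, g) \<in> B}),
      Zero = (\<lambda>X Y. roof_class T S (Ident T X) (Zero T X Y)),
      ShO = ShO T,
      ShA = (\<lambda>A. \<Union>(s, f) \<in> A. roof_class T S (ShA T s) (ShA T f)),
      Tri = {}\<rparr>"

definition verdier_quotient ::
  "('o, 'm, 'x) tri_cat_scheme \<Rightarrow> 'o set \<Rightarrow> ('o, ('m \<times> 'm) set) tri_cat" where
  "verdier_quotient T S = (verdier_precat T S)
     \<lparr>Tri := {t. \<exists>(u, v, w) \<in> Tri T. isomorphic_triangles (verdier_precat T S)
        (AMap (verdier_functor T S) u, AMap (verdier_functor T S) v, AMap (verdier_functor T S) w) t}\<rparr>"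

end

theory Submission
  imports Defs
begin

text \<open>Removing from an object of \<open>\<T>\<close> first its \<open>\<X>\<close>-part and then its \<open>\<Y>[1]\<close>-part changes it only
  by objects of \<open>\<S>\<close> and leads into \<open>\<Z>\<close>, so \<open>\<Z> \<rightarrow> \<U>\<close> is dense. As \<open>\<S> = \<X> * \<Y>\<close>, every morphism from
  an object of \<open>\<Z>\<close> to an object of \<open>\<S>\<close> factors through some \<open>A[1]\<close> with \<open>A \<in> \<X>\<close>. Hence in a fraction
  \<open>f s\<inverse>\<close> between objects of \<open>\<Z>\<close> the cone of \<open>s\<close> may be taken in \<open>\<X>[1]\<close>, and then \<open>f\<close> extends along \<open>s\<close>
  because there are no morphisms from \<open>\<X>\<close> to \<open>\<Z>\<close>: the functor is full. A morphism of \<open>\<Z>\<close> that vanishes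
  in \<open>\<U>\<close> factors through some \<open>A[1]\<close> with \<open>A \<in> \<X>\<close> and then through the \<open>\<Y>\<close>-part of \<open>A[1]\<close>, which is an
  extension of objects of \<open>\<X>[1]\<close> and so lies in \<open>\<P>\<close>.

  The quotient \<open>\<U>\<close> is triangulated because every commutative square and every composable pair of \<open>\<U>\<close> is
  isomorphic to one that comes from \<open>\<T>\<close>, and this structure is transported along the equivalence.\<close>

section \<open>Categories with explicit sources and targets\<close>

text \<open>Two obstacles shape the proof. The shift is only an autoequivalence, so there is no
  object \<open>C[-1]\<close>: every backward rotation starts from some \<open>B\<close> with an
  isomorphism from \<open>B[1]\<close> to \<open>C\<close>, and arrows are un-shifted by full
  faithfulness. For the same reason the shift on the ideal quotient is defined only up to chosen
  isomorphisms, which enter the third arrow of every triangle. The other obstacle is that TR3 in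
  \<open>U\<close> already needs a comparison map of cones to be invertible there. This comes from a
  five lemma for triangles that are merely exact under Hom, and such exactness passes from
  \<open>T\<close> to \<open>U\<close> by clearing denominators.

  The two halves of the definition of \<open>Z\<close> do different work. Shifting the torsion
  triangles of \<open>S\<close> decomposes its objects into an \<open>X[1]\<close>-part and a
  \<open>Y[1]\<close>-part; orthogonality of \<open>Z\<close> to \<open>Y[1]\<close> lets morphisms
  from \<open>Z\<close> to \<open>S\<close> lift to the \<open>X[1]\<close>-part. Orthogonality of
  \<open>X\<close> to \<open>Z\<close> kills the obstruction to extending a numerator, and makes
  morphisms from \<open>A[1]\<close> to \<open>Z\<close> descend to the \<open>Y\<close>-part of
  \<open>A[1]\<close>.\<close>

declare Hom_def [simp]

context category
begin

declare Src_in_Ob [simp] Tgt_in_Ob [simp]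

lemma Ident_simps [simp]:
  assumes "A \<in> Ob C"
  shows "Ident C A \<in> Arr C" "Src C (Ident C A) = A" "Tgt C (Ident C A) = A"
  using Ident_in_Hom[OF assms] by auto

lemma Comp_simps [simp]:
  assumes "f \<in> Arr C" "g \<in> Arr C" "Tgt C f = Src C g"
  shows "g \<cdot> f \<in> Arr C" "Src C (g \<cdot> f) = Src C f" "Tgt C (g \<cdot> f) = Tgt C g"
  using Comp_in_Hom[of f "Src C f" "Tgt C f" g "Tgt C g"] assms by auto

lemma Ident_rules [simp]:
  assumes "f \<in> Arr C"
  shows "Src C f = A \<Longrightarrow> f \<cdot> Ident C A = f" "Tgt C f = A \<Longrightarrow> Ident C A \<cdot> f = f"
  using Comp_Ident[of f "Src C f" "Tgt C f"] Ident_Comp[of f "Src C f" "Tgt C f"] assms by auto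

lemma assoc [simp]:
  assumes "f \<in> Arr C" "g \<in> Arr C" "h \<in> Arr C" "Tgt C f = Src C g" "Tgt C g = Src C h"
  shows "(h \<cdot> g) \<cdot> f = h \<cdot> (g \<cdot> f)"
  using Comp_assoc[of f "Src C f" "Tgt C f" g "Tgt C g" h "Tgt C h"] assms by auto

text \<open>The simp rule \<open>assoc\<close> nests composites to the right, which hides the
  left-hand side of an equation \<open>g \<cdot> f = k\<close> as soon as something is composed on
  its right. The rule \<open>e[THEN assoc_eq]\<close> is the form of such an equation
  \<open>e\<close> that still rewrites there.\<close>

lemma assoc_eq:
  assumes "g \<cdot> f = k" "f \<in> Arr C" "g \<in> Arr C" "x \<in> Arr C" "Tgt C x = Src C f" "Tgt C f = Src C g"
  shows "g \<cdot> (f \<cdot> x) = k \<cdot> x"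
  using assoc[OF assms(4,2,3,5,6)] assms(1) by simp

end

definition inv_arr :: "('o, 'm, 'x) cat_scheme \<Rightarrow> 'm \<Rightarrow> 'm" where
  "inv_arr C f = (SOME g. g \<in> Hom C (Tgt C f) (Src C f) \<and>
     g \<cdot>\<^bsub>C\<^esub> f = Ident C (Src C f) \<and> f \<cdot>\<^bsub>C\<^esub> g = Ident C (Tgt C f))"

lemma is_iso_Arr: "is_iso C f \<Longrightarrow> f \<in> Arr C"
  by (simp add: is_iso_def)

lemma inv_arr:
  assumes "is_iso C f"
  shows "inv_arr C f \<in> Hom C (Tgt C f) (Src C f) \<and>
    inv_arr C f \<cdot>\<^bsub>C\<^esub> f = Ident C (Src C f) \<and> f \<cdot>\<^bsub>C\<^esub> inv_arr C f = Ident C (Tgt C f)"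
  unfolding inv_arr_def
  by (rule someI_ex) (use assms in \<open>auto simp: is_iso_def\<close>)

context category
begin

lemma inv_simps [simp]:
  assumes "is_iso C f"
  shows "inv_arr C f \<in> Arr C" "Src C (inv_arr C f) = Tgt C f" "Tgt C (inv_arr C f) = Src C f"
    "inv_arr C f \<cdot> f = Ident C (Src C f)" "f \<cdot> inv_arr C f = Ident C (Tgt C f)"
  using inv_arr[OF assms] by auto

lemma is_isoI:
  assumes "f \<in> Arr C" "g \<in> Arr C" "Src C g = Tgt C f" "Tgt C g = Src C f"
    "g \<cdot> f = Ident C (Src C f)" "f \<cdot> g = Ident C (Tgt C f)"
  shows "is_iso C f"
  using assms by (auto simp: is_iso_def)

lemma is_iso_inv [simp]: "is_iso C f \<Longrightarrow> is_iso C (inv_arr C f)"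
  by (rule is_isoI[of _ f]) (simp_all add: is_iso_Arr)

lemma is_iso_Ident [simp]: "A \<in> Ob C \<Longrightarrow> is_iso C (Ident C A)"
  by (rule is_isoI[of _ "Ident C A"]) auto

lemma inv_cancel [simp]:
  assumes "is_iso C f" "x \<in> Arr C"
  shows "Tgt C x = Src C f \<Longrightarrow> inv_arr C f \<cdot> (f \<cdot> x) = x"
    and "Tgt C x = Tgt C f \<Longrightarrow> f \<cdot> (inv_arr C f \<cdot> x) = x"
  using assms is_iso_Arr[OF assms(1)] by (simp_all flip: assoc)

lemma is_iso_Comp [simp]:
  assumes "is_iso C f" "is_iso C g" "Tgt C f = Src C g"
  shows "is_iso C (g \<cdot> f)"
  by (rule is_isoI[of _ "inv_arr C f \<cdot> inv_arr C g"])
    (use assms in \<open>simp_all add: is_iso_Arr\<close>)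

lemma iso_cancel_left:
  assumes "is_iso C f" "x \<in> Arr C" "y \<in> Arr C" "Tgt C x = Src C f" "Tgt C y = Src C f" "f \<cdot> x = f \<cdot> y"
  shows "x = y"
  using arg_cong[OF assms(6), of "\<lambda>z. inv_arr C f \<cdot> z"] assms(1-5) by simp

lemma iso_cancel_right:
  assumes "is_iso C f" "x \<in> Arr C" "y \<in> Arr C" "Src C x = Tgt C f" "Src C y = Tgt C f" "x \<cdot> f = y \<cdot> f"
  shows "x = y"
  using arg_cong[OF assms(6), of "\<lambda>z. z \<cdot> inv_arr C f"] assms(1-5) by (simp add: is_iso_Arr)

lemma isomorphic_refl: "A \<in> Ob C \<Longrightarrow> isomorphic C A A"
  unfolding isomorphic_def by (intro bexI[of _ "Ident C A"]) auto

end

section \<open>Preadditive categories\<close>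

context preadditive_category
begin

lemma Zero_simps [simp]:
  assumes "A \<in> Ob C" "B \<in> Ob C"
  shows "Zero C A B \<in> Arr C" "Src C (Zero C A B) = A" "Tgt C (Zero C A B) = B"
proof -
  interpret G: comm_group "hom_group C A B" using assms by (rule comm_group_Hom)
  show "Zero C A B \<in> Arr C" "Src C (Zero C A B) = A" "Tgt C (Zero C A B) = B"
    using G.one_closed by (simp_all add: hom_group_def)
qed

lemma Add_simps [simp]:
  assumes "f \<in> Arr C" "g \<in> Arr C" "Src C f = Src C g" "Tgt C f = Tgt C g"
  shows "f \<boxplus> g \<in> Arr C" "Src C (f \<boxplus> g) = Src C g" "Tgt C (f \<boxplus> g) = Tgt C g"
proof -
  interpret G: comm_group "hom_group C (Src C g) (Tgt C g)" using assms by (simp add: comm_group_Hom)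
  show "f \<boxplus> g \<in> Arr C" "Src C (f \<boxplus> g) = Src C g" "Tgt C (f \<boxplus> g) = Tgt C g"
    using assms G.m_closed[of f g] by (simp_all add: hom_group_def)
qed

lemma Neg_simps [simp]:
  assumes "f \<in> Arr C"
  shows "Neg C f \<in> Arr C" "Src C (Neg C f) = Src C f" "Tgt C (Neg C f) = Tgt C f"
proof -
  interpret G: comm_group "hom_group C (Src C f) (Tgt C f)" using assms by (simp add: comm_group_Hom)
  have "Neg C f \<in> carrier (hom_group C (Src C f) (Tgt C f))"
    unfolding Neg_def using assms by (intro G.inv_closed) (simp add: hom_group_def)
  then show "Neg C f \<in> Arr C" "Src C (Neg C f) = Src C f" "Tgt C (Neg C f) = Tgt C f"
    by (simp_all add: hom_group_def)
qed

lemma Add_Zero [simp]: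
  assumes "f \<in> Arr C" "Src C f = A" "Tgt C f = B"
  shows "f \<boxplus> Zero C A B = f" "Zero C A B \<boxplus> f = f"
proof -
  interpret G: comm_group "hom_group C A B" using assms by (auto intro: comm_group_Hom)
  show "f \<boxplus> Zero C A B = f" "Zero C A B \<boxplus> f = f"
    using assms G.r_one[of f] G.l_one[of f] by (simp_all add: hom_group_def)
qed

lemma Add_Neg [simp]:
  assumes "f \<in> Arr C"
  shows "f \<boxplus> Neg C f = Zero C (Src C f) (Tgt C f)" "Neg C f \<boxplus> f = Zero C (Src C f) (Tgt C f)"
proof -
  interpret G: comm_group "hom_group C (Src C f) (Tgt C f)" using assms by (simp add: comm_group_Hom)
  have f: "f \<in> carrier (hom_group C (Src C f) (Tgt C f))" using assms by (simp add: hom_group_def)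
  show "f \<boxplus> Neg C f = Zero C (Src C f) (Tgt C f)" "Neg C f \<boxplus> f = Zero C (Src C f) (Tgt C f)"
    using G.r_inv[OF f] G.l_inv[OF f] by (simp_all add: Neg_def) (simp_all add: hom_group_def)
qed

lemma Add_assoc:
  assumes "f \<in> Arr C" "g \<in> Arr C" "h \<in> Arr C"
    "Src C f = Src C g" "Tgt C f = Tgt C g" "Src C g = Src C h" "Tgt C g = Tgt C h"
  shows "(f \<boxplus> g) \<boxplus> h = f \<boxplus> (g \<boxplus> h)"
proof -
  interpret G: comm_group "hom_group C (Src C h) (Tgt C h)" using assms by (simp add: comm_group_Hom)
  show ?thesis using assms G.m_assoc[of f g h] by (simp add: hom_group_def)
qed

lemma Add_commute:
  assumes "f \<in> Arr C" "g \<in> Arr C" "Src C f = Src C g" "Tgt C f = Tgt C g"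
  shows "f \<boxplus> g = g \<boxplus> f"
proof -
  interpret G: comm_group "hom_group C (Src C g) (Tgt C g)" using assms by (simp add: comm_group_Hom)
  show ?thesis using assms G.m_comm[of f g] by (simp add: hom_group_def)
qed

lemma Add_left_cancel:
  assumes "f \<in> Arr C" "g \<in> Arr C" "h \<in> Arr C"
    "Src C f = Src C g" "Tgt C f = Tgt C g" "Src C g = Src C h" "Tgt C g = Tgt C h"
    "f \<boxplus> g = f \<boxplus> h"
  shows "g = h"
  using arg_cong[OF assms(8), of "\<lambda>z. Neg C f \<boxplus> z"] assms(1-7) by (simp flip: Add_assoc)

lemma Neg_unique:
  assumes "f \<in> Arr C" "g \<in> Arr C" "Src C f = Src C g" "Tgt C f = Tgt C g"
    "f \<boxplus> g = Zero C (Src C f) (Tgt C f)"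
  shows "g = Neg C f"
  by (rule Add_left_cancel[of f]) (use assms in simp_all)

lemma Add_Neg_eq_Zero:
  assumes "f \<in> Arr C" "g \<in> Arr C" "Src C f = Src C g" "Tgt C f = Tgt C g"
    "f \<boxplus> Neg C g = Zero C (Src C g) (Tgt C g)"
  shows "f = g"
proof -
  have "Neg C g \<boxplus> f = Neg C g \<boxplus> g" using assms by (simp add: Add_commute[of "Neg C g" f])
  then show ?thesis using Add_left_cancel[of "Neg C g" f g] assms(1-4) by simp
qed

lemma Comp_Add [simp]:
  assumes "f \<in> Arr C" "g \<in> Arr C" "h \<in> Arr C" "Src C f = Src C g" "Tgt C f = Tgt C g"
  shows "Tgt C f = Src C h \<Longrightarrow> h \<cdot> (f \<boxplus> g) = h \<cdot> f \<boxplus> h \<cdot> g"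
    and "Tgt C h = Src C f \<Longrightarrow> (f \<boxplus> g) \<cdot> h = f \<cdot> h \<boxplus> g \<cdot> h"
  using Comp_Add_right[of f "Src C f" "Tgt C f" g h "Tgt C h"]
    Comp_Add_left[of h "Src C h" "Tgt C h" f "Tgt C f" g] assms by auto

lemma Add_self_eq_Zero:
  assumes "f \<in> Arr C" "f \<boxplus> f = f"
  shows "f = Zero C (Src C f) (Tgt C f)"
  by (rule Add_left_cancel[of f]) (use assms in simp_all)

lemma Comp_Zero [simp]:
  assumes "f \<in> Arr C" "B \<in> Ob C"
  shows "Tgt C f = A \<Longrightarrow> Zero C A B \<cdot> f = Zero C (Src C f) B"
    and "Src C f = A \<Longrightarrow> f \<cdot> Zero C B A = Zero C B (Tgt C f)"
proof -
  assume A: "Tgt C f = A"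
  have "Zero C A B \<cdot> f \<boxplus> Zero C A B \<cdot> f = Zero C A B \<cdot> f"
    using Comp_Add(2)[of "Zero C A B" "Zero C A B" f] assms A by fastforce
  then show "Zero C A B \<cdot> f = Zero C (Src C f) B"
    using Add_self_eq_Zero[of "Zero C A B \<cdot> f"] assms A by fastforce
next
  assume A: "Src C f = A"
  have "f \<cdot> Zero C B A \<boxplus> f \<cdot> Zero C B A = f \<cdot> Zero C B A"
    using Comp_Add(1)[of "Zero C B A" "Zero C B A" f] assms A by fastforce
  then show "f \<cdot> Zero C B A = Zero C B (Tgt C f)"
    using Add_self_eq_Zero[of "f \<cdot> Zero C B A"] assms A by fastforce
qed

lemma Comp_Neg [simp]:
  assumes "f \<in> Arr C" "g \<in> Arr C" "Tgt C f = Src C g"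
  shows "g \<cdot> Neg C f = Neg C (g \<cdot> f)" "Neg C g \<cdot> f = Neg C (g \<cdot> f)"
proof -
  have "g \<cdot> f \<boxplus> g \<cdot> Neg C f = Zero C (Src C f) (Tgt C g)"
    using assms Comp_Add(1)[of f "Neg C f" g] by simp
  then show "g \<cdot> Neg C f = Neg C (g \<cdot> f)" using assms by (intro Neg_unique) auto
  have "g \<cdot> f \<boxplus> Neg C g \<cdot> f = Zero C (Src C f) (Tgt C g)"
    using assms Comp_Add(2)[of g "Neg C g" f] by simp
  then show "Neg C g \<cdot> f = Neg C (g \<cdot> f)" using assms by (intro Neg_unique) auto
qed

lemma Neg_Neg [simp]: "f \<in> Arr C \<Longrightarrow> Neg C (Neg C f) = f"
  by (rule Neg_unique[symmetric]) simp_all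

lemma Neg_Zero [simp]: "\<lbrakk>A \<in> Ob C; B \<in> Ob C\<rbrakk> \<Longrightarrow> Neg C (Zero C A B) = Zero C A B"
  by (rule Neg_unique[symmetric]) simp_all

text \<open>If the identity of \<open>A\<close> is zero, every arrow into or out of \<open>A\<close>
  is zero, since it absorbs the identity. This equational form is the one that additive functors
  visibly preserve.\<close>

lemma zero_object_iff:
  assumes "A \<in> Ob C"
  shows "zero_object C A \<longleftrightarrow> Ident C A = Zero C A A"
proof
  assume "zero_object C A"
  then have "\<exists>!f. f \<in> Hom C A A" using assms unfolding zero_object_def by blast
  moreover have "Ident C A \<in> Hom C A A" "Zero C A A \<in> Hom C A A" using assms by simp_all
  ultimately show "Ident C A = Zero C A A" by blast
next
  assume *: "Ident C A = Zero C A A"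
  have 1: "\<exists>!f. f \<in> Hom C B A" if "B \<in> Ob C" for B
  proof (rule ex1I)
    show "Zero C B A \<in> Hom C B A" using assms that by simp
    show "f = Zero C B A" if "f \<in> Hom C B A" for f
      using Ident_rules(2)[of f A] that assms by (simp add: *)
  qed
  have 2: "\<exists>!f. f \<in> Hom C A B" if "B \<in> Ob C" for B
  proof (rule ex1I)
    show "Zero C A B \<in> Hom C A B" using assms that by simp
    show "f = Zero C A B" if "f \<in> Hom C A B" for f
      using Ident_rules(1)[of f A] that assms by (simp add: *)
  qed
  from 1 2 show "zero_object C A" using assms by (simp add: zero_object_def)
qed

lemma zero_object_Zero:
  assumes "zero_object C A" "f \<in> Arr C"
  shows "Src C f = A \<Longrightarrow> f = Zero C A (Tgt C f)" "Tgt C f = A \<Longrightarrow> f = Zero C (Src C f) A"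
proof -
  have A: "A \<in> Ob C" using assms by (simp add: zero_object_def)
  then have *: "Ident C A = Zero C A A" using assms zero_object_iff by blast
  show "f = Zero C A (Tgt C f)" if "Src C f = A"
    using Ident_rules(1)[OF assms(2) that] that assms A by (simp add: *)
  show "f = Zero C (Src C f) A" if "Tgt C f = A"
    using Ident_rules(2)[OF assms(2) that] that assms A by (simp add: *)
qed

end

section \<open>Functors\<close>

text \<open>Faithfulness compares only parallel arrows, since the functor may identify objects.
  Together with \<open>ess_surj\<close> this replaces the quasi-inverse in
  \<open>equivalence_functor\<close> by conditions that can be checked arrow by arrow.\<close>

definition fully_faithful :: "('o, 'm, 'x) cat_scheme \<Rightarrow> ('p, 'n, 'y) cat_scheme \<Rightarrow> ('o, 'm, 'p, 'n) ftor \<Rightarrow> bool" where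
  "fully_faithful C D F \<longleftrightarrow>
     (\<forall>f \<in> Arr C. \<forall>g \<in> Arr C. Src C f = Src C g \<and> Tgt C f = Tgt C g \<and> AMap F f = AMap F g \<longrightarrow> f = g) \<and>
     (\<forall>A \<in> Ob C. \<forall>B \<in> Ob C. \<forall>h \<in> Hom D (OMap F A) (OMap F B). \<exists>f \<in> Hom C A B. AMap F f = h)"

definition ess_surj :: "('o, 'm, 'x) cat_scheme \<Rightarrow> ('p, 'n, 'y) cat_scheme \<Rightarrow> ('o, 'm, 'p, 'n) ftor \<Rightarrow> bool" where
  "ess_surj C D F \<longleftrightarrow> (\<forall>B \<in> Ob D. \<exists>A \<in> Ob C. isomorphic D (OMap F A) B)"

locale cat_functor = C: category C + D: category D
  for C :: "('o, 'm, 'x) cat_scheme" and D :: "('p, 'n, 'y) cat_scheme" and F :: "('o, 'm, 'p, 'n) ftor" +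
  assumes is_functor: "is_functor C D F"
begin

lemma F_simps [simp]:
  shows "A \<in> Ob C \<Longrightarrow> OMap F A \<in> Ob D"
    and "f \<in> Arr C \<Longrightarrow> AMap F f \<in> Arr D"
    and "f \<in> Arr C \<Longrightarrow> Src D (AMap F f) = OMap F (Src C f)"
    and "f \<in> Arr C \<Longrightarrow> Tgt D (AMap F f) = OMap F (Tgt C f)"
    and "A \<in> Ob C \<Longrightarrow> AMap F (Ident C A) = Ident D (OMap F A)"
    and "\<lbrakk>f \<in> Arr C; g \<in> Arr C; Tgt C f = Src C g\<rbrakk> \<Longrightarrow> AMap F (g \<cdot>\<^bsub>C\<^esub> f) = AMap F g \<cdot>\<^bsub>D\<^esub> AMap F f"
  using is_functor by (auto simp: is_functor_def)

lemma F_inv: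
  assumes "is_iso C f"
  shows "is_iso D (AMap F f)" "inv_arr D (AMap F f) = AMap F (inv_arr C f)"
proof -
  have [simp]: "f \<in> Arr C" using assms by (rule is_iso_Arr)
  have e: "AMap F (inv_arr C f) \<cdot>\<^bsub>D\<^esub> AMap F f = Ident D (OMap F (Src C f))"
    "AMap F f \<cdot>\<^bsub>D\<^esub> AMap F (inv_arr C f) = Ident D (OMap F (Tgt C f))"
    using assms by (simp_all flip: F_simps(6))
  show i: "is_iso D (AMap F f)"
    by (rule D.is_isoI[of _ "AMap F (inv_arr C f)"]) (use assms e in simp_all)
  show "inv_arr D (AMap F f) = AMap F (inv_arr C f)"
    by (rule D.iso_cancel_left[OF i]) (use assms i e in simp_all)
qed

lemma fully_faithful_inj:
  "\<lbrakk>fully_faithful C D F; f \<in> Arr C; g \<in> Arr C; Src C f = Src C g; Tgt C f = Tgt C g; AMap F f = AMap F g\<rbrakk> \<Longrightarrow> f = g"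
  unfolding fully_faithful_def by blast

lemma fully_faithful_surj:
  assumes "fully_faithful C D F" "A \<in> Ob C" "B \<in> Ob C" "h \<in> Arr D" "Src D h = OMap F A" "Tgt D h = OMap F B"
  obtains f where "f \<in> Arr C" "Src C f = A" "Tgt C f = B" "AMap F f = h"
  using assms(1)[unfolded fully_faithful_def, THEN conjunct2, rule_format, of A B h] assms(2-) that by auto

lemma fully_faithful_reflects_iso:
  assumes fully_faithful: "fully_faithful C D F" and f: "f \<in> Arr C" and i: "is_iso D (AMap F f)"
  shows "is_iso C f"
proof -
  obtain g where g: "g \<in> Arr C" "Src C g = Tgt C f" "Tgt C g = Src C f" "AMap F g = inv_arr D (AMap F f)"
    using fully_faithful_surj[OF fully_faithful, of "Tgt C f" "Src C f" "inv_arr D (AMap F f)"] f i by auto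
  show ?thesis
    by (rule C.is_isoI[of _ g]; (rule fully_faithful_inj[OF fully_faithful])?) (use f g i in simp_all)
qed

text \<open>The quasi-inverse chooses for each \<open>B\<close> an object \<open>GO B\<close> with
  an isomorphism \<open>e B\<close> from its image to \<open>B\<close>, and lifts the conjugates of
  arrows by \<open>e\<close>. Identities in \<open>C\<close> are checked after applying
  \<open>F\<close>, by faithfulness.\<close>

lemma equivalence_functorI:
  assumes fully_faithful: "fully_faithful C D F" and es: "ess_surj C D F"
  shows "equivalence_functor C D F"
proof -
  define GO where "GO B = (SOME A. A \<in> Ob C \<and> isomorphic D (OMap F A) B)" for B
  have GO: "GO B \<in> Ob C \<and> isomorphic D (OMap F (GO B)) B" if "B \<in> Ob D" for B
    unfolding GO_def by (rule someI_ex) (use es that in \<open>auto simp: ess_surj_def\<close>)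
  define e where "e B = (SOME h. h \<in> Hom D (OMap F (GO B)) B \<and> is_iso D h)" for B
  have e: "e B \<in> Hom D (OMap F (GO B)) B \<and> is_iso D (e B)" if "B \<in> Ob D" for B
    unfolding e_def by (rule someI_ex) (use GO[OF that] in \<open>auto simp: isomorphic_def\<close>)
  define pre where "pre A B h = (SOME f. f \<in> Hom C A B \<and> AMap F f = h)" for A B h
  have pre: "pre A B h \<in> Hom C A B \<and> AMap F (pre A B h) = h"
    if h: "A \<in> Ob C" "B \<in> Ob C" "h \<in> Arr D" "Src D h = OMap F A" "Tgt D h = OMap F B" for A B h
  proof -
    obtain f where "f \<in> Hom C A B \<and> AMap F f = h" using fully_faithful_surj[OF fully_faithful h] by auto
    then show ?thesis unfolding pre_def by (rule someI)
  qed
  define GA where "GA g = pre (GO (Src D g)) (GO (Tgt D g)) (inv_arr D (e (Tgt D g)) \<cdot>\<^bsub>D\<^esub> (g \<cdot>\<^bsub>D\<^esub> e (Src D g)))" for g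
  have GA: "GA g \<in> Hom C (GO (Src D g)) (GO (Tgt D g)) \<and>
    AMap F (GA g) = inv_arr D (e (Tgt D g)) \<cdot>\<^bsub>D\<^esub> (g \<cdot>\<^bsub>D\<^esub> e (Src D g))" if "g \<in> Arr D" for g
    unfolding GA_def by (rule pre) (use that GO e in auto)
  define G where "G = \<lparr>OMap = GO, AMap = GA\<rparr>"
  have "is_functor D C G"
    unfolding is_functor_def
  proof (intro conjI ballI impI)
    show "AMap G (Ident D B) = Ident C (OMap G B)" if "B \<in> Ob D" for B
      by (rule fully_faithful_inj[OF fully_faithful]) (use that GO e GA in \<open>auto simp: G_def\<close>)
    show "AMap G (g \<cdot>\<^bsub>D\<^esub> f) = AMap G g \<cdot>\<^bsub>C\<^esub> AMap G f" if "f \<in> Arr D" "g \<in> Arr D" "Tgt D f = Src D g" for f g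
      by (rule fully_faithful_inj[OF fully_faithful]) (use that GO e GA in \<open>auto simp: G_def\<close>)
  qed (use GO GA C.category_axioms D.category_axioms in \<open>auto simp: G_def\<close>)
  moreover have "natural_iso C C id_functor (G \<circ>\<^sub>F F) (\<lambda>A. pre A (GO (OMap F A)) (inv_arr D (e (OMap F A))))"
    (is "natural_iso _ _ _ _ ?eta")
  proof -
    have eta: "?eta A \<in> Hom C A (GO (OMap F A)) \<and> AMap F (?eta A) = inv_arr D (e (OMap F A))" if "A \<in> Ob C" for A
      by (rule pre) (use that GO e in auto)
    show ?thesis
      unfolding natural_iso_def
    proof (intro conjI ballI)
      show "is_iso C (?eta A)" if "A \<in> Ob C" for A
        by (rule fully_faithful_reflects_iso[OF fully_faithful]) (use that eta e in auto)
      show "?eta (Tgt C f) \<cdot>\<^bsub>C\<^esub> AMap id_functor f = AMap (G \<circ>\<^sub>F F) f \<cdot>\<^bsub>C\<^esub> ?eta (Src C f)" if "f \<in> Arr C" for f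
        by (rule fully_faithful_inj[OF fully_faithful]) (use that GO e GA eta in \<open>auto simp: G_def id_functor_def comp_functor_def\<close>)
    qed (use eta in \<open>auto simp: G_def id_functor_def comp_functor_def\<close>)
  qed
  moreover have "natural_iso D D (F \<circ>\<^sub>F G) id_functor e"
    unfolding natural_iso_def using GO e GA by (auto simp: G_def id_functor_def comp_functor_def)
  ultimately show ?thesis unfolding equivalence_functor_def using is_functor by blast
qed

lemma equivalence_functorD:
  assumes "equivalence_functor C D F"
  shows "fully_faithful C D F" "ess_surj C D F"
proof -
  obtain G eta e where G: "is_functor D C G" and eta: "natural_iso C C id_functor (G \<circ>\<^sub>F F) eta"
    and e: "natural_iso D D (F \<circ>\<^sub>F G) id_functor e"
    using assms unfolding equivalence_functor_def by blast
  interpret G: cat_functor D C G using G by unfold_locales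
  have eta1 [simp]: "eta A \<in> Arr C" "Src C (eta A) = A" "Tgt C (eta A) = OMap G (OMap F A)" "is_iso C (eta A)"
    if "A \<in> Ob C" for A
    using eta that by (auto simp: natural_iso_def id_functor_def comp_functor_def)
  have eta2: "eta (Tgt C f) \<cdot>\<^bsub>C\<^esub> f = AMap G (AMap F f) \<cdot>\<^bsub>C\<^esub> eta (Src C f)" if "f \<in> Arr C" for f
    using eta that by (auto simp: natural_iso_def id_functor_def comp_functor_def)
  have e1 [simp]: "e A \<in> Arr D" "Tgt D (e A) = A" "Src D (e A) = OMap F (OMap G A)" "is_iso D (e A)"
    if "A \<in> Ob D" for A
    using e that by (auto simp: natural_iso_def id_functor_def comp_functor_def)
  have e2: "e (Tgt D f) \<cdot>\<^bsub>D\<^esub> AMap F (AMap G f) = f \<cdot>\<^bsub>D\<^esub> e (Src D f)" if "f \<in> Arr D" for f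
    using e that by (auto simp: natural_iso_def id_functor_def comp_functor_def)
  \<comment> \<open>Naturality of \<open>eta\<close> recovers \<open>f\<close> from
    \<open>AMap F f\<close>, because \<open>eta\<close> is invertible; naturality of
    \<open>e\<close> does the same for \<open>G\<close>.\<close>
  have F_inj: "f = g" if "f \<in> Arr C" "g \<in> Arr C" "Src C f = Src C g" "Tgt C f = Tgt C g" "AMap F f = AMap F g" for f g
    by (rule C.iso_cancel_left[of "eta (Tgt C g)"]) (use that eta2[of f] eta2[of g] in simp_all)
  have G_inj: "f = g" if "f \<in> Arr D" "g \<in> Arr D" "Src D f = Src D g" "Tgt D f = Tgt D g" "AMap G f = AMap G g" for f g
    by (rule D.iso_cancel_right[of "e (Src D g)"]) (use that e2[of f] e2[of g] in simp_all)
  show "fully_faithful C D F"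
    unfolding fully_faithful_def
  proof (intro conjI ballI impI)
    show "f = g" if "f \<in> Arr C" "g \<in> Arr C" "Src C f = Src C g \<and> Tgt C f = Tgt C g \<and> AMap F f = AMap F g" for f g
      using F_inj[of f g] that by simp
    fix A B h assume *: "A \<in> Ob C" "B \<in> Ob C" "h \<in> Hom D (OMap F A) (OMap F B)"
    \<comment> \<open>Naturality of \<open>eta\<close> forces this formula for a preimage of
      \<open>h\<close>. It makes \<open>G\<close> agree on \<open>AMap F f\<close> and
      \<open>h\<close>, so faithfulness of \<open>G\<close> finishes.\<close>
    define f where "f = inv_arr C (eta B) \<cdot>\<^bsub>C\<^esub> (AMap G h \<cdot>\<^bsub>C\<^esub> eta A)"
    have f: "f \<in> Arr C" "Src C f = A" "Tgt C f = B" "eta B \<cdot>\<^bsub>C\<^esub> f = AMap G h \<cdot>\<^bsub>C\<^esub> eta A"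
      using * by (simp_all add: f_def)
    have "AMap G (AMap F f) \<cdot>\<^bsub>C\<^esub> eta A = AMap G h \<cdot>\<^bsub>C\<^esub> eta A"
      using eta2[of f] f by simp
    from C.iso_cancel_right[OF _ _ _ _ _ this] have "AMap G (AMap F f) = AMap G h"
      using f(1-3) * by simp
    from G_inj[OF _ _ _ _ this] have "AMap F f = h" using f(1-3) * by simp
    then show "\<exists>f \<in> Hom C A B. AMap F f = h" using f by (intro bexI[of _ f]) simp_all
  qed
  show "ess_surj C D F"
    unfolding ess_surj_def isomorphic_def
  proof
    fix B assume "B \<in> Ob D"
    then show "\<exists>A\<in>Ob C. \<exists>f\<in>Hom D (OMap F A) B. is_iso D f"
      by (intro bexI[of _ "OMap G B"] bexI[of _ "e B"]) simp_all
  qed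
qed

end

locale add_functor = cat_functor C D F + C: preadditive_category C + D: preadditive_category D
  for C :: "('o, 'm, 'x) add_cat_scheme" and D :: "('p, 'n, 'y) add_cat_scheme" and F :: "('o, 'm, 'p, 'n) ftor" +
  assumes F_Add [simp]: "\<lbrakk>f \<in> Arr C; g \<in> Arr C; Src C f = Src C g; Tgt C f = Tgt C g\<rbrakk>
    \<Longrightarrow> AMap F (f \<boxplus>\<^bsub>C\<^esub> g) = AMap F f \<boxplus>\<^bsub>D\<^esub> AMap F g"
begin

lemma F_Zero [simp]:
  assumes "A \<in> Ob C" "B \<in> Ob C"
  shows "AMap F (Zero C A B) = Zero D (OMap F A) (OMap F B)"
proof -
  have "AMap F (Zero C A B) = AMap F (Zero C A B) \<boxplus>\<^bsub>D\<^esub> AMap F (Zero C A B)"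
    using F_Add[of "Zero C A B" "Zero C A B"] assms by simp
  from D.Add_self_eq_Zero[OF _ this[symmetric]] show ?thesis using assms by simp
qed

lemma F_Neg [simp]:
  assumes "f \<in> Arr C"
  shows "AMap F (Neg C f) = Neg D (AMap F f)"
proof (rule D.Neg_unique)
  show "AMap F f \<boxplus>\<^bsub>D\<^esub> AMap F (Neg C f) = Zero D (Src D (AMap F f)) (Tgt D (AMap F f))"
    using F_Add[of f "Neg C f"] assms by simp
qed (use assms in simp_all)

lemma F_zero_object:
  assumes "zero_object C A"
  shows "zero_object D (OMap F A)"
proof -
  have A: "A \<in> Ob C" using assms by (simp add: zero_object_def)
  then have "AMap F (Ident C A) = AMap F (Zero C A A)" using assms C.zero_object_iff by simp
  then show ?thesis using D.zero_object_iff[of "OMap F A"] A by simp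
qed

end

lemma additive_functor_imp_locale:
  assumes "additive_functor C D F"
  shows "add_functor C D F" "additive_category C" "additive_category D"
proof -
  show a: "additive_category C" "additive_category D" using assms by (simp_all add: additive_functor_def)
  interpret C: additive_category C by fact
  interpret D: additive_category D by fact
  show "add_functor C D F"
    by unfold_locales (use assms in \<open>auto simp: additive_functor_def\<close>)
qed

section \<open>Exact triangles and the five lemma\<close>

text \<open>Only the additive structure and the shift are required, so that the Verdier quotient and
  the transported category can enter this locale while their triangle axioms are still to be
  proved.\<close>

locale shift_category = additive_category T
  for T :: "('o, 'm, 'x) tri_cat_scheme" (structure) +
  assumes shift_equiv: "additive_equivalence T T (shift_functor T)"
begin

sublocale Sh: add_functor T T "shift_functor T"
  using shift_equiv by (auto simp: additive_equivalence_def intro: additive_functor_imp_locale)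

lemma shift_sel [simp]: "OMap (shift_functor T) = ShO T" "AMap (shift_functor T) = ShA T"
  by (simp_all add: shift_functor_def)

lemmas Sh_simps [simp] = Sh.F_simps[simplified] Sh.F_Zero[simplified] Sh.F_Neg[simplified] Sh.F_Add[simplified]

lemma Sh_fully_faithful: "fully_faithful T T (shift_functor T)" and Sh_ess_surj: "ess_surj T T (shift_functor T)"
  using Sh.equivalence_functorD shift_equiv by (auto simp: additive_equivalence_def)

lemma Sh_faithful:
  "\<lbrakk>ShA T f = ShA T g; f \<in> Arr T; g \<in> Arr T; Src T f = Src T g; Tgt T f = Tgt T g\<rbrakk> \<Longrightarrow> f = g"
  using Sh.fully_faithful_inj[OF Sh_fully_faithful, of f g] by simp

lemma Sh_full:
  assumes "h \<in> Arr T" "Src T h = ShO T A" "Tgt T h = ShO T B" "A \<in> Ob T" "B \<in> Ob T"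
  shows "\<exists>f. f \<in> Arr T \<and> Src T f = A \<and> Tgt T f = B \<and> ShA T f = h"
proof -
  obtain f where "f \<in> Arr T" "Src T f = A" "Tgt T f = B" "ShA T f = h"
    using Sh.fully_faithful_surj[OF Sh_fully_faithful assms(4,5,1)] assms(2,3) by auto
  then show ?thesis by blast
qed

text \<open>Substitute for desuspension: as the shift need not be bijective on objects, an object is
  a shift only up to a chosen isomorphism \<open>i\<close>.\<close>

lemma Sh_onto:
  assumes "A \<in> Ob T"
  shows "\<exists>B i. B \<in> Ob T \<and> is_iso T i \<and> Src T i = ShO T B \<and> Tgt T i = A"
proof -
  obtain B where B: "B \<in> Ob T" "isomorphic T (ShO T B) A" using Sh_ess_surj assms by (auto simp: ess_surj_def)
  then obtain i where "i \<in> Hom T (ShO T B) A" "is_iso T i" unfolding isomorphic_def by blast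
  with B show ?thesis unfolding Hom_def by blast
qed

lemma Sh_iso: "is_iso T f \<Longrightarrow> is_iso T (ShA T f)" "is_iso T f \<Longrightarrow> inv_arr T (ShA T f) = ShA T (inv_arr T f)"
  using Sh.F_inv by simp_all

lemma Sh_reflects_iso: "\<lbrakk>f \<in> Arr T; is_iso T (ShA T f)\<rbrakk> \<Longrightarrow> is_iso T f"
  using Sh.fully_faithful_reflects_iso[OF Sh_fully_faithful] by simp

lemma square_inv:
  assumes "is_iso T a" "is_iso T b" "b \<cdot> u = u' \<cdot> a" "u \<in> Arr T" "u' \<in> Arr T"
    "Tgt T a = Src T u'" "Src T b = Tgt T u" "Tgt T b = Tgt T u'" "Src T a = Src T u"
  shows "inv_arr T b \<cdot> u' = u \<cdot> inv_arr T a"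
proof (rule iso_cancel_right[OF assms(1)])
  have [simp]: "a \<in> Arr T" "b \<in> Arr T" using assms by (auto intro: is_iso_Arr)
  have "(inv_arr T b \<cdot> u') \<cdot> a = inv_arr T b \<cdot> (b \<cdot> u)" using assms by simp
  then show "(inv_arr T b \<cdot> u') \<cdot> a = (u \<cdot> inv_arr T a) \<cdot> a" using assms(1,2,4-) by simp
qed (use assms in simp_all)

lemma isomorphic_triangles_sym:
  assumes "isomorphic_triangles T t t'"
  shows "isomorphic_triangles T t' t"
proof -
  obtain u v w u' v' w' where t: "t = (u, v, w)" "t' = (u', v', w')" by (cases t; cases t')
  obtain a b c where i: "is_iso T a" "is_iso T b" "is_iso T c"
    and m: "triangle_morphism T (u, v, w) (u', v', w') (a, b, c)"
    and c: "candidate_triangle T (u, v, w)" "candidate_triangle T (u', v', w')"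
    using assms unfolding isomorphic_triangles_def t by blast
  have "triangle_morphism T (u', v', w') (u, v, w) (inv_arr T a, inv_arr T b, inv_arr T c)"
    using i m c square_inv[of a b u u'] square_inv[of b c v v'] square_inv[of c "ShA T a" w w']
    by (simp add: Sh_iso)
  then show ?thesis unfolding isomorphic_triangles_def t using c i is_iso_inv by blast
qed

lemma isomorphic_triangles_trans:
  assumes "isomorphic_triangles T t t'" "isomorphic_triangles T t' t''"
  shows "isomorphic_triangles T t t''"
proof -
  obtain u v w u' v' w' u'' v'' w'' where t: "t = (u, v, w)" "t' = (u', v', w')" "t'' = (u'', v'', w'')"
    by (cases t; cases t'; cases t'')
  obtain a b c where i: "is_iso T a" "is_iso T b" "is_iso T c"
    and m: "triangle_morphism T (u, v, w) (u', v', w') (a, b, c)"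
    and c: "candidate_triangle T (u, v, w)" "candidate_triangle T (u', v', w')"
    using assms(1) unfolding isomorphic_triangles_def t by blast
  obtain a' b' c' where i': "is_iso T a'" "is_iso T b'" "is_iso T c'"
    and m': "triangle_morphism T (u', v', w') (u'', v'', w'') (a', b', c')"
    and c': "candidate_triangle T (u'', v'', w'')"
    using assms(2) unfolding isomorphic_triangles_def t by blast
  have m1: "b \<cdot> u = u' \<cdot> a" "c \<cdot> v = v' \<cdot> b" "ShA T a \<cdot> w = w' \<cdot> c"
    and m2: "b' \<cdot> u' = u'' \<cdot> a'" "c' \<cdot> v' = v'' \<cdot> b'" "ShA T a' \<cdot> w' = w'' \<cdot> c'"
    using m m' by simp_all
  have "triangle_morphism T (u, v, w) (u'', v'', w'') (a' \<cdot> a, b' \<cdot> b, c' \<cdot> c)"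
    using c c' m m' by (simp add: m1 m2[THEN assoc_eq])
  moreover have "is_iso T (a' \<cdot> a)" "is_iso T (b' \<cdot> b)" "is_iso T (c' \<cdot> c)"
    using i i' m m' c c' by simp_all
  ultimately show ?thesis unfolding isomorphic_triangles_def t using c c' by blast
qed

lemma isomorphic_triangles_refl:
  assumes "candidate_triangle T t"
  shows "isomorphic_triangles T t t"
proof -
  obtain u v w where t: "t = (u, v, w)" by (cases t)
  have "triangle_morphism T t t (Ident T (Src T u), Ident T (Src T v), Ident T (Src T w))"
    using assms by (simp add: t)
  then show ?thesis unfolding isomorphic_triangles_def using assms
    by (intro conjI exI[of _ "Ident T (Src T u)"] exI[of _ "Ident T (Src T v)"] exI[of _ "Ident T (Src T w)"])
      (simp_all add: t)
qed

end

text \<open>The factorisation \<open>g\<close> need not be unique. For composable arrows the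
  condition says that Hom(A, -) makes \<open>u\<close>, \<open>v\<close> an exact sequence for every
  object A.\<close>

definition weak_kernel :: "('o, 'm, 'x) add_cat_scheme \<Rightarrow> 'm \<Rightarrow> 'm \<Rightarrow> bool" where
  "weak_kernel C u v \<longleftrightarrow> v \<cdot>\<^bsub>C\<^esub> u = Zero C (Src C u) (Tgt C v) \<and>
     (\<forall>f \<in> Arr C. Tgt C f = Src C v \<and> v \<cdot>\<^bsub>C\<^esub> f = Zero C (Src C f) (Tgt C v) \<longrightarrow>
        (\<exists>g \<in> Hom C (Src C f) (Src C u). f = u \<cdot>\<^bsub>C\<^esub> g))"

lemma weak_kernelD:
  assumes "weak_kernel C u v"
  shows "v \<cdot>\<^bsub>C\<^esub> u = Zero C (Src C u) (Tgt C v)"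
  using assms by (simp add: weak_kernel_def)

lemma weak_kernel_factor:
  assumes "weak_kernel C u v" "f \<in> Arr C" "Tgt C f = Src C v" "v \<cdot>\<^bsub>C\<^esub> f = Zero C A B" "Src C f = A" "Tgt C v = B"
  shows "\<exists>g. g \<in> Arr C \<and> Src C g = A \<and> Tgt C g = Src C u \<and> f = u \<cdot>\<^bsub>C\<^esub> g"
proof -
  have "\<exists>g \<in> Hom C (Src C f) (Src C u). f = u \<cdot>\<^bsub>C\<^esub> g"
    using assms(1) unfolding weak_kernel_def by (metis assms(2-))
  then show ?thesis unfolding Hom_def assms(5) by blast
qed

text \<open>These three conditions are the part of the long exact Hom sequence that the five lemma
  uses. The sign of the rotated arrow is omitted, as it does not affect which arrows are
  killed.\<close>

fun exact_triangle :: "('o, 'm, 'x) tri_cat_scheme \<Rightarrow> 'm \<times> 'm \<times> 'm \<Rightarrow> bool" where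
  "exact_triangle T (u, v, w) \<longleftrightarrow> candidate_triangle T (u, v, w) \<and>
     weak_kernel T u v \<and> weak_kernel T v w \<and> weak_kernel T w (ShA T u)"

context shift_category
begin

text \<open>Only exactness is required, so the lemma is available in the Verdier quotient before the axioms
  of a triangulated category are known there.\<close>

lemma five_lemma:
  assumes t: "exact_triangle T (u, v, w)" and t': "exact_triangle T (u', v', w')"
    and m: "triangle_morphism T (u, v, w) (u', v', w') (a, b, c)" and ia: "is_iso T a" and ib: "is_iso T b"
  shows "is_iso T c"
proof -
  have ty [simp]: "u \<in> Arr T" "v \<in> Arr T" "w \<in> Arr T" "Tgt T u = Src T v" "Tgt T v = Src T w"
     "Tgt T w = ShO T (Src T u)" "u' \<in> Arr T" "v' \<in> Arr T" "w' \<in> Arr T" "Tgt T u' = Src T v'"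
     "Tgt T v' = Src T w'" "Tgt T w' = ShO T (Src T u')" "a \<in> Arr T" "b \<in> Arr T" "c \<in> Arr T"
     "Src T a = Src T u" "Src T b = Src T v" "Src T c = Src T w"
     "Tgt T a = Src T u'" "Tgt T b = Src T v'" "Tgt T c = Src T w'"
    using t t' m by simp_all
  have e: "b \<cdot> u = u' \<cdot> a" "c \<cdot> v = v' \<cdot> b" "ShA T a \<cdot> w = w' \<cdot> c" using m by simp_all
  have k: "weak_kernel T u v" "weak_kernel T v w" "weak_kernel T w (ShA T u)" using t by simp_all
  have k': "weak_kernel T u' v'" "weak_kernel T v' w'" "weak_kernel T w' (ShA T u')" using t' by simp_all
  note z = k[THEN weak_kernelD, simplified] and z' = k'[THEN weak_kernelD, simplified]
  note ze = z[THEN assoc_eq] z'[THEN assoc_eq]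
  note [simp] = ia ib Sh_iso(1)[OF ia] Sh_iso(1)[OF ib]
  \<comment> \<open>First approximation to a right inverse of \<open>c\<close>: compatibility with
    \<open>w'\<close> and \<open>ShA T a\<close> demands an \<open>m0\<close> with
    \<open>w \<cdot> m0 = k0\<close>.\<close>
  define k0 where "k0 = inv_arr T (ShA T a) \<cdot> w'"
  have k0 [simp]: "k0 \<in> Arr T" "Src T k0 = Src T w'" "Tgt T k0 = ShO T (Src T u)"
    by (simp_all add: k0_def)
  have ak0: "ShA T a \<cdot> k0 = w'" by (simp add: k0_def)
  have "ShA T u \<cdot> k0 = Zero T (Src T w') (ShO T (Src T v))"
  proof (rule iso_cancel_left[OF Sh_iso(1)[OF ib]])
    have "ShA T b \<cdot> ShA T u = ShA T u' \<cdot> ShA T a" using arg_cong[OF e(1), of "ShA T"] by simp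
    from assoc_eq[OF this, of k0]
    show "ShA T b \<cdot> (ShA T u \<cdot> k0) = ShA T b \<cdot> Zero T (Src T w') (ShO T (Src T v))"
      by (simp add: ak0 z')
  qed simp_all
  from weak_kernel_factor[OF k(3) _ _ this] obtain m0 where m0 [simp]: "m0 \<in> Arr T" "Src T m0 = Src T w'"
    "Tgt T m0 = Src T w" and km0: "k0 = w \<cdot> m0" by (simp (no_asm_use)) blast
  \<comment> \<open>The defect of \<open>m0\<close> as a right inverse of \<open>c\<close>. It is
    killed by \<open>w'\<close>, hence comes from \<open>v'\<close>; lifting it through the
    isomorphism \<open>b\<close> corrects \<open>m0\<close> to \<open>g\<close>.\<close>
  let ?h = "Ident T (Src T w') \<boxplus> Neg T (c \<cdot> m0)"
  have "w' \<cdot> ?h = Zero T (Src T w') (ShO T (Src T u'))"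
  proof -
    have "w' \<cdot> (c \<cdot> m0) = w'" using assoc_eq[OF e(3), of m0] ak0 by (simp add: km0)
    then show ?thesis by simp
  qed
  from weak_kernel_factor[OF k'(2) _ _ this] obtain n where n [simp]: "n \<in> Arr T" "Src T n = Src T w'"
    "Tgt T n = Src T v'" and hn: "?h = v' \<cdot> n" by (simp (no_asm_use)) blast
  define g where "g = m0 \<boxplus> v \<cdot> (inv_arr T b \<cdot> n)"
  have g [simp]: "g \<in> Arr T" "Src T g = Src T w'" "Tgt T g = Src T w" by (simp_all add: g_def)
  have cg: "c \<cdot> g = Ident T (Src T w')"
  proof -
    have "c \<cdot> g = c \<cdot> m0 \<boxplus> v' \<cdot> n" by (simp add: g_def e(2)[THEN assoc_eq])
    also have "\<dots> = ?h \<boxplus> c \<cdot> m0" unfolding hn[symmetric] by (rule Add_commute) simp_all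
    also have "\<dots> = Ident T (Src T w')" by (simp add: Add_assoc)
    finally show ?thesis .
  qed
  \<comment> \<open>\<open>c\<close> has trivial kernel, by a diagram chase. Applied to
    \<open>g \<cdot> c\<close> minus the identity this makes the right inverse \<open>g\<close>
    two-sided.\<close>
  have mono: "f = Zero T (Src T f) (Src T w)"
    if f [simp]: "f \<in> Arr T" "Tgt T f = Src T w" and cf: "c \<cdot> f = Zero T (Src T f) (Src T w')" for f
  proof -
    have "w \<cdot> f = Zero T (Src T f) (ShO T (Src T u))"
      by (rule iso_cancel_left[OF Sh_iso(1)[OF ia]]) (simp_all add: e(3)[THEN assoc_eq] cf)
    from weak_kernel_factor[OF k(2) _ _ this] obtain n where n [simp]: "n \<in> Arr T" "Src T n = Src T f"
      "Tgt T n = Src T v" and fn: "f = v \<cdot> n" by (simp (no_asm_use)) blast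
    have "v' \<cdot> (b \<cdot> n) = Zero T (Src T f) (Src T w')"
      using cf unfolding fn by (simp add: e(2)[THEN assoc_eq])
    from weak_kernel_factor[OF k'(1) _ _ this] obtain l where l [simp]: "l \<in> Arr T" "Src T l = Src T f"
      "Tgt T l = Src T u'" and bn: "b \<cdot> n = u' \<cdot> l" by (simp (no_asm_use)) blast
    have "n = u \<cdot> (inv_arr T a \<cdot> l)"
      by (rule iso_cancel_left[OF ib]) (simp_all add: e(1)[THEN assoc_eq] bn)
    then show ?thesis using fn by (simp add: z(1)[THEN assoc_eq])
  qed
  have gc: "g \<cdot> c = Ident T (Src T w)"
  proof (rule Add_Neg_eq_Zero)
    have "c \<cdot> (g \<cdot> c \<boxplus> Neg T (Ident T (Src T w))) = Zero T (Src T w) (Src T w')"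
      by (simp add: cg[THEN assoc_eq])
    then show "g \<cdot> c \<boxplus> Neg T (Ident T (Src T w)) = Zero T (Src T (Ident T (Src T w))) (Tgt T (Ident T (Src T w)))"
      using mono[of "g \<cdot> c \<boxplus> Neg T (Ident T (Src T w))"] by simp
  qed simp_all
  show ?thesis by (rule is_isoI[of _ g]) (simp_all add: gc cg)
qed

text \<open>Reduces the octahedral axiom in the Verdier quotient to arrows that come from \<open>T\<close>.\<close>

lemma octahedron_iso_invariant:
  assumes ex: "\<And>t. t \<in> Tri T \<Longrightarrow> exact_triangle T t"
    and iso: "\<And>t t'. \<lbrakk>t \<in> Tri T; isomorphic_triangles T t t'\<rbrakk> \<Longrightarrow> t' \<in> Tri T"
    and TR3: "\<And>u v w u' v' w' a b. \<lbrakk>(u, v, w) \<in> Tri T; (u', v', w') \<in> Tri T;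
        a \<in> Hom T (Src T u) (Src T u'); b \<in> Hom T (Tgt T u) (Tgt T u'); b \<cdot> u = u' \<cdot> a\<rbrakk>
      \<Longrightarrow> \<exists>c. triangle_morphism T (u, v, w) (u', v', w') (a, b, c)"
    and [simp]: "u \<in> Arr T" "v \<in> Arr T" "Tgt T u = Src T v"
    and t: "(u, p, d) \<in> Tri T" "(v, q, e) \<in> Tri T" "(v \<cdot> u, r, k) \<in> Tri T"
    and [simp]: "u' \<in> Arr T" "v' \<in> Arr T" "Tgt T u' = Src T v'"
    and t': "(u', p', d') \<in> Tri T" "(v', q', e') \<in> Tri T" "(v' \<cdot> u', r', k') \<in> Tri T"
    and oct: "(a', b', ShA T p' \<cdot> e') \<in> Tri T"
      "triangle_morphism T (u', p', d') (v' \<cdot> u', r', k') (Ident T (Src T u'), v', a')"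
      "triangle_morphism T (v' \<cdot> u', r', k') (v', q', e') (u', Ident T (Tgt T v'), b')"
    and i [simp]: "is_iso T x" "is_iso T y" "is_iso T z"
    and [simp]: "Src T x = Src T u" "Tgt T x = Src T u'" "Src T y = Src T v" "Tgt T y = Src T v'"
      "Src T z = Tgt T v" "Tgt T z = Tgt T v'"
    and yu: "y \<cdot> u = u' \<cdot> x" and zv: "z \<cdot> v = v' \<cdot> y"
  shows "\<exists>a b. (a, b, ShA T p \<cdot> e) \<in> Tri T \<and>
            triangle_morphism T (u, p, d) (v \<cdot> u, r, k) (Ident T (Src T u), v, a) \<and>
            triangle_morphism T (v \<cdot> u, r, k) (v, q, e) (u, Ident T (Tgt T v), b)"
proof -
  have xyz [simp]: "x \<in> Arr T" "y \<in> Arr T" "z \<in> Arr T" using i by (auto intro: is_iso_Arr)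
  have ty [simp]: "p \<in> Arr T" "d \<in> Arr T" "q \<in> Arr T" "e \<in> Arr T" "r \<in> Arr T" "k \<in> Arr T"
    "Src T p = Src T v" "Tgt T p = Src T d" "Tgt T d = ShO T (Src T u)"
    "Src T q = Tgt T v" "Tgt T q = Src T e" "Tgt T e = ShO T (Src T v)"
    "Src T r = Tgt T v" "Tgt T r = Src T k" "Tgt T k = ShO T (Src T u)"
    using t[THEN ex] by simp_all
  have ty' [simp]: "p' \<in> Arr T" "d' \<in> Arr T" "q' \<in> Arr T" "e' \<in> Arr T" "r' \<in> Arr T" "k' \<in> Arr T"
    "Src T p' = Src T v'" "Tgt T p' = Src T d'" "Tgt T d' = ShO T (Src T u')"
    "Src T q' = Tgt T v'" "Tgt T q' = Src T e'" "Tgt T e' = ShO T (Src T v')"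
    "Src T r' = Tgt T v'" "Tgt T r' = Src T k'" "Tgt T k' = ShO T (Src T u')"
    using t'[THEN ex] by simp_all
  have ab' [simp]: "a' \<in> Arr T" "Src T a' = Src T d'" "Tgt T a' = Src T k'"
     "b' \<in> Arr T" "Src T b' = Src T k'" "Tgt T b' = Src T e'"
    using oct(2,3) unfolding triangle_morphism.simps Hom_def by blast+
  have o': "a' \<cdot> p' = r' \<cdot> v'" "ShA T (Ident T (Src T u')) \<cdot> d' = k' \<cdot> a'"
    "b' \<cdot> r' = q' \<cdot> Ident T (Tgt T v')" "ShA T u' \<cdot> k' = e' \<cdot> b'"
    using oct(2,3) unfolding triangle_morphism.simps by blast+
  have o: "a' \<cdot> p' = r' \<cdot> v'" "k' \<cdot> a' = d'" "b' \<cdot> r' = q'" "e' \<cdot> b' = ShA T u' \<cdot> k'"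
    using o'(1) o'(2)[symmetric] o'(3) o'(4)[symmetric] by simp_all
  \<comment> \<open>TR3 extends \<open>x\<close>, \<open>y\<close>, \<open>z\<close> to comparison
    maps of the three cones, and the five lemma makes these invertible.\<close>
  obtain al where al: "triangle_morphism T (u, p, d) (u', p', d') (x, y, al)"
    using TR3[OF t(1) t'(1), of x y] yu by auto
  obtain be where be: "triangle_morphism T (v, q, e) (v', q', e') (y, z, be)"
    using TR3[OF t(2) t'(2), of y z] zv by auto
  obtain ga where ga: "triangle_morphism T (v \<cdot> u, r, k) (v' \<cdot> u', r', k') (x, z, ga)"
    using TR3[OF t(3) t'(3), of x z] yu zv[THEN assoc_eq] by auto
  have abg [simp]: "al \<in> Arr T" "Src T al = Src T d" "Tgt T al = Src T d'"
     "be \<in> Arr T" "Src T be = Src T e" "Tgt T be = Src T e'"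
     "ga \<in> Arr T" "Src T ga = Src T k" "Tgt T ga = Src T k'"
    using al be ga by simp_all
  have [simp]: "is_iso T al" "is_iso T be" "is_iso T ga"
    using five_lemma[OF t(1)[THEN ex] t'(1)[THEN ex] al] five_lemma[OF t(2)[THEN ex] t'(2)[THEN ex] be]
      five_lemma[OF t(3)[THEN ex] t'(3)[THEN ex] ga] by simp_all
  have m: "al \<cdot> p = p' \<cdot> y" "be \<cdot> q = q' \<cdot> z" "ga \<cdot> r = r' \<cdot> z"
      "ShA T x \<cdot> d = d' \<cdot> al" "ShA T y \<cdot> e = e' \<cdot> be" "ShA T x \<cdot> k = k' \<cdot> ga"
    using al be ga by simp_all
  have sh: "ShA T al \<cdot> ShA T p = ShA T p' \<cdot> ShA T y" "ShA T y \<cdot> ShA T u = ShA T u' \<cdot> ShA T x"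
    using arg_cong[OF m(1), of "ShA T"] arg_cong[OF yu, of "ShA T"] by simp_all
  \<comment> \<open>The octahedron of \<open>u'\<close>, \<open>v'\<close> is carried back by
    conjugation with the comparison maps of the cones.\<close>
  define a where "a = inv_arr T ga \<cdot> (a' \<cdot> al)"
  define b where "b = inv_arr T be \<cdot> (b' \<cdot> ga)"
  have ab [simp]: "a \<in> Arr T" "Src T a = Src T d" "Tgt T a = Src T k"
     "b \<in> Arr T" "Src T b = Src T k" "Tgt T b = Src T e"
    by (simp_all add: a_def b_def)
  have gb: "ga \<cdot> a = a' \<cdot> al" "be \<cdot> b = b' \<cdot> ga" by (simp_all add: a_def b_def)
  note rw = o m sh gb yu zv and rwa = o[THEN assoc_eq] m[THEN assoc_eq] sh[THEN assoc_eq]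
    gb[THEN assoc_eq] yu[THEN assoc_eq] zv[THEN assoc_eq]
  have "a \<cdot> p = r \<cdot> v" by (rule iso_cancel_left[of ga]) (simp_all add: rw rwa)
  moreover have "k \<cdot> a = d"
    by (rule iso_cancel_left[of "ShA T x"]) (simp_all add: rw rwa Sh_iso)
  moreover have "b \<cdot> r = q" by (rule iso_cancel_left[of be]) (simp_all add: rw rwa)
  moreover have "e \<cdot> b = ShA T u \<cdot> k"
    by (rule iso_cancel_left[of "ShA T y"]) (simp_all add: rw rwa Sh_iso)
  moreover have "(a, b, ShA T p \<cdot> e) \<in> Tri T"
  proof (rule iso[OF oct(1)], rule isomorphic_triangles_sym)
    have "triangle_morphism T (a, b, ShA T p \<cdot> e) (a', b', ShA T p' \<cdot> e') (al, ga, be)"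
      by (simp add: rw rwa)
    then show "isomorphic_triangles T (a, b, ShA T p \<cdot> e) (a', b', ShA T p' \<cdot> e')"
      unfolding isomorphic_triangles_def by (intro conjI exI[of _ al] exI[of _ ga] exI[of _ be]) simp_all
  qed
  ultimately show ?thesis by (intro exI[of _ a] exI[of _ b]) simp
qed

end

section \<open>Elementary properties of triangulated categories\<close>

context triangulated_category
begin

sublocale shift_category
  by unfold_locales (rule shift_equivalence)

lemma Tri_simps:
  assumes "(u, v, w) \<in> Tri T"
  shows "u \<in> Arr T" "v \<in> Arr T" "w \<in> Arr T" "Tgt T u = Src T v" "Tgt T v = Src T w" "Tgt T w = ShO T (Src T u)"
  using Tri_candidate[OF assms] by simp_all

lemma rotate:
  assumes "(u, v, w) \<in> Tri T"
  shows "(v, w, Neg T (ShA T u)) \<in> Tri T"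
  using TR2[of u v w] Tri_candidate[OF assms] assms by blast

lemma TR3_fill:
  assumes "(u, v, w) \<in> Tri T" "(u', v', w') \<in> Tri T" "a \<in> Arr T" "b \<in> Arr T"
    "Src T a = Src T u" "Tgt T a = Src T u'" "Src T b = Tgt T u" "Tgt T b = Tgt T u'" "b \<cdot> u = u' \<cdot> a"
  shows "\<exists>c. c \<in> Arr T \<and> Src T c = Tgt T v \<and> Tgt T c = Tgt T v' \<and> c \<cdot> v = v' \<cdot> b \<and> ShA T a \<cdot> w = w' \<cdot> c"
proof -
  obtain c where "triangle_morphism T (u, v, w) (u', v', w') (a, b, c)"
    using TR3[OF assms(1,2) _ _ assms(9)] assms(3-8) by (simp del: triangle_morphism.simps) blast
  then show ?thesis using Tri_simps[OF assms(1)] Tri_simps[OF assms(2)]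
    unfolding triangle_morphism.simps Hom_def by auto
qed

text \<open>TR3 maps the trivial triangle on the source of \<open>u\<close> to
  \<open>(u, v, w)\<close>, with \<open>u\<close> as second component. The square that its third
  component closes writes \<open>v \<cdot> u\<close> as a composite through a zero object.\<close>

lemma Tri_comp:
  assumes t: "(u, v, w) \<in> Tri T"
  shows "v \<cdot> u = Zero T (Src T u) (Tgt T v)"
proof -
  note [simp] = Tri_simps[OF t]
  obtain Z where Z: "zero_object T Z" using ex_zero_object by blast
  then have [simp]: "Z \<in> Ob T" by (simp add: zero_object_def)
  have i: "(Ident T (Src T u), Zero T (Src T u) Z, Zero T Z (ShO T (Src T u))) \<in> Tri T"
    by (rule TR1_ident[OF _ Z]) simp
  obtain c where c [simp]: "c \<in> Arr T" "Src T c = Z" "Tgt T c = Tgt T v"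
    and e: "c \<cdot> Zero T (Src T u) Z = v \<cdot> u"
    using TR3_fill[OF i t, of "Ident T (Src T u)" u] by (simp (no_asm_use)) blast
  show ?thesis using e[symmetric] by simp
qed

text \<open>An arrow \<open>f\<close> killed by \<open>v\<close> is the first component of a map
  from a triangle on \<open>W\<close>, \<open>0\<close>, \<open>W[1]\<close> to the rotated
  triangle. The third component given by TR3 goes from \<open>W[1]\<close> to the shifted source of
  \<open>u\<close>, and un-shifting it yields the lift.\<close>

lemma Tri_weak_kernel:
  assumes t: "(u, v, w) \<in> Tri T"
  shows "weak_kernel T u v"
  unfolding weak_kernel_def
proof (intro conjI ballI impI)
  show "v \<cdot> u = Zero T (Src T u) (Tgt T v)" using Tri_comp[OF t] .
  note [simp] = Tri_simps[OF t]
  fix f assume f [simp]: "f \<in> Arr T" and "Tgt T f = Src T v \<and> v \<cdot> f = Zero T (Src T f) (Tgt T v)"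
  then have [simp]: "Tgt T f = Src T v" and vf: "v \<cdot> f = Zero T (Src T f) (Tgt T v)" by blast+
  let ?W = "Src T f"
  obtain Z where Z: "zero_object T Z" using ex_zero_object by blast
  then have [simp]: "Z \<in> Ob T" by (simp add: zero_object_def)
  have t0: "(Zero T ?W Z, Zero T Z (ShO T ?W), Neg T (ShA T (Ident T ?W))) \<in> Tri T"
    using rotate[OF TR1_ident[OF _ Z, of ?W]] by simp
  obtain c where c [simp]: "c \<in> Arr T" "Src T c = ShO T ?W" "Tgt T c = ShO T (Src T u)"
    and e: "ShA T f \<cdot> Neg T (ShA T (Ident T ?W)) = Neg T (ShA T u) \<cdot> c"
    using TR3_fill[OF t0 rotate[OF t], of f "Zero T Z (Tgt T v)"] by (simp (no_asm_use) add: vf) blast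
  obtain g where g [simp]: "g \<in> Arr T" "Src T g = ?W" "Tgt T g = Src T u" and gc: "ShA T g = c"
    using Sh_full[of c ?W "Src T u"] by (simp (no_asm_use)) blast
  have "ShA T f = ShA T u \<cdot> c" using arg_cong[OF e, of "Neg T"] by simp
  with gc have "ShA T f = ShA T (u \<cdot> g)" by simp
  from Sh_faithful[OF this] have "f = u \<cdot> g" by simp
  then show "\<exists>g\<in>Hom T (Src T f) (Src T u). f = u \<cdot> g" using g unfolding Hom_def by blast
qed

lemma weak_kernel_Neg:
  assumes "weak_kernel T u (Neg T v)" "u \<in> Arr T" "v \<in> Arr T" "Tgt T u = Src T v"
  shows "weak_kernel T u v"
  unfolding weak_kernel_def
proof (intro conjI ballI impI)
  show "v \<cdot> u = Zero T (Src T u) (Tgt T v)"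
    using arg_cong[OF weak_kernelD[OF assms(1)], of "Neg T"] assms(2-) by simp
  fix f assume f: "f \<in> Arr T" "Tgt T f = Src T v \<and> v \<cdot> f = Zero T (Src T f) (Tgt T v)"
  then have "Neg T v \<cdot> f = Zero T (Src T f) (Tgt T v)" using assms(2-) by simp
  from weak_kernel_factor[OF assms(1) _ _ this] show "\<exists>g\<in>Hom T (Src T f) (Src T u). f = u \<cdot> g"
    using f assms(2-) unfolding Hom_def by simp
qed

lemma Tri_exact:
  assumes "t \<in> Tri T"
  shows "exact_triangle T t"
proof -
  obtain u v w where t: "t = (u, v, w)" by (cases t)
  have t': "(u, v, w) \<in> Tri T" using assms unfolding t .
  note [simp] = Tri_simps[OF t']
  note r = rotate[OF t']
  have "weak_kernel T w (Neg T (ShA T u))" using Tri_weak_kernel[OF rotate[OF r]] .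
  then have "weak_kernel T w (ShA T u)" by (rule weak_kernel_Neg) simp_all
  then show ?thesis using Tri_weak_kernel[OF r] Tri_weak_kernel[OF t'] unfolding t by simp
qed

text \<open>Dual to \<open>Tri_weak_kernel\<close>, but TR3 can be applied directly: an arrow
  \<open>f\<close> with \<open>f \<cdot> u\<close> zero is the second component of a map to a
  triangle on \<open>0\<close>, \<open>B\<close>, \<open>B\<close>.\<close>

lemma Tri_cokernel:
  assumes t: "(u, v, w) \<in> Tri T" and f [simp]: "f \<in> Arr T" "Src T f = Src T v"
    and fu: "f \<cdot> u = Zero T A B" "Src T u = A" "Tgt T f = B"
  shows "\<exists>g. g \<in> Arr T \<and> Src T g = Tgt T v \<and> Tgt T g = B \<and> f = g \<cdot> v"
proof -
  note [simp] = Tri_simps[OF t] fu(3)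
  have [simp]: "B \<in> Ob T" "A \<in> Ob T"
    using Tgt_in_Ob[OF f(1)] Src_in_Ob[OF Tri_simps(1)[OF t]] unfolding fu(2,3) .
  obtain Z where Z: "zero_object T Z" using ex_zero_object by blast
  then have [simp]: "Z \<in> Ob T" by (simp add: zero_object_def)
  have SZ: "zero_object T (ShO T Z)" using Sh.F_zero_object[OF Z] by simp
  \<comment> \<open>The backward direction of TR2, applied to the trivial triangle on
    \<open>B\<close> with the zero object \<open>ShO T Z\<close>; its last arrow is the negated
    shift of \<open>Zero T Z B\<close> because both are zero.\<close>
  have t0: "(Zero T Z B, Ident T B, Zero T B (ShO T Z)) \<in> Tri T"
    using TR1_ident[OF _ SZ, of B] TR2[of "Zero T Z B" "Ident T B" "Zero T B (ShO T Z)"] by simp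
  obtain c where "c \<in> Arr T" "Src T c = Tgt T v" "Tgt T c = B" "c \<cdot> v = Ident T B \<cdot> f"
    using TR3_fill[OF t t0, of "Zero T (Src T u) Z" f] by (simp (no_asm_use) add: fu) blast
  then show ?thesis by (intro exI[of _ c]) simp
qed

text \<open>With a strict inverse of the shift this would say that \<open>f\<close> extends along
  \<open>u\<close> once it kills \<open>w[-1]\<close>. The condition is stated one shift higher, and
  the extension is un-shifted at the end.\<close>

lemma Tri_cokernel_shift:
  assumes t: "(u, v, w) \<in> Tri T" and f [simp]: "f \<in> Arr T" "Src T f = Src T u"
    and fw: "ShA T f \<cdot> w = Zero T A B" "Src T w = A" "ShO T (Tgt T f) = B"
  shows "\<exists>g. g \<in> Arr T \<and> Src T g = Tgt T u \<and> Tgt T g = Tgt T f \<and> f = g \<cdot> u"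
proof -
  note [simp] = Tri_simps[OF t]
  obtain g where g [simp]: "g \<in> Arr T" "Src T g = ShO T (Src T v)" "Tgt T g = ShO T (Tgt T f)"
    and fg: "ShA T f = g \<cdot> Neg T (ShA T u)"
    using Tri_cokernel[OF rotate[OF rotate[OF t]], of "ShA T f", OF _ _ fw(1)] by (simp (no_asm_use) add: fw) blast
  obtain h where h [simp]: "h \<in> Arr T" "Src T h = Src T v" "Tgt T h = Tgt T f" and hg: "ShA T h = g"
    using Sh_full[of g "Src T v" "Tgt T f"] by (simp (no_asm_use)) blast
  have "f = Neg T h \<cdot> u" by (rule Sh_faithful) (simp_all add: fg hg)
  moreover have "Neg T h \<in> Arr T" "Src T (Neg T h) = Tgt T u" "Tgt T (Neg T h) = Tgt T f" by simp_all
  ultimately show ?thesis by blast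
qed

text \<open>The isomorphism \<open>i\<close> presents the cone of \<open>v\<close> as
  \<open>A[1]\<close>. Replacing the cone along \<open>i\<close> gives a triangle whose last arrow
  is \<open>e \<cdot> i\<close>, and the sign in \<open>ShA T u\<close> cancels the one in
  TR2.\<close>

lemma unrotate:
  assumes t: "(v, q, e) \<in> Tri T" and i: "is_iso T i" "Src T i = ShO T A" "A \<in> Ob T" "Tgt T i = Tgt T q"
  shows "\<exists>u. u \<in> Arr T \<and> Src T u = A \<and> Tgt T u = Src T v \<and> ShA T u = Neg T (e \<cdot> i) \<and>
    (u, v, inv_arr T i \<cdot> q) \<in> Tri T"
proof -
  note [simp] = Tri_simps[OF t] is_iso_Arr[OF i(1)] i
  obtain u where u [simp]: "u \<in> Arr T" "Src T u = A" "Tgt T u = Src T v" and ue: "ShA T u = Neg T (e \<cdot> i)"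
    using Sh_full[of "Neg T (e \<cdot> i)" A "Src T v"] by (simp (no_asm_use)) blast
  have "(v, inv_arr T i \<cdot> q, e \<cdot> i) \<in> Tri T"
  proof (rule TR1_iso[OF t])
    have "triangle_morphism T (v, q, e) (v, inv_arr T i \<cdot> q, e \<cdot> i) (Ident T (Src T v), Ident T (Tgt T v), inv_arr T i)"
      by simp
    then show "isomorphic_triangles T (v, q, e) (v, inv_arr T i \<cdot> q, e \<cdot> i)"
      unfolding isomorphic_triangles_def
      by (intro conjI exI[of _ "Ident T (Src T v)"] exI[of _ "Ident T (Tgt T v)"] exI[of _ "inv_arr T i"]) simp_all
  qed
  then have "(u, v, inv_arr T i \<cdot> q) \<in> Tri T" using TR2[of u v "inv_arr T i \<cdot> q"] by (simp add: ue)
  then show ?thesis using u ue by blast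
qed

text \<open>The cone of \<open>v\<close> is identified with a shift and the triangle rotated
  backwards. The fibers obtained in this way are the source of new denominators below.\<close>

lemma ex_fiber:
  assumes v: "v \<in> Arr T"
  shows "\<exists>u w. (u, v, w) \<in> Tri T"
proof -
  obtain q e where t: "(v, q, e) \<in> Tri T" using TR1_cone[OF v] by blast
  obtain A i where i: "A \<in> Ob T" "is_iso T i" "Src T i = ShO T A" "Tgt T i = Tgt T q"
    using Sh_onto[OF Tgt_in_Ob[OF Tri_simps(2)[OF t]]] by blast
  then show ?thesis using unrotate[OF t i(2,3,1,4)] by blast
qed

end

section \<open>The calculus of fractions\<close>

locale triangulated_subcat = triangulated_category T
  for T :: "('o, 'm, 'x) tri_cat_scheme" (structure) +
  fixes S :: "'o set"
  assumes subcat: "triangulated_subcategory T S"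
begin

abbreviation Sig :: "'m set" where "Sig \<equiv> cone_in T S"

lemma S_Ob: "A \<in> S \<Longrightarrow> A \<in> Ob T"
  and S_iso: "\<lbrakk>A \<in> S; B \<in> Ob T; isomorphic T A B\<rbrakk> \<Longrightarrow> B \<in> S"
  and S_shift: "A \<in> Ob T \<Longrightarrow> ShO T A \<in> S \<longleftrightarrow> A \<in> S"
  and S_cone: "\<lbrakk>(u, v, w) \<in> Tri T; Src T u \<in> S; Tgt T u \<in> S\<rbrakk> \<Longrightarrow> Tgt T v \<in> S"
  using subcat unfolding triangulated_subcategory_def by blast+

text \<open>After a rotation the first vertex appears, shifted, as a cone of the other two, and
  \<open>S\<close> detects membership through shifts. One more rotation gives
  \<open>S_extension\<close>.\<close>

lemma S_fiber:
  assumes t: "(u, v, w) \<in> Tri T" and "Tgt T u \<in> S" "Tgt T v \<in> S"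
  shows "Src T u \<in> S"
  using S_cone[OF rotate[OF t]] assms(2-) Tri_simps[OF t] S_shift[of "Src T u"] by simp

lemma S_extension:
  assumes t: "(u, v, w) \<in> Tri T" and "Src T u \<in> S" "Tgt T v \<in> S"
  shows "Tgt T u \<in> S"
  using S_cone[OF rotate[OF rotate[OF t]]] assms(2-) Tri_simps[OF t] S_shift[of "Src T u"] S_shift[of "Src T v"]
  by simp

lemma S_zero_object:
  assumes Z: "zero_object T Z"
  shows "Z \<in> S"
proof -
  have "S \<noteq> {}" using subcat by (simp add: triangulated_subcategory_def)
  then obtain A where A: "A \<in> S" by blast
  have "Z \<in> Ob T" using Z by (simp add: zero_object_def)
  then show ?thesis using S_cone[OF TR1_ident[OF S_Ob[OF A] Z]] S_Ob[OF A] A by simp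
qed

section \<open>Arrows with cone in \<open>S\<close>: independence of the cone, two out of three, and
  the Ore conditions\<close>

lemma Sig_Arr [simp]: "s \<in> Sig \<Longrightarrow> s \<in> Arr T"
  by (simp add: cone_in_def)

lemma Tri_ex_iso_cone:
  assumes t: "(u, v, w) \<in> Tri T" and t': "(u', v', w') \<in> Tri T" and [simp]: "is_iso T a" "is_iso T b"
    and "Src T a = Src T u" "Tgt T a = Src T u'" "Src T b = Tgt T u" "Tgt T b = Tgt T u'" "b \<cdot> u = u' \<cdot> a"
  shows "isomorphic T (Tgt T v) (Tgt T v')"
proof -
  obtain c where c: "triangle_morphism T (u, v, w) (u', v', w') (a, b, c)"
    using TR3[OF t t' _ _ assms(9)] assms(5-8) is_iso_Arr[OF assms(3)] is_iso_Arr[OF assms(4)]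
    by (simp del: triangle_morphism.simps) blast
  have "is_iso T c" by (rule five_lemma[OF t[THEN Tri_exact] t'[THEN Tri_exact] c assms(3,4)])
  then show ?thesis using c Tri_simps[OF t] Tri_simps[OF t']
    unfolding isomorphic_def triangle_morphism.simps by auto
qed

text \<open>Cones of one arrow are isomorphic by TR3 and the five lemma, and \<open>S\<close> is
  closed under isomorphism. So any single triangle decides membership in \<open>Sig\<close>, whose
  definition asks only for some triangle.\<close>

lemma Sig_iff:
  assumes t: "(s, v, w) \<in> Tri T"
  shows "s \<in> Sig \<longleftrightarrow> Tgt T v \<in> S"
proof
  assume "s \<in> Sig"
  then obtain v' w' where t': "(s, v', w') \<in> Tri T" and C: "Tgt T v' \<in> S" unfolding cone_in_def by blast
  have "isomorphic T (Tgt T v') (Tgt T v)"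
    by (rule Tri_ex_iso_cone[OF t' t, of "Ident T (Src T s)" "Ident T (Tgt T s)"]) (use Tri_simps[OF t] in simp_all)
  then show "Tgt T v \<in> S" using S_iso[OF C] Tri_simps[OF t] by simp
next
  assume "Tgt T v \<in> S"
  then show "s \<in> Sig" using t Tri_simps(1)[OF t] unfolding cone_in_def by blast
qed

text \<open>TR3 and the five lemma compare the triangle of \<open>s\<close> with the trivial one on
  its source, so the cone of \<open>s\<close> is isomorphic to a zero object.\<close>

lemma Sig_iso:
  assumes s: "is_iso T s"
  shows "s \<in> Sig"
proof -
  note [simp] = s is_iso_Arr[OF s]
  obtain Z where Z: "zero_object T Z" using ex_zero_object by blast
  then have ZO: "Z \<in> Ob T" by (simp add: zero_object_def)
  have i: "(Ident T (Src T s), Zero T (Src T s) Z, Zero T Z (ShO T (Src T s))) \<in> Tri T"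
    by (rule TR1_ident[OF _ Z]) simp
  obtain v w where t: "(s, v, w) \<in> Tri T" using TR1_cone[of s] by auto
  have "isomorphic T (Tgt T (Zero T (Src T s) Z)) (Tgt T v)"
    by (rule Tri_ex_iso_cone[OF i t, of "Ident T (Src T s)" s]) simp_all
  then have "Tgt T v \<in> S" using S_iso[OF S_zero_object[OF Z]] ZO Tri_simps[OF t] by simp
  then show ?thesis using Sig_iff[OF t] by simp
qed

lemma Sig_Ident [simp]: "A \<in> Ob T \<Longrightarrow> Ident T A \<in> Sig"
  by (simp add: Sig_iso)

text \<open>TR4 places the cones of \<open>s\<close>, \<open>t \<cdot> s\<close> and
  \<open>t\<close> in one triangle, so the closure of \<open>S\<close> under extensions and fibers
  turns into closure of \<open>Sig\<close> under composition and cancellation.\<close>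

lemma Sig_octahedron:
  assumes [simp]: "s \<in> Arr T" "t \<in> Arr T" "Tgt T s = Src T t"
  obtains a b c where "(a, b, c) \<in> Tri T" "s \<in> Sig \<longleftrightarrow> Src T a \<in> S" "t \<cdot> s \<in> Sig \<longleftrightarrow> Tgt T a \<in> S"
    "t \<in> Sig \<longleftrightarrow> Tgt T b \<in> S"
proof -
  obtain p d where t1: "(s, p, d) \<in> Tri T" using TR1_cone[of s] by auto
  obtain q e where t2: "(t, q, e) \<in> Tri T" using TR1_cone[of t] by auto
  obtain r k where t3: "(t \<cdot> s, r, k) \<in> Tri T" using TR1_cone[of "t \<cdot> s"] by auto
  obtain a b where o: "(a, b, ShA T p \<cdot> e) \<in> Tri T"
    "triangle_morphism T (s, p, d) (t \<cdot> s, r, k) (Ident T (Src T s), t, a)"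
    "triangle_morphism T (t \<cdot> s, r, k) (t, q, e) (s, Ident T (Tgt T t), b)"
    using TR4[OF _ _ t1 t2 t3, of "Src T s" "Src T t" "Tgt T t"] by (simp (no_asm_use) del: triangle_morphism.simps) blast
  have "Src T a = Src T d" "Tgt T a = Src T k" "Tgt T b = Src T e"
    using o(2,3) unfolding triangle_morphism.simps Hom_def by blast+
  then have "Src T a = Tgt T p" "Tgt T a = Tgt T r" "Tgt T b = Tgt T q"
    using Tri_simps(5)[OF t1] Tri_simps(5)[OF t2] Tri_simps(5)[OF t3] by simp_all
  then show ?thesis using that[OF o(1)] Sig_iff[OF t1] Sig_iff[OF t2] Sig_iff[OF t3] by simp
qed

lemma Sig_Comp [simp]:
  assumes "s \<in> Sig" "t \<in> Sig" "Tgt T s = Src T t"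
  shows "t \<cdot> s \<in> Sig"
proof -
  obtain a b c where "(a, b, c) \<in> Tri T" "s \<in> Sig \<longleftrightarrow> Src T a \<in> S" "t \<cdot> s \<in> Sig \<longleftrightarrow> Tgt T a \<in> S"
    "t \<in> Sig \<longleftrightarrow> Tgt T b \<in> S" using Sig_octahedron[of s t] assms Sig_Arr by metis
  then show ?thesis using S_extension assms by blast
qed

lemma Sig_cancel_left:
  assumes "t \<in> Sig" "t \<cdot> s \<in> Sig" "s \<in> Arr T" "Tgt T s = Src T t"
  shows "s \<in> Sig"
proof -
  obtain a b c where "(a, b, c) \<in> Tri T" "s \<in> Sig \<longleftrightarrow> Src T a \<in> S" "t \<cdot> s \<in> Sig \<longleftrightarrow> Tgt T a \<in> S"
    "t \<in> Sig \<longleftrightarrow> Tgt T b \<in> S" using Sig_octahedron[of s t] assms Sig_Arr by metis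
  then show ?thesis using S_fiber assms by blast
qed

lemma Sig_Neg:
  assumes "s \<in> Sig"
  shows "Neg T s \<in> Sig"
proof -
  note [simp] = Sig_Arr[OF assms]
  have "is_iso T (Neg T (Ident T (Tgt T s)))"
    by (rule is_isoI[of _ "Neg T (Ident T (Tgt T s))"]) simp_all
  from Sig_Comp[OF assms Sig_iso[OF this]] show ?thesis by simp
qed

text \<open>Three rotations give a triangle on \<open>Neg T (ShA T s)\<close> whose cone is the
  shifted cone of \<open>s\<close>; \<open>Sig_Neg\<close> then removes the sign.\<close>

lemma Sig_shift_iff:
  assumes [simp]: "s \<in> Arr T"
  shows "ShA T s \<in> Sig \<longleftrightarrow> s \<in> Sig"
proof -
  obtain v w where t: "(s, v, w) \<in> Tri T" using TR1_cone[of s] by auto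
  note [simp] = Tri_simps[OF t]
  have t': "(Neg T (ShA T s), Neg T (ShA T v), Neg T (ShA T w)) \<in> Tri T"
    using rotate[OF rotate[OF rotate[OF t]]] .
  have "Neg T (ShA T s) \<in> Sig \<longleftrightarrow> s \<in> Sig"
    using Sig_iff[OF t'] Sig_iff[OF t] S_shift[of "Src T w"] by simp
  moreover have "ShA T s = Neg T (Neg T (ShA T s))" by simp
  ultimately show ?thesis using Sig_Neg[of "ShA T s"] Sig_Neg[of "Neg T (ShA T s)"] by metis
qed

lemma Sig_shift: "s \<in> Sig \<Longrightarrow> ShA T s \<in> Sig"
  by (simp add: Sig_shift_iff)

text \<open>With \<open>q\<close> the arrow from the target of \<open>t\<close> to its cone,
  \<open>t'\<close> is taken as the fiber of \<open>q \<cdot> f\<close>. Its cone is then that of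
  \<open>t\<close>, and \<open>q\<close> kills \<open>f \<cdot> t'\<close>, which therefore lifts
  through \<open>t\<close>.\<close>

lemma Ore:
  assumes [simp]: "f \<in> Arr T" "t \<in> Sig" "Tgt T f = Tgt T t"
  shows "\<exists>t' f'. t' \<in> Sig \<and> f' \<in> Arr T \<and> Tgt T t' = Src T f \<and> Tgt T f' = Src T t \<and> Src T t' = Src T f' \<and>
    f \<cdot> t' = t \<cdot> f'"
proof -
  obtain q e where t: "(t, q, e) \<in> Tri T" using TR1_cone[of t] by auto
  note [simp] = Tri_simps[OF t]
  obtain t' w where t': "(t', q \<cdot> f, w) \<in> Tri T" using ex_fiber[of "q \<cdot> f"] by auto
  have [simp]: "t' \<in> Arr T" "Tgt T t' = Src T f" using Tri_simps[OF t'] by simp_all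
  have "t' \<in> Sig" using Sig_iff[OF t] Sig_iff[OF rotate[OF rotate[OF t']]] Sig_iff[OF t'] by simp
  moreover have "q \<cdot> (f \<cdot> t') = Zero T (Src T t') (Src T e)" using Tri_comp[OF t'] by simp
  then obtain f' where "f' \<in> Arr T" "Src T f' = Src T t'" "Tgt T f' = Src T t" "f \<cdot> t' = t \<cdot> f'"
    using weak_kernel_factor[OF Tri_weak_kernel[OF t], of "f \<cdot> t'"] by (simp (no_asm_use)) blast
  ultimately show ?thesis by (intro exI[of _ t'] exI[of _ f']) auto
qed

text \<open>As \<open>t\<close> kills \<open>f\<close>, the latter factors through the fiber object
  of \<open>t\<close>, which lies in \<open>S\<close>. The fiber \<open>s\<close> of an arrow
  \<open>g\<close> into an object of \<open>S\<close> belongs to \<open>Sig\<close>, and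
  precomposing with it kills \<open>g\<close> and hence \<open>f\<close>.\<close>

lemma Sig_annihilate:
  assumes t: "t \<in> Sig" and f: "f \<in> Arr T" "Tgt T f = Src T t" "t \<cdot> f = Zero T A B" "Src T f = A" "Tgt T t = B"
  shows "\<exists>s. s \<in> Sig \<and> Tgt T s = A \<and> f \<cdot> s = Zero T (Src T s) (Src T t)"
proof -
  obtain z w where tr: "(z, t, w) \<in> Tri T" using ex_fiber[OF Sig_Arr[OF t]] by blast
  note [simp] = Tri_simps[OF tr] f(2)
  obtain g where g [simp]: "g \<in> Arr T" "Src T g = A" "Tgt T g = Src T z" and fg: "f = z \<cdot> g"
    using weak_kernel_factor[OF Tri_weak_kernel[OF tr] f] by blast
  obtain s e where s: "(s, g, e) \<in> Tri T" using ex_fiber[OF g(1)] by blast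
  note ty = Tri_simps[OF s]
  have "Src T z \<in> S" using Sig_iff[OF rotate[OF tr]] t S_shift[of "Src T z"] by simp
  then have "s \<in> Sig" using Sig_iff[OF s] by simp
  moreover have "z \<cdot> (g \<cdot> s) = Zero T (Src T s) (Src T t)" unfolding Tri_comp[OF s] using ty by simp
  then have "f \<cdot> s = Zero T (Src T s) (Src T t)" unfolding fg using ty by simp
  ultimately show ?thesis using ty by auto
qed

lemma Sig_cancel:
  assumes "t \<in> Sig" and f: "f \<in> Arr T" "g \<in> Arr T" "Src T f = Src T g" "Tgt T f = Src T t" "Tgt T g = Src T t"
    and e: "t \<cdot> f = t \<cdot> g"
  shows "\<exists>s. s \<in> Sig \<and> Tgt T s = Src T g \<and> f \<cdot> s = g \<cdot> s"
proof -
  have "t \<cdot> (f \<boxplus> Neg T g) = Zero T (Src T g) (Tgt T t)" using assms by simp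
  then obtain s where s: "s \<in> Sig" "Tgt T s = Src T g" "(f \<boxplus> Neg T g) \<cdot> s = Zero T (Src T s) (Src T t)"
    using Sig_annihilate[OF assms(1), of "f \<boxplus> Neg T g"] f by (simp (no_asm_use) add: assms) blast
  have "f \<cdot> s = g \<cdot> s" by (rule Add_Neg_eq_Zero) (use s f in simp_all)
  then show ?thesis using s by blast
qed

section \<open>Roofs\<close>

abbreviation cls :: "'m \<Rightarrow> 'm \<Rightarrow> ('m \<times> 'm) set" where "cls \<equiv> roof_class T S"

lemma roofs_iff [simp]: "(s, f) \<in> roofs T S \<longleftrightarrow> s \<in> Sig \<and> f \<in> Arr T \<and> Src T s = Src T f"
  by (simp add: roofs_def)

lemma roof_relI:
  assumes "(s, f) \<in> roofs T S" "(t, g) \<in> roofs T S" "a \<in> Arr T" "b \<in> Arr T" "Tgt T a = Src T s" "Tgt T b = Src T t"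
    "Src T a = Src T b" "s \<cdot> a = t \<cdot> b" "s \<cdot> a \<in> Sig" "f \<cdot> a = g \<cdot> b"
  shows "((s, f), (t, g)) \<in> roof_rel T S"
  using assms unfolding roof_rel_def by blast

text \<open>The relation asks only that the common denominator \<open>s \<cdot> a\<close> lie in
  \<open>Sig\<close>. Cancelling \<open>s\<close> and \<open>t\<close> puts both legs
  \<open>a\<close> and \<open>b\<close> in \<open>Sig\<close>, which makes them available for
  further refinements.\<close>

lemma roof_relD:
  assumes "((s, f), (t, g)) \<in> roof_rel T S"
  shows "(s, f) \<in> roofs T S" "(t, g) \<in> roofs T S"
    and "\<exists>a b. a \<in> Sig \<and> b \<in> Sig \<and> Tgt T a = Src T f \<and> Tgt T b = Src T g \<and> Src T a = Src T b \<and>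
      s \<cdot> a = t \<cdot> b \<and> f \<cdot> a = g \<cdot> b"
proof -
  show r: "(s, f) \<in> roofs T S" "(t, g) \<in> roofs T S" using assms by (auto simp: roof_rel_def)
  obtain a b where ab: "a \<in> Arr T" "b \<in> Arr T" "Tgt T a = Src T s" "Tgt T b = Src T t"
    "Src T a = Src T b" "s \<cdot> a = t \<cdot> b" "s \<cdot> a \<in> Sig" "f \<cdot> a = g \<cdot> b"
    using assms unfolding roof_rel_def by blast
  have "a \<in> Sig" using Sig_cancel_left[of s a] r ab by simp
  moreover have "b \<in> Sig" using Sig_cancel_left[of t b] r ab by simp
  ultimately show "\<exists>a b. a \<in> Sig \<and> b \<in> Sig \<and> Tgt T a = Src T f \<and> Tgt T b = Src T g \<and> Src T a = Src T b \<and>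
      s \<cdot> a = t \<cdot> b \<and> f \<cdot> a = g \<cdot> b"
    using ab r by (intro exI[of _ a] exI[of _ b]) simp
qed

lemma equiv_roof_rel: "equiv (roofs T S) (roof_rel T S)"
proof (rule equivI)
  show "roof_rel T S \<subseteq> roofs T S \<times> roofs T S" by (auto simp: roof_rel_def)
  show "refl_on (roofs T S) (roof_rel T S)"
  proof (rule refl_onI)
    fix x assume x: "x \<in> roofs T S"
    obtain s f where sf: "x = (s, f)" by (cases x)
    show "(x, x) \<in> roof_rel T S" unfolding sf
      by (rule roof_relI[of _ _ _ _ "Ident T (Src T f)" "Ident T (Src T f)"]) (use x sf in auto)
  qed
  show "sym (roof_rel T S)"
  proof (rule symI)
    fix x y assume xy: "(x, y) \<in> roof_rel T S"
    obtain s f t g where sf: "x = (s, f)" "y = (t, g)" by (cases x; cases y)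
    note R = roof_relD(1,2)[OF xy[unfolded sf]]
    obtain a b where ab [simp]: "a \<in> Sig" "b \<in> Sig" "Tgt T a = Src T f" "Tgt T b = Src T g" "Src T a = Src T b"
      and e1: "s \<cdot> a = t \<cdot> b" "f \<cdot> a = g \<cdot> b" using roof_relD(3)[OF xy[unfolded sf]] by blast
    show "(y, x) \<in> roof_rel T S" unfolding sf
      by (rule roof_relI[of _ _ _ _ b a]) (use R e1 in simp_all)
  qed
  show "trans (roof_rel T S)"
  proof (rule transI)
    fix x y z assume xy: "(x, y) \<in> roof_rel T S" and yz: "(y, z) \<in> roof_rel T S"
    obtain s f t g r h where x: "x = (s, f)" "y = (t, g)" "z = (r, h)" by (cases x; cases y; cases z)
    note R = roof_relD(1,2)[OF xy[unfolded x]] roof_relD(2)[OF yz[unfolded x]]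
    have [simp]: "s \<in> Sig" "t \<in> Sig" "r \<in> Sig" "f \<in> Arr T" "g \<in> Arr T" "h \<in> Arr T"
      "Src T s = Src T f" "Src T t = Src T g" "Src T r = Src T h" using R by simp_all
    obtain a b where ab [simp]: "a \<in> Sig" "b \<in> Sig" "Tgt T a = Src T f" "Tgt T b = Src T g" "Src T a = Src T b"
      and e1: "s \<cdot> a = t \<cdot> b" "f \<cdot> a = g \<cdot> b" using roof_relD(3)[OF xy[unfolded x]] by blast
    obtain c d where cd [simp]: "c \<in> Sig" "d \<in> Sig" "Tgt T c = Src T g" "Tgt T d = Src T h" "Src T c = Src T d"
      and e2: "t \<cdot> c = r \<cdot> d" "g \<cdot> c = h \<cdot> d" using roof_relD(3)[OF yz[unfolded x]] by blast
    \<comment> \<open>The two given refinements meet at the middle roof; completing \<open>b\<close>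
      against \<open>c\<close> produces a refinement of all three. Only \<open>p\<close> is known to
      lie in \<open>Sig\<close>, so membership of \<open>c \<cdot> q\<close> is read off from
      \<open>b \<cdot> p\<close>.\<close>
    obtain p q where pq [simp]: "p \<in> Sig" "q \<in> Arr T" "Tgt T p = Src T b" "Tgt T q = Src T d" "Src T p = Src T q"
      and e3: "b \<cdot> p = c \<cdot> q" using Ore[of b c] by (simp (no_asm_use)) blast
    have "b \<cdot> p \<in> Sig" by simp
    then have [simp]: "c \<cdot> q \<in> Sig" unfolding e3 .
    show "(x, z) \<in> roof_rel T S" unfolding x
      by (rule roof_relI[of _ _ _ _ "a \<cdot> p" "d \<cdot> q"])
        (simp_all add: e1[THEN assoc_eq] e2[symmetric, THEN assoc_eq] e3)
  qed
qed

lemma cls_eqI: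
  assumes "s \<in> Sig" "t \<in> Sig" "f \<in> Arr T" "g \<in> Arr T" "Src T s = Src T f" "Src T t = Src T g"
    "a \<in> Arr T" "b \<in> Arr T" "Tgt T a = Src T f" "Tgt T b = Src T g"
    "Src T a = Src T b" "s \<cdot> a = t \<cdot> b" "s \<cdot> a \<in> Sig" "f \<cdot> a = g \<cdot> b"
  shows "cls s f = cls t g"
  unfolding roof_class_def
  by (rule equiv_class_eq[OF equiv_roof_rel], rule roof_relI[of _ _ _ _ a b]) (use assms in simp_all)

lemma cls_mem:
  assumes "(t, g) \<in> cls s f"
  shows "t \<in> Sig" "g \<in> Arr T" "Src T t = Src T g" "cls t g = cls s f"
    "s \<in> Sig" "f \<in> Arr T" "Src T s = Src T f" "Tgt T t = Tgt T s" "Tgt T g = Tgt T f"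
proof -
  have r: "((s, f), (t, g)) \<in> roof_rel T S" using assms by (simp add: roof_class_def)
  show ty: "t \<in> Sig" "g \<in> Arr T" "Src T t = Src T g" "s \<in> Sig" "f \<in> Arr T" "Src T s = Src T f"
    using roof_relD(1,2)[OF r] by simp_all
  show "cls t g = cls s f" unfolding roof_class_def using equiv_class_eq[OF equiv_roof_rel r] by simp
  obtain a b where ab: "a \<in> Sig" "b \<in> Sig" "Tgt T a = Src T f" "Tgt T b = Src T g" "Src T a = Src T b"
      and e: "s \<cdot> a = t \<cdot> b" "f \<cdot> a = g \<cdot> b" using roof_relD(3)[OF r] by blast
  show "Tgt T t = Tgt T s" "Tgt T g = Tgt T f"
    using arg_cong[OF e(1), of "Tgt T"] arg_cong[OF e(2), of "Tgt T"] ab ty by simp_all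
qed

lemma cls_self: "\<lbrakk>s \<in> Sig; f \<in> Arr T; Src T s = Src T f\<rbrakk> \<Longrightarrow> (s, f) \<in> cls s f"
  unfolding roof_class_def by (rule equiv_class_self[OF equiv_roof_rel]) simp

lemma cls_eqD:
  assumes "cls s f = cls t g" "t \<in> Sig" "g \<in> Arr T" "Src T t = Src T g"
  shows "\<exists>a b. a \<in> Sig \<and> b \<in> Sig \<and> Tgt T a = Src T f \<and> Tgt T b = Src T g \<and> Src T a = Src T b \<and>
      s \<cdot> a = t \<cdot> b \<and> f \<cdot> a = g \<cdot> b"
proof -
  have "(t, g) \<in> cls s f" unfolding assms(1) by (rule cls_self[OF assms(2-)])
  then show ?thesis by (intro roof_relD(3)) (simp add: roof_class_def)
qed

lemma cls_refine:
  assumes "s \<in> Sig" "a \<in> Sig" "f \<in> Arr T" "Src T s = Src T f" "Tgt T a = Src T f"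
  shows "cls (s \<cdot> a) (f \<cdot> a) = cls s f"
  by (rule cls_eqI[of _ _ _ _ "Ident T (Src T a)" a]) (use assms in simp_all)

text \<open>Equality of the roofs provides \<open>a\<close> and \<open>b\<close> that agree only
  after \<open>s\<close>. Since \<open>s\<close> is in \<open>Sig\<close>, a further refinement
  makes them equal, so a single arrow equalises the numerators.\<close>

lemma cls_same_denominator:
  assumes "cls s f = cls s g" and [simp]: "s \<in> Sig" "f \<in> Arr T" "g \<in> Arr T" "Src T s = Src T g" "Src T f = Src T g"
  shows "\<exists>a. a \<in> Sig \<and> Tgt T a = Src T g \<and> f \<cdot> a = g \<cdot> a"
proof -
  obtain a b where ab [simp]: "a \<in> Sig" "b \<in> Sig" "Tgt T a = Src T g" "Tgt T b = Src T g" "Src T a = Src T b"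
      and e: "s \<cdot> a = s \<cdot> b" "f \<cdot> a = g \<cdot> b" using cls_eqD[OF assms(1)] by (simp (no_asm_use)) blast
  obtain c where c [simp]: "c \<in> Sig" "Tgt T c = Src T b" and ec: "a \<cdot> c = b \<cdot> c"
    using Sig_cancel[of s a b] e(1) by (simp (no_asm_use)) blast
  have "f \<cdot> (a \<cdot> c) = g \<cdot> (b \<cdot> c)" by (simp add: e(2)[THEN assoc_eq])
  then have "f \<cdot> (b \<cdot> c) = g \<cdot> (b \<cdot> c)" unfolding ec .
  then show ?thesis by (intro exI[of _ "b \<cdot> c"]) simp
qed

text \<open>Ore completes \<open>p\<close> against \<open>p'\<close>. The arrows
  \<open>q \<cdot> x\<close> and \<open>q' \<cdot> y\<close> then agree after \<open>t\<close>, and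
  \<open>Sig_cancel\<close> removes \<open>t\<close> at the cost of one more refinement
  \<open>z\<close>.\<close>

lemma cls_Comp_indep:
  assumes [simp]: "s \<in> Sig" "f \<in> Arr T" "Src T s = Src T f" "t \<in> Sig" "g \<in> Arr T" "Src T t = Src T g"
    "p \<in> Sig" "q \<in> Arr T" "Src T p = Src T q" "Tgt T p = Src T f" "Tgt T q = Src T g"
    "p' \<in> Sig" "q' \<in> Arr T" "Src T p' = Src T q'" "Tgt T p' = Src T f" "Tgt T q' = Src T g"
    and e: "f \<cdot> p = t \<cdot> q" "f \<cdot> p' = t \<cdot> q'"
  shows "cls (s \<cdot> p) (g \<cdot> q) = cls (s \<cdot> p') (g \<cdot> q')"
proof -
  obtain x y where x [simp]: "x \<in> Sig" "y \<in> Arr T" "Tgt T x = Src T q" "Tgt T y = Src T q'" "Src T x = Src T y"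
    and ex: "p \<cdot> x = p' \<cdot> y" using Ore[of p p'] by (simp (no_asm_use)) blast
  have "t \<cdot> (q \<cdot> x) = t \<cdot> (q' \<cdot> y)"
    using e(1)[THEN assoc_eq, of x] e(2)[THEN assoc_eq, of y] ex by simp
  then obtain z where z [simp]: "z \<in> Sig" "Tgt T z = Src T y" and ez: "(q \<cdot> x) \<cdot> z = (q' \<cdot> y) \<cdot> z"
    using Sig_cancel[of t "q \<cdot> x" "q' \<cdot> y"] by (simp (no_asm_use) del: assoc) blast
  have "p \<cdot> (x \<cdot> z) \<in> Sig" by simp
  then have [simp]: "p' \<cdot> (y \<cdot> z) \<in> Sig" by (simp add: ex[THEN assoc_eq])
  show ?thesis
    by (rule cls_eqI[of _ _ _ _ "x \<cdot> z" "y \<cdot> z"]) (use ez in \<open>simp_all add: ex[THEN assoc_eq]\<close>)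
qed

text \<open>Completing \<open>f \<cdot> d\<close> against \<open>t \<cdot> b\<close> gives a square
  that serves both pairs of representatives at once. Two applications of
  \<open>cls_Comp_indep\<close> compare it with the given completions.\<close>

lemma cls_Comp_well_defined:
  assumes [simp]: "t \<in> Sig" "g \<in> Arr T" "Src T t = Src T g"
    "p \<in> Sig" "q \<in> Arr T" "Src T p = Src T q" "Tgt T p = Src T f" "Tgt T q = Src T g"
    "p' \<in> Sig" "q' \<in> Arr T" "Src T p' = Src T q'" "Tgt T p' = Src T f'" "Tgt T q' = Src T g'"
    and e: "f \<cdot> p = t \<cdot> q" "f' \<cdot> p' = t' \<cdot> q'" and m: "(s', f') \<in> cls s f" "(t', g') \<in> cls t g"
  shows "cls (s' \<cdot> p') (g' \<cdot> q') = cls (s \<cdot> p) (g \<cdot> q)"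
proof -
  have ty [simp]: "s' \<in> Sig" "f' \<in> Arr T" "Src T s' = Src T f'" "s \<in> Sig" "f \<in> Arr T" "Src T s = Src T f" "Tgt T f' = Tgt T f"
    "t' \<in> Sig" "g' \<in> Arr T" "Src T t' = Src T g'" "Tgt T t' = Tgt T t"
    using cls_mem[OF m(1)] cls_mem[OF m(2)] by simp_all
  have [simp]: "Tgt T f = Tgt T t" using arg_cong[OF e(1), of "Tgt T"] by simp
  obtain c d where cd [simp]: "c \<in> Sig" "d \<in> Sig" "Tgt T c = Src T f'" "Tgt T d = Src T f" "Src T c = Src T d"
    and e1: "s' \<cdot> c = s \<cdot> d" "f' \<cdot> c = f \<cdot> d"
    using cls_eqD[OF cls_mem(4)[OF m(1)]] by (simp (no_asm_use)) blast
  obtain a b where ab [simp]: "a \<in> Sig" "b \<in> Sig" "Tgt T a = Src T g'" "Tgt T b = Src T g" "Src T a = Src T b"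
    and e2: "t' \<cdot> a = t \<cdot> b" "g' \<cdot> a = g \<cdot> b"
    using cls_eqD[OF cls_mem(4)[OF m(2)]] by (simp (no_asm_use)) blast
  obtain x y where x [simp]: "x \<in> Sig" "y \<in> Arr T" "Tgt T x = Src T d" "Tgt T y = Src T b" "Src T x = Src T y"
    and ex: "(f \<cdot> d) \<cdot> x = (t \<cdot> b) \<cdot> y" using Ore[of "f \<cdot> d" "t \<cdot> b"] by (simp (no_asm_use) del: assoc) blast
  have "cls (s' \<cdot> p') (g' \<cdot> q') = cls (s' \<cdot> (c \<cdot> x)) (g' \<cdot> (a \<cdot> y))"
    by (rule cls_Comp_indep[OF _ _ _ _ _ _ _ _ _ _ _ _ _ _ _ _ e(2)])
      (use ex in \<open>simp_all add: e1[THEN assoc_eq] e2[THEN assoc_eq]\<close>)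
  also have "\<dots> = cls (s \<cdot> (d \<cdot> x)) (g \<cdot> (b \<cdot> y))"
    by (simp add: e1[THEN assoc_eq] e2[THEN assoc_eq])
  also have "\<dots> = cls (s \<cdot> p) (g \<cdot> q)"
    by (rule cls_Comp_indep[OF _ _ _ _ _ _ _ _ _ _ _ _ _ _ _ _ _ e(1)])
      (use ex in simp_all)
  finally show ?thesis .
qed

text \<open>The equivalences for \<open>f\<close> and for \<open>g\<close> come with unrelated
  refinements. Ore makes them agree over \<open>s'\<close>, cancellation of \<open>s\<close> makes
  them agree on the other side, and then one refinement works for the sum.\<close>

lemma cls_Add_well_defined:
  assumes m: "(s', f') \<in> cls s f" "(s', g') \<in> cls s g" and [simp]: "Tgt T f = Tgt T g"
  shows "cls s' (f' \<boxplus> g') = cls s (f \<boxplus> g)"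
proof -
  have ty [simp]: "s' \<in> Sig" "f' \<in> Arr T" "s \<in> Sig" "f \<in> Arr T" "Tgt T f' = Tgt T f"
    "g' \<in> Arr T" "Src T s' = Src T g'" "g \<in> Arr T" "Src T s = Src T g" "Tgt T g' = Tgt T g" "Src T f = Src T g" "Src T f' = Src T g'"
    using cls_mem[OF m(1)] cls_mem[OF m(2)] by simp_all
  obtain c d where cd [simp]: "c \<in> Sig" "d \<in> Sig" "Tgt T c = Src T g'" "Tgt T d = Src T g" "Src T c = Src T d"
    and e1: "s' \<cdot> c = s \<cdot> d" "f' \<cdot> c = f \<cdot> d"
    using cls_eqD[OF cls_mem(4)[OF m(1)]] by (simp (no_asm_use)) blast
  obtain a b where ab [simp]: "a \<in> Sig" "b \<in> Sig" "Tgt T a = Src T g'" "Tgt T b = Src T g" "Src T a = Src T b"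
    and e2: "s' \<cdot> a = s \<cdot> b" "g' \<cdot> a = g \<cdot> b"
    using cls_eqD[OF cls_mem(4)[OF m(2)]] by (simp (no_asm_use)) blast
  obtain x y where x [simp]: "x \<in> Sig" "y \<in> Arr T" "Tgt T x = Src T d" "Tgt T y = Src T b" "Src T x = Src T y"
    and ex: "c \<cdot> x = a \<cdot> y" using Ore[of c a] by (simp (no_asm_use)) blast
  have "s \<cdot> (d \<cdot> x) = s \<cdot> (b \<cdot> y)"
    using e1(1)[THEN assoc_eq, of x] e2(1)[THEN assoc_eq, of y] ex by simp
  then obtain z where z [simp]: "z \<in> Sig" "Tgt T z = Src T y" and ez: "(d \<cdot> x) \<cdot> z = (b \<cdot> y) \<cdot> z"
    using Sig_cancel[of s "d \<cdot> x" "b \<cdot> y"] by (simp (no_asm_use) del: assoc) blast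
  have "g' \<cdot> (c \<cdot> (x \<cdot> z)) = g' \<cdot> (a \<cdot> (y \<cdot> z))" by (simp add: ex[THEN assoc_eq])
  also have "\<dots> = g \<cdot> (d \<cdot> (x \<cdot> z))" using ez by (simp add: e2(2)[THEN assoc_eq])
  finally have g: "g' \<cdot> (c \<cdot> (x \<cdot> z)) = g \<cdot> (d \<cdot> (x \<cdot> z))" .
  show ?thesis
    by (rule cls_eqI[of _ _ _ _ "c \<cdot> (x \<cdot> z)" "d \<cdot> (x \<cdot> z)"])
      (simp_all add: g e1[THEN assoc_eq])
qed

lemma common_denominator:
  assumes [simp]: "s \<in> Sig" "f \<in> Arr T" "Src T s = Src T f" "t \<in> Sig" "g \<in> Arr T" "Src T t = Src T g" "Tgt T s = Tgt T t"
  shows "\<exists>a b. a \<in> Sig \<and> b \<in> Sig \<and> Tgt T a = Src T f \<and> Tgt T b = Src T g \<and> Src T a = Src T b \<and> s \<cdot> a = t \<cdot> b \<and>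
    cls s f = cls (s \<cdot> a) (f \<cdot> a) \<and> cls t g = cls (s \<cdot> a) (g \<cdot> b)"
proof -
  obtain a b where ab [simp]: "a \<in> Sig" "b \<in> Arr T" "Tgt T a = Src T f" "Tgt T b = Src T g" "Src T a = Src T b"
    and e: "s \<cdot> a = t \<cdot> b" using Ore[of s t] by (simp (no_asm_use)) blast
  have "s \<cdot> a \<in> Sig" by simp
  then have [simp]: "b \<in> Sig" using Sig_cancel_left[of t b] e by simp
  have "cls s f = cls (s \<cdot> a) (f \<cdot> a)" "cls t g = cls (s \<cdot> a) (g \<cdot> b)"
    unfolding e using cls_refine[of s a f] cls_refine[of t b g] e by simp_all
  then show ?thesis using e by (intro exI[of _ a] exI[of _ b]) simp
qed

end

section \<open>The Verdier quotient as an additive category\<close>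

text \<open>The class of distinguished triangles is a parameter, since it is defined through isomorphisms
  in this very category.\<close>

locale verdier = triangulated_subcat T S
  for T :: "('o, 'm, 'x) tri_cat_scheme" (structure) and S :: "'o set" +
  fixes U :: "('o, ('m \<times> 'm) set) tri_cat" and D
  assumes U_eq: "U = (verdier_precat T S)\<lparr>Tri := D\<rparr>"
begin

abbreviation V :: "'m \<Rightarrow> ('m \<times> 'm) set" where "V \<equiv> AMap (verdier_functor T S)"

lemma V_eq: "V f = cls (Ident T (Src T f)) f"
  by (simp add: verdier_functor_def)

lemma U_sel [simp]:
  "Ob U = Ob T" "ShO U = ShO T" "Zero U A B = cls (Ident T A) (Zero T A B)"
  "Ident U A = cls (Ident T A) (Ident T A)"
  by (simp_all add: U_eq verdier_precat_def)

lemma cls_Arr [simp]: "\<lbrakk>s \<in> Sig; f \<in> Arr T; Src T s = Src T f\<rbrakk> \<Longrightarrow> cls s f \<in> Arr U"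
  by (simp add: U_eq verdier_precat_def roof_class_def quotientI)

lemma U_Arr_cases:
  assumes "A \<in> Arr U"
  shows "\<exists>s f. s \<in> Sig \<and> f \<in> Arr T \<and> Src T s = Src T f \<and> A = cls s f"
proof -
  have "A \<in> roofs T S // roof_rel T S" using assms by (simp add: U_eq verdier_precat_def)
  then obtain r where r: "r \<in> roofs T S" "A = roof_rel T S `` {r}" by (elim quotientE)
  obtain s f where "r = (s, f)" by (cases r)
  with r show ?thesis unfolding roof_class_def by (intro exI[of _ s] exI[of _ f]) simp
qed

lemma cls_Src_Tgt [simp]:
  assumes "s \<in> Sig" "f \<in> Arr T" "Src T s = Src T f"
  shows "Src U (cls s f) = Tgt T s" "Tgt U (cls s f) = Tgt T f"
proof -
  obtain t g where tg: "(SOME r. r \<in> cls s f) = (t, g)" by fastforce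
  have "(SOME r. r \<in> cls s f) \<in> cls s f" using cls_self[OF assms] by (rule someI)
  then have m: "(t, g) \<in> cls s f" unfolding tg .
  show "Src U (cls s f) = Tgt T s" "Tgt U (cls s f) = Tgt T f"
    using tg cls_mem(8,9)[OF m] by (simp_all add: U_eq verdier_precat_def)
qed

text \<open>All members of the union that defines the composite are the same class, by
  \<open>cls_Comp_well_defined\<close>. So the union collapses and any one Ore completion computes
  the composite.\<close>

lemma U_Comp:
  assumes [simp]: "s \<in> Sig" "f \<in> Arr T" "Src T s = Src T f" "t \<in> Sig" "g \<in> Arr T" "Src T t = Src T g"
    "p \<in> Sig" "q \<in> Arr T" "Src T p = Src T q" "Tgt T p = Src T f" "Tgt T q = Src T g"
    and e: "f \<cdot> p = t \<cdot> q"
  shows "cls t g \<cdot>\<^bsub>U\<^esub> cls s f = cls (s \<cdot> p) (g \<cdot> q)"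
proof -
  have "{cls (s1 \<cdot> p1) (g1 \<cdot> q1) |s1 f1 t1 g1 p1 q1.
        (s1, f1) \<in> cls s f \<and> (t1, g1) \<in> cls t g \<and> (p1, q1) \<in> roofs T S \<and>
        Tgt T p1 = Src T f1 \<and> Tgt T q1 = Src T t1 \<and> f1 \<cdot> p1 = t1 \<cdot> q1} = {cls (s \<cdot> p) (g \<cdot> q)}"
    (is "?X = _")
  proof (rule Set.set_eqI)
    fix c
    have "c = cls (s \<cdot> p) (g \<cdot> q)" if c: "c \<in> ?X"
    proof -
      obtain s1 f1 t1 g1 p1 q1 where 1: "c = cls (s1 \<cdot> p1) (g1 \<cdot> q1)" and m: "(s1, f1) \<in> cls s f" "(t1, g1) \<in> cls t g"
        and 2: "(p1, q1) \<in> roofs T S" "Tgt T p1 = Src T f1" "Tgt T q1 = Src T t1" and e1: "f1 \<cdot> p1 = t1 \<cdot> q1"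
        using c by blast
      show ?thesis unfolding 1
        by (rule cls_Comp_well_defined[OF _ _ _ _ _ _ _ _ _ _ _ _ _ e e1 m])
          (use 2 cls_mem(3)[OF m(2)] in simp_all)
    qed
    moreover have "cls (s \<cdot> p) (g \<cdot> q) \<in> ?X"
      using cls_self[of s f] cls_self[of t g] e
      by (intro CollectI exI[of _ s] exI[of _ f] exI[of _ t] exI[of _ g] exI[of _ p] exI[of _ q]) simp
    ultimately show "c \<in> ?X \<longleftrightarrow> c \<in> {cls (s \<cdot> p) (g \<cdot> q)}" by blast
  qed
  then show ?thesis by (simp add: U_eq verdier_precat_def)
qed

lemma U_Add [simp]:
  assumes [simp]: "s \<in> Sig" "f \<in> Arr T" "g \<in> Arr T" "Src T s = Src T g" "Src T f = Src T g" "Tgt T f = Tgt T g"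
  shows "cls s f \<boxplus>\<^bsub>U\<^esub> cls s g = cls s (f \<boxplus> g)"
proof -
  have "{cls s1 (f1 \<boxplus> g1) |s1 f1 g1. (s1, f1) \<in> cls s f \<and> (s1, g1) \<in> cls s g} = {cls s (f \<boxplus> g)}"
    (is "?X = _")
  proof (rule Set.set_eqI)
    fix c
    have "c = cls s (f \<boxplus> g)" if "c \<in> ?X"
      using that cls_Add_well_defined[OF _ _ assms(6)] by blast
    moreover have "cls s (f \<boxplus> g) \<in> ?X" using cls_self[of s f] cls_self[of s g] by auto
    ultimately show "c \<in> ?X \<longleftrightarrow> c \<in> {cls s (f \<boxplus> g)}" by blast
  qed
  then show ?thesis by (simp add: U_eq verdier_precat_def)
qed

lemma U_Comp_ex:
  assumes [simp]: "s \<in> Sig" "f \<in> Arr T" "Src T s = Src T f" "t \<in> Sig" "g \<in> Arr T" "Src T t = Src T g" "Tgt T f = Tgt T t"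
  shows "\<exists>p q. p \<in> Sig \<and> q \<in> Arr T \<and> Tgt T p = Src T f \<and> Tgt T q = Src T g \<and> Src T p = Src T q \<and> f \<cdot> p = t \<cdot> q \<and>
    cls t g \<cdot>\<^bsub>U\<^esub> cls s f = cls (s \<cdot> p) (g \<cdot> q)"
proof -
  obtain p q where [simp]: "p \<in> Sig" "q \<in> Arr T" "Tgt T p = Src T f" "Tgt T q = Src T g" "Src T p = Src T q"
    and e: "f \<cdot> p = t \<cdot> q" using Ore[of f t] by (simp (no_asm_use)) blast
  have "cls t g \<cdot>\<^bsub>U\<^esub> cls s f = cls (s \<cdot> p) (g \<cdot> q)" by (rule U_Comp[OF _ _ _ _ _ _ _ _ _ _ _ e]) simp_all
  then show ?thesis using e by (intro exI[of _ p] exI[of _ q] conjI) simp_all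
qed

lemma cls_Comp_V:
  assumes [simp]: "s \<in> Sig" "f \<in> Arr T" "Src T s = Src T f" "h \<in> Arr T" "Src T h = Tgt T f"
  shows "cls (Ident T (Src T h)) h \<cdot>\<^bsub>U\<^esub> cls s f = cls s (h \<cdot> f)"
proof -
  have O: "Tgt T f \<in> Ob T" by simp
  have "cls (Ident T (Src T h)) h \<cdot>\<^bsub>U\<^esub> cls s f = cls (s \<cdot> Ident T (Src T f)) (h \<cdot> f)"
    by (rule U_Comp) (simp_all add: O)
  then show ?thesis by simp
qed

lemma U_assoc:
  assumes "F \<in> Arr U" "G \<in> Arr U" "H \<in> Arr U" "Tgt U F = Src U G" "Tgt U G = Src U H"
  shows "(H \<cdot>\<^bsub>U\<^esub> G) \<cdot>\<^bsub>U\<^esub> F = H \<cdot>\<^bsub>U\<^esub> (G \<cdot>\<^bsub>U\<^esub> F)"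
proof -
  obtain s f where F: "s \<in> Sig" "f \<in> Arr T" "Src T s = Src T f" "F = cls s f" using U_Arr_cases[OF assms(1)] by blast
  obtain t g where G: "t \<in> Sig" "g \<in> Arr T" "Src T t = Src T g" "G = cls t g" using U_Arr_cases[OF assms(2)] by blast
  obtain r h where H: "r \<in> Sig" "h \<in> Arr T" "Src T r = Src T h" "H = cls r h" using U_Arr_cases[OF assms(3)] by blast
  note [simp] = F(1-3) G(1-3) H(1-3)
  have [simp]: "Tgt T f = Tgt T t" "Tgt T g = Tgt T r" using assms(4,5) F G H by simp_all
  obtain r1 g1 where 1 [simp]: "r1 \<in> Sig" "g1 \<in> Arr T" "Tgt T r1 = Src T g" "Tgt T g1 = Src T h" "Src T r1 = Src T g1"
    and e1: "g \<cdot> r1 = r \<cdot> g1" using Ore[of g r] by (simp (no_asm_use)) blast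
  \<comment> \<open>The second completion is taken against the denominator
    \<open>t \<cdot> r1\<close> of the composite of \<open>H\<close> and \<open>G\<close>. With this
    choice both bracketings evaluate to the same roof.\<close>
  obtain x y where xy [simp]: "x \<in> Sig" "y \<in> Arr T" "Tgt T x = Src T f" "Tgt T y = Src T g1" "Src T x = Src T y"
    and e2: "f \<cdot> x = (t \<cdot> r1) \<cdot> y" using Ore[of f "t \<cdot> r1"] by (simp (no_asm_use) del: assoc) blast
  have "H \<cdot>\<^bsub>U\<^esub> G = cls (t \<cdot> r1) (h \<cdot> g1)" unfolding H G by (rule U_Comp) (simp_all add: e1)
  moreover have "cls (t \<cdot> r1) (h \<cdot> g1) \<cdot>\<^bsub>U\<^esub> F = cls (s \<cdot> x) ((h \<cdot> g1) \<cdot> y)"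
    unfolding F by (rule U_Comp) (use e2 in simp_all)
  moreover have "G \<cdot>\<^bsub>U\<^esub> F = cls (s \<cdot> x) (g \<cdot> (r1 \<cdot> y))" unfolding G F by (rule U_Comp) (use e2 in simp_all)
  moreover have "H \<cdot>\<^bsub>U\<^esub> cls (s \<cdot> x) (g \<cdot> (r1 \<cdot> y)) = cls ((s \<cdot> x) \<cdot> Ident T (Src T y)) (h \<cdot> (g1 \<cdot> y))"
    unfolding H by (rule U_Comp) (simp_all add: e1[THEN assoc_eq])
  ultimately show ?thesis by simp
qed

sublocale U: category U
proof
  fix F assume "F \<in> Arr U"
  then show "Src U F \<in> Ob U" "Tgt U F \<in> Ob U" using U_Arr_cases[of F] by auto
next
  fix A assume "A \<in> Ob U"
  then show "Ident U A \<in> Hom U A A" by simp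
next
  fix F G X Y Z assume FG: "F \<in> Hom U X Y" "G \<in> Hom U Y Z"
  obtain s f where F: "s \<in> Sig" "f \<in> Arr T" "Src T s = Src T f" "F = cls s f" using U_Arr_cases[of F] FG by auto
  obtain t g where G: "t \<in> Sig" "g \<in> Arr T" "Src T t = Src T g" "G = cls t g" using U_Arr_cases[of G] FG by auto
  have "Tgt T f = Tgt T t" using FG F G by simp
  then obtain p q where "p \<in> Sig \<and> q \<in> Arr T \<and> Tgt T p = Src T f \<and> Tgt T q = Src T g \<and> Src T p = Src T q \<and> f \<cdot> p = t \<cdot> q \<and>
    cls t g \<cdot>\<^bsub>U\<^esub> cls s f = cls (s \<cdot> p) (g \<cdot> q)" using U_Comp_ex[of s f t g] F G by blast
  then show "G \<cdot>\<^bsub>U\<^esub> F \<in> Hom U X Z" using F G FG by simp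
next
  fix F X Y assume FG: "F \<in> Hom U X Y"
  obtain s f where F: "s \<in> Sig" "f \<in> Arr T" "Src T s = Src T f" "F = cls s f" using U_Arr_cases[of F] FG by auto
  have [simp]: "Tgt T s = X" "Tgt T f = Y" using FG F by simp_all
  note [simp] = F(1-3)
  have [simp]: "X \<in> Ob T" using Tgt_in_Ob[OF Sig_Arr[OF F(1)]] by simp
  show "F \<cdot>\<^bsub>U\<^esub> Ident U X = F"
    using U_Comp[of "Ident T X" "Ident T X" s f s "Ident T (Src T f)"] by (simp add: F(4))
  show "Ident U Y \<cdot>\<^bsub>U\<^esub> F = F" using cls_Comp_V[of s f "Ident T Y"] Tgt_in_Ob[OF F(2)] by (simp add: F(4))
next
  fix F G H W X Y Z assume "F \<in> Hom U W X" "G \<in> Hom U X Y" "H \<in> Hom U Y Z"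
  then show "(H \<cdot>\<^bsub>U\<^esub> G) \<cdot>\<^bsub>U\<^esub> F = H \<cdot>\<^bsub>U\<^esub> (G \<cdot>\<^bsub>U\<^esub> F)" using U_assoc by simp
qed

end

context add_functor
begin

lemma F_biproduct:
  assumes "biproduct C X Y B" "X \<in> Ob C" "Y \<in> Ob C"
  shows "biproduct D (OMap F X) (OMap F Y) (OMap F B)"
proof -
  obtain i j p q where [simp]: "i \<in> Arr C" "j \<in> Arr C" "p \<in> Arr C" "q \<in> Arr C" "Src C i = X" "Src C j = Y" "Src C p = B"
    "Src C q = B" "Tgt C i = B" "Tgt C j = B" "Tgt C p = X" "Tgt C q = Y"
    and e: "p \<cdot>\<^bsub>C\<^esub> i = Ident C X" "q \<cdot>\<^bsub>C\<^esub> j = Ident C Y" "q \<cdot>\<^bsub>C\<^esub> i = Zero C X Y" "p \<cdot>\<^bsub>C\<^esub> j = Zero C Y X"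
        "i \<cdot>\<^bsub>C\<^esub> p \<boxplus>\<^bsub>C\<^esub> j \<cdot>\<^bsub>C\<^esub> q = Ident C B"
    using assms(1) unfolding biproduct_def Hom_def by blast
  have [simp]: "B \<in> Ob C" using C.Tgt_in_Ob[of i] by simp
  show ?thesis unfolding biproduct_def
  proof (intro bexI conjI)
    show "AMap F p \<cdot>\<^bsub>D\<^esub> AMap F i = Ident D (OMap F X)" using arg_cong[OF e(1), of "AMap F"] assms by simp
    show "AMap F q \<cdot>\<^bsub>D\<^esub> AMap F j = Ident D (OMap F Y)" using arg_cong[OF e(2), of "AMap F"] assms by simp
    show "AMap F q \<cdot>\<^bsub>D\<^esub> AMap F i = Zero D (OMap F X) (OMap F Y)" using arg_cong[OF e(3), of "AMap F"] assms by simp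
    show "AMap F p \<cdot>\<^bsub>D\<^esub> AMap F j = Zero D (OMap F Y) (OMap F X)" using arg_cong[OF e(4), of "AMap F"] assms by simp
    show "AMap F i \<cdot>\<^bsub>D\<^esub> AMap F p \<boxplus>\<^bsub>D\<^esub> AMap F j \<cdot>\<^bsub>D\<^esub> AMap F q = Ident D (OMap F B)"
      using arg_cong[OF e(5), of "AMap F"] by simp
  qed simp_all
qed

text \<open>Additive functors preserve zero objects and biproducts, so surjectivity on objects is
  enough. This applies both to the Verdier quotient and to the ideal quotient, whose projections are
  the identity on objects.\<close>

lemma additive_image:
  assumes C: "additive_category C" and onto: "Ob D = OMap F ` Ob C"
  shows "additive_category D"
proof -
  interpret A: additive_category C by fact
  show ?thesis
  proof
    obtain Z where Z: "zero_object C Z" using A.ex_zero_object by blast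
    then show "\<exists>Z. zero_object D Z" using F_zero_object by blast
  next
    fix X Y assume "X \<in> Ob D" "Y \<in> Ob D"
    then obtain X' Y' where XY: "X' \<in> Ob C" "Y' \<in> Ob C" "X = OMap F X'" "Y = OMap F Y'" using onto by blast
    obtain B where "B \<in> Ob C" "biproduct C X' Y' B" using A.ex_biproduct XY by blast
    then show "\<exists>B\<in>Ob D. biproduct D X Y B" using F_biproduct[of X' Y' B] XY by auto
  qed
qed

end

context verdier
begin

declare U_sel(3,4) [simp del]

lemma OMap_V [simp]: "OMap (verdier_functor T S) A = A"
  by (simp add: verdier_functor_def)

sublocale V: cat_functor T U "verdier_functor T S"
proof
  show "is_functor T U (verdier_functor T S)"
    unfolding is_functor_def
  proof (intro conjI ballI impI)
    fix f g assume [simp]: "f \<in> Arr T" "g \<in> Arr T" and e: "Tgt T f = Src T g"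
    have [simp]: "Src T g = Tgt T f" using e by simp
    have "cls (Ident T (Src T g)) g \<cdot>\<^bsub>U\<^esub> cls (Ident T (Src T f)) f = cls (Ident T (Src T f)) (g \<cdot> f)"
      by (rule cls_Comp_V) simp_all
    then show "V (g \<cdot> f) = V g \<cdot>\<^bsub>U\<^esub> V f" by (simp add: V_eq)
  qed (simp_all add: V_eq category_axioms U.category_axioms U_sel)
qed

lemmas V_simps [simp] = V.F_simps[simplified]

lemma cls_fraction:
  assumes [simp]: "s \<in> Sig" "f \<in> Arr T" "Src T s = Src T f"
  shows "cls s f \<cdot>\<^bsub>U\<^esub> V s = V f"
proof -
  have "cls s f \<cdot>\<^bsub>U\<^esub> cls (Ident T (Src T f)) s = cls (Ident T (Src T f) \<cdot> Ident T (Src T f)) (f \<cdot> Ident T (Src T f))"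
    by (rule U_Comp) simp_all
  then show ?thesis by (simp add: V_eq)
qed

text \<open>The inverse of \<open>V s\<close> is the roof with denominator \<open>s\<close> and
  identity numerator; one of the two composites is the class of \<open>(s, s)\<close>, which is the
  identity expanded by \<open>s\<close>.\<close>

lemma V_Sig_iso:
  assumes s [simp]: "s \<in> Sig"
  shows "is_iso U (V s)"
proof (rule U.is_isoI)
  let ?r = "cls s (Ident T (Src T s))"
  show "?r \<in> Arr U" "Src U ?r = Tgt U (V s)" "Tgt U ?r = Src U (V s)" "V s \<in> Arr U" by simp_all
  show "?r \<cdot>\<^bsub>U\<^esub> V s = Ident U (Src U (V s))"
    using cls_fraction[of s "Ident T (Src T s)"] by simp
  have "V s \<cdot>\<^bsub>U\<^esub> ?r = cls s s" using cls_Comp_V[of s "Ident T (Src T s)" s] by (simp add: V_eq)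
  also have "\<dots> = Ident U (Tgt U (V s))"
    using cls_refine[of "Ident T (Tgt T s)" s "Ident T (Tgt T s)"] by (simp add: U_sel)
  finally show "V s \<cdot>\<^bsub>U\<^esub> ?r = Ident U (Tgt U (V s))" .
qed

text \<open>Since \<open>V s\<close> is invertible, this equation determines the arrow. It allows
  calculations with composites in \<open>U\<close> in place of equivalence classes.\<close>

lemma U_fraction:
  assumes F: "F \<in> Arr U"
  shows "\<exists>s f. s \<in> Sig \<and> f \<in> Arr T \<and> Src T f = Src T s \<and> Tgt T s = Src U F \<and> Tgt T f = Tgt U F \<and> F \<cdot>\<^bsub>U\<^esub> V s = V f"
proof -
  obtain s f where sf: "s \<in> Sig" "f \<in> Arr T" "Src T s = Src T f" "F = cls s f" using U_Arr_cases[OF F] by blast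
  then have "Src U F = Tgt T s" "Tgt U F = Tgt T f" by simp_all
  then show ?thesis using sf cls_fraction[OF sf(1-3)] by metis
qed

text \<open>The way back from \<open>U\<close> to \<open>T\<close>: an equation between images
  becomes an honest equation after precomposing with a denominator.\<close>

lemma V_eq_iff:
  assumes [simp]: "f \<in> Arr T" "g \<in> Arr T" "Src T f = Src T g"
  shows "V f = V g \<longleftrightarrow> (\<exists>a. a \<in> Sig \<and> Tgt T a = Src T g \<and> f \<cdot> a = g \<cdot> a)"
proof
  assume "V f = V g"
  then have "cls (Ident T (Src T g)) f = cls (Ident T (Src T g)) g" by (simp add: V_eq)
  then show "\<exists>a. a \<in> Sig \<and> Tgt T a = Src T g \<and> f \<cdot> a = g \<cdot> a" by (rule cls_same_denominator) simp_all
next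
  assume "\<exists>a. a \<in> Sig \<and> Tgt T a = Src T g \<and> f \<cdot> a = g \<cdot> a"
  then obtain a where a [simp]: "a \<in> Sig" "Tgt T a = Src T g" and e: "f \<cdot> a = g \<cdot> a" by blast
  have "V f \<cdot>\<^bsub>U\<^esub> V a = V g \<cdot>\<^bsub>U\<^esub> V a" using arg_cong[OF e, of V] by simp
  from U.iso_cancel_right[OF V_Sig_iso[OF a(1)] _ _ _ _ this] show "V f = V g" by simp
qed

section \<open>Addition in \<open>U\<close> over common denominators\<close>

lemma U_common_denominator:
  assumes "F \<in> Arr U" "G \<in> Arr U" "Src U F = Src U G"
  shows "\<exists>s f g. s \<in> Sig \<and> f \<in> Arr T \<and> g \<in> Arr T \<and> Src T s = Src T g \<and> Src T f = Src T g \<and> Tgt T s = Src U G \<and>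
    Tgt T f = Tgt U F \<and> Tgt T g = Tgt U G \<and> F = cls s f \<and> G = cls s g"
proof -
  obtain s f where F: "s \<in> Sig" "f \<in> Arr T" "Src T s = Src T f" "F = cls s f" using U_Arr_cases[OF assms(1)] by blast
  obtain t g where G: "t \<in> Sig" "g \<in> Arr T" "Src T t = Src T g" "G = cls t g" using U_Arr_cases[OF assms(2)] by blast
  have [simp]: "Tgt T s = Tgt T t" using assms F G by simp
  obtain a b where ab [simp]: "a \<in> Sig" "b \<in> Sig" "Tgt T a = Src T f" "Tgt T b = Src T g" "Src T a = Src T b"
    and e: "cls s f = cls (s \<cdot> a) (f \<cdot> a)" "cls t g = cls (s \<cdot> a) (g \<cdot> b)"
    using common_denominator[OF F(1-3) G(1-3)] by (simp (no_asm_use)) blast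
  have "s \<cdot> a \<in> Sig" "f \<cdot> a \<in> Arr T" "g \<cdot> b \<in> Arr T" "Src T (s \<cdot> a) = Src T (g \<cdot> b)" "Src T (f \<cdot> a) = Src T (g \<cdot> b)"
    "Tgt T (s \<cdot> a) = Src U G" "Tgt T (f \<cdot> a) = Tgt U F" "Tgt T (g \<cdot> b) = Tgt U G"
    unfolding F(4) G(4) using F(1-3) G(1-3) by simp_all
  then show ?thesis using e F(4) G(4) by metis
qed

lemma U_common_denominator3:
  assumes "F \<in> Arr U" "G \<in> Arr U" "H \<in> Arr U" "Src U F = Src U G" "Src U G = Src U H"
  shows "\<exists>s f g h. s \<in> Sig \<and> f \<in> Arr T \<and> g \<in> Arr T \<and> h \<in> Arr T \<and> Src T s = Src T h \<and> Src T f = Src T h \<and> Src T g = Src T h \<and>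
    Tgt T s = Src U H \<and> Tgt T f = Tgt U F \<and> Tgt T g = Tgt U G \<and> Tgt T h = Tgt U H \<and>
    F = cls s f \<and> G = cls s g \<and> H = cls s h"
proof -
  obtain s f g where FG: "s \<in> Sig" "f \<in> Arr T" "g \<in> Arr T" "Src T s = Src T g" "Src T f = Src T g" "Tgt T s = Src U G"
    "Tgt T f = Tgt U F" "Tgt T g = Tgt U G" "F = cls s f" "G = cls s g"
    using U_common_denominator[OF assms(1,2,4)] by blast
  obtain t h where H: "t \<in> Sig" "h \<in> Arr T" "Src T t = Src T h" "H = cls t h" using U_Arr_cases[OF assms(3)] by blast
  have [simp]: "Tgt T s = Tgt T t" using assms FG(1-6) H by simp
  obtain a b where ab [simp]: "a \<in> Sig" "b \<in> Sig" "Tgt T a = Src T g" "Tgt T b = Src T h" "Src T a = Src T b"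
    and e: "cls s g = cls (s \<cdot> a) (g \<cdot> a)" "cls t h = cls (s \<cdot> a) (h \<cdot> b)"
    using common_denominator[OF FG(1,3,4) H(1-3)] by (simp (no_asm_use)) blast
  have e2: "cls s f = cls (s \<cdot> a) (f \<cdot> a)" using cls_refine[of s a f] FG(1-5) by simp
  have "s \<cdot> a \<in> Sig" "f \<cdot> a \<in> Arr T" "g \<cdot> a \<in> Arr T" "h \<cdot> b \<in> Arr T" "Src T (s \<cdot> a) = Src T (h \<cdot> b)" "Src T (f \<cdot> a) = Src T (h \<cdot> b)"
     "Src T (g \<cdot> a) = Src T (h \<cdot> b)" "Tgt T (s \<cdot> a) = Src U H" "Tgt T (f \<cdot> a) = Tgt U F" "Tgt T (g \<cdot> a) = Tgt U G" "Tgt T (h \<cdot> b) = Tgt U H"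
    unfolding H(4) using FG(1-8) H(1-3) by simp_all
  then show ?thesis using e e2 FG(9,10) H(4) by metis
qed

lemma cls_Zero:
  assumes [simp]: "s \<in> Sig" "A \<in> Ob T" "Src T s = B"
  shows "cls s (Zero T B A) = Zero U (Tgt T s) A"
proof -
  have [simp]: "B \<in> Ob T" using Src_in_Ob[OF Sig_Arr[OF assms(1)]] by simp
  show ?thesis using cls_refine[of "Ident T (Tgt T s)" s "Zero T (Tgt T s) A"] by (simp add: U_sel)
qed

lemma U_comm_group:
  assumes [simp]: "A \<in> Ob T" "B \<in> Ob T"
  shows "comm_group (hom_group U A B)"
proof (rule comm_groupI)
  let ?G = "hom_group U A B"
  have sel: "carrier ?G = Hom U A B" "x \<otimes>\<^bsub>?G\<^esub> y = x \<boxplus>\<^bsub>U\<^esub> y" "\<one>\<^bsub>?G\<^esub> = Zero U A B" for x y by (simp_all add: hom_group_def)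
  {
    fix x y assume "x \<in> carrier ?G" "y \<in> carrier ?G"
    then have xy: "x \<in> Arr U" "y \<in> Arr U" "Src U x = A" "Src U y = A" "Tgt U x = B" "Tgt U y = B" by (simp_all add: sel)
    then obtain s f g where "s \<in> Sig" "f \<in> Arr T" "g \<in> Arr T" "Src T s = Src T g" "Src T f = Src T g" "Tgt T s = A"
      "Tgt T f = B" "Tgt T g = B" "x = cls s f" "y = cls s g"
      using U_common_denominator[OF xy(1,2)] by auto
    then show "x \<otimes>\<^bsub>?G\<^esub> y \<in> carrier ?G" "x \<otimes>\<^bsub>?G\<^esub> y = y \<otimes>\<^bsub>?G\<^esub> x" by (simp_all add: sel Add_commute[of f g])
  }
  show "\<one>\<^bsub>?G\<^esub> \<in> carrier ?G" by (simp add: sel U_sel)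
  {
    fix x y z assume "x \<in> carrier ?G" "y \<in> carrier ?G" "z \<in> carrier ?G"
    then have xyz: "x \<in> Arr U" "y \<in> Arr U" "z \<in> Arr U" "Src U x = A" "Src U y = A" "Src U z = A"
      "Tgt U x = B" "Tgt U y = B" "Tgt U z = B" by (simp_all add: sel)
    then obtain s f g h where "s \<in> Sig" "f \<in> Arr T" "g \<in> Arr T" "h \<in> Arr T" "Src T s = Src T h" "Src T f = Src T h" "Src T g = Src T h"
      "Tgt T f = B" "Tgt T g = B" "Tgt T h = B" "x = cls s f" "y = cls s g" "z = cls s h"
      using U_common_denominator3[OF xyz(1-3)] by auto
    then show "x \<otimes>\<^bsub>?G\<^esub> y \<otimes>\<^bsub>?G\<^esub> z = x \<otimes>\<^bsub>?G\<^esub> (y \<otimes>\<^bsub>?G\<^esub> z)" by (simp add: sel Add_assoc)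
  }
  {
    fix x assume "x \<in> carrier ?G"
    then have x: "x \<in> Arr U" "Src U x = A" "Tgt U x = B" by (simp_all add: sel)
    obtain s f where sf [simp]: "s \<in> Sig" "f \<in> Arr T" "Src T s = Src T f" and xe: "x = cls s f" using U_Arr_cases[OF x(1)] by blast
    have [simp]: "Tgt T s = A" "Tgt T f = B" using x unfolding xe by simp_all
    have z: "Zero U A B = cls s (Zero T (Src T f) B)" by (simp add: cls_Zero)
    show "\<one>\<^bsub>?G\<^esub> \<otimes>\<^bsub>?G\<^esub> x = x" unfolding sel xe z by simp
    show "\<exists>y\<in>carrier ?G. y \<otimes>\<^bsub>?G\<^esub> x = \<one>\<^bsub>?G\<^esub>" unfolding sel xe z
      by (rule bexI[of _ "cls s (Neg T f)"]) simp_all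
  }
qed

sublocale U: preadditive_category U
proof (intro preadditive_category.intro preadditive_category_axioms.intro)
  show "category U" by (rule U.category_axioms)
next
  show "comm_group (hom_group U A B)" if "A \<in> Ob U" "B \<in> Ob U" for A B using U_comm_group that by simp
next
  fix F X Y G Z H assume FGH: "F \<in> Hom U X Y" "G \<in> Hom U Y Z" "H \<in> Hom U Y Z"
  obtain s f where F [simp]: "s \<in> Sig" "f \<in> Arr T" "Src T s = Src T f" and Fe: "F = cls s f"
    using U_Arr_cases[of F] FGH by auto
  obtain t g h where GH [simp]: "t \<in> Sig" "g \<in> Arr T" "h \<in> Arr T" "Src T t = Src T h" "Src T g = Src T h"
    and GHe: "G = cls t g" "H = cls t h"
    using U_common_denominator[of G H] FGH by auto
  have [simp]: "Tgt T f = Tgt T t" "Tgt T g = Tgt T h" using FGH unfolding Fe GHe by simp_all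
  obtain p q where pq [simp]: "p \<in> Sig" "q \<in> Arr T" "Tgt T p = Src T f" "Tgt T q = Src T h" "Src T p = Src T q"
    and e: "f \<cdot> p = t \<cdot> q" using Ore[of f t] by (simp (no_asm_use)) blast
  have "cls t g \<cdot>\<^bsub>U\<^esub> cls s f = cls (s \<cdot> p) (g \<cdot> q)" by (rule U_Comp) (simp_all add: e)
  moreover have "cls t h \<cdot>\<^bsub>U\<^esub> cls s f = cls (s \<cdot> p) (h \<cdot> q)" by (rule U_Comp) (simp_all add: e)
  moreover have "cls t (g \<boxplus> h) \<cdot>\<^bsub>U\<^esub> cls s f = cls (s \<cdot> p) ((g \<boxplus> h) \<cdot> q)" by (rule U_Comp) (simp_all add: e)
  ultimately show "(G \<boxplus>\<^bsub>U\<^esub> H) \<cdot>\<^bsub>U\<^esub> F = G \<cdot>\<^bsub>U\<^esub> F \<boxplus>\<^bsub>U\<^esub> H \<cdot>\<^bsub>U\<^esub> F" unfolding Fe GHe by simp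
next
  fix F X Y G Z H assume FGH: "F \<in> Hom U X Y" "G \<in> Hom U X Y" "H \<in> Hom U Y Z"
  obtain t h where H [simp]: "t \<in> Sig" "h \<in> Arr T" "Src T t = Src T h" and He: "H = cls t h"
    using U_Arr_cases[of H] FGH by auto
  obtain s f g where FG [simp]: "s \<in> Sig" "f \<in> Arr T" "g \<in> Arr T" "Src T s = Src T g" "Src T f = Src T g"
    and FGe: "F = cls s f" "G = cls s g"
    using U_common_denominator[of F G] FGH by auto
  have [simp]: "Tgt T f = Tgt T t" "Tgt T g = Tgt T t" using FGH unfolding He FGe by simp_all
  obtain p q where pq [simp]: "p \<in> Sig" "q \<in> Arr T" "Tgt T p = Src T g" "Tgt T q = Src T h" "Src T p = Src T q"
    and e: "f \<cdot> p = t \<cdot> q" using Ore[of f t] by (simp (no_asm_use)) blast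
  obtain p' q' where pq' [simp]: "p' \<in> Sig" "q' \<in> Arr T" "Tgt T p' = Src T g" "Tgt T q' = Src T h" "Src T p' = Src T q'"
    and e': "g \<cdot> p' = t \<cdot> q'" using Ore[of g t] by (simp (no_asm_use)) blast
  \<comment> \<open>The completions for \<open>f\<close> and \<open>g\<close> have different
    denominators \<open>p\<close> and \<open>p'\<close>. Refining both to \<open>p \<cdot> x\<close>
    gives a completion that serves \<open>f\<close>, \<open>g\<close> and their sum.\<close>
  obtain x y where xy [simp]: "x \<in> Sig" "y \<in> Arr T" "Tgt T x = Src T q" "Tgt T y = Src T q'" "Src T x = Src T y"
    and ex: "p \<cdot> x = p' \<cdot> y" using Ore[of p p'] by (simp (no_asm_use)) blast
  have f: "f \<cdot> (p \<cdot> x) = t \<cdot> (q \<cdot> x)" by (simp add: e[THEN assoc_eq])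
  have g: "g \<cdot> (p \<cdot> x) = t \<cdot> (q' \<cdot> y)" by (simp add: ex e'[THEN assoc_eq])
  have "cls t h \<cdot>\<^bsub>U\<^esub> cls s f = cls (s \<cdot> (p \<cdot> x)) (h \<cdot> (q \<cdot> x))" by (rule U_Comp) (simp_all add: f)
  moreover have "cls t h \<cdot>\<^bsub>U\<^esub> cls s g = cls (s \<cdot> (p \<cdot> x)) (h \<cdot> (q' \<cdot> y))" by (rule U_Comp) (simp_all add: g)
  moreover have "cls t h \<cdot>\<^bsub>U\<^esub> cls s (f \<boxplus> g) = cls (s \<cdot> (p \<cdot> x)) (h \<cdot> (q \<cdot> x \<boxplus> q' \<cdot> y))"
    by (rule U_Comp) (simp_all add: f g)
  ultimately show "H \<cdot>\<^bsub>U\<^esub> (F \<boxplus>\<^bsub>U\<^esub> G) = H \<cdot>\<^bsub>U\<^esub> F \<boxplus>\<^bsub>U\<^esub> H \<cdot>\<^bsub>U\<^esub> G" unfolding He FGe by simp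
qed

sublocale V: add_functor T U "verdier_functor T S"
  by unfold_locales (simp add: V_eq)

lemmas V_add_simps [simp] = V.F_Add V.F_Zero[simplified] V.F_Neg

sublocale U: additive_category U
  using V.additive_image[OF additive_category_axioms] by simp

section \<open>The shift of the Verdier quotient\<close>

lemma U_ShA [simp]:
  assumes [simp]: "s \<in> Sig" "f \<in> Arr T" "Src T s = Src T f"
  shows "ShA U (cls s f) = cls (ShA T s) (ShA T f)"
proof -
  have "cls (ShA T t) (ShA T g) = cls (ShA T s) (ShA T f)" if m: "(t, g) \<in> cls s f" for t g
  proof -
    note ty [simp] = cls_mem(1-3)[OF m]
    obtain a b where ab [simp]: "a \<in> Sig" "b \<in> Sig" "Tgt T a = Src T g" "Tgt T b = Src T f" "Src T a = Src T b"
      and e: "t \<cdot> a = s \<cdot> b" "g \<cdot> a = f \<cdot> b"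
      using cls_eqD[OF cls_mem(4)[OF m]] by (simp (no_asm_use)) blast
    show ?thesis
      by (rule cls_eqI[of _ _ _ _ "ShA T a" "ShA T b"])
        (use arg_cong[OF e(1), of "ShA T"] arg_cong[OF e(2), of "ShA T"] Sig_shift in simp_all)
  qed
  then have "(\<Union>(t, g) \<in> cls s f. cls (ShA T t) (ShA T g)) = cls (ShA T s) (ShA T f)"
    using cls_self[OF assms] by fast
  then show ?thesis by (simp add: U_eq verdier_precat_def)
qed

lemma V_ShA: "f \<in> Arr T \<Longrightarrow> ShA U (V f) = V (ShA T f)"
  by (simp add: V_eq)

lemma shift_sel_U: "OMap (shift_functor U) = ShO T" "AMap (shift_functor U) = ShA U"
  by (simp_all add: shift_functor_def)

sublocale ShU: add_functor U U "shift_functor U"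
proof
  show "is_functor U U (shift_functor U)"
    unfolding is_functor_def shift_sel_U
  proof (intro conjI ballI impI)
    fix F assume "F \<in> Arr U"
    then obtain s f where "s \<in> Sig" "f \<in> Arr T" "Src T s = Src T f" "F = cls s f" using U_Arr_cases by blast
    then show "ShA U F \<in> Hom U (ShO T (Src U F)) (ShO T (Tgt U F))" by (simp add: Sig_shift)
  next
    fix A assume "A \<in> Ob U"
    then show "ShA U (Ident U A) = Ident U (ShO T A)" by (simp add: U_sel)
  next
    fix F G assume FG: "F \<in> Arr U" "G \<in> Arr U" "Tgt U F = Src U G"
    obtain s f where F [simp]: "s \<in> Sig" "f \<in> Arr T" "Src T s = Src T f" and Fe: "F = cls s f"
      using U_Arr_cases[OF FG(1)] by blast
    obtain t g where G [simp]: "t \<in> Sig" "g \<in> Arr T" "Src T t = Src T g" and Ge: "G = cls t g"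
      using U_Arr_cases[OF FG(2)] by blast
    have [simp]: "Tgt T f = Tgt T t" using FG unfolding Fe Ge by simp
    obtain p q where pq [simp]: "p \<in> Sig" "q \<in> Arr T" "Tgt T p = Src T f" "Tgt T q = Src T g" "Src T p = Src T q"
      and e: "f \<cdot> p = t \<cdot> q" using Ore[of f t] by (simp (no_asm_use)) blast
    have "cls t g \<cdot>\<^bsub>U\<^esub> cls s f = cls (s \<cdot> p) (g \<cdot> q)" by (rule U_Comp) (simp_all add: e)
    moreover have "cls (ShA T t) (ShA T g) \<cdot>\<^bsub>U\<^esub> cls (ShA T s) (ShA T f) = cls (ShA T s \<cdot> ShA T p) (ShA T g \<cdot> ShA T q)"
      by (rule U_Comp) (use arg_cong[OF e, of "ShA T"] Sig_shift in simp_all)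
    ultimately show "ShA U (G \<cdot>\<^bsub>U\<^esub> F) = ShA U G \<cdot>\<^bsub>U\<^esub> ShA U F" unfolding Fe Ge by simp
  qed (simp_all add: U.category_axioms)
next
  fix F G assume FG: "F \<in> Arr U" "G \<in> Arr U" "Src U F = Src U G" "Tgt U F = Tgt U G"
  obtain s f g where [simp]: "s \<in> Sig" "f \<in> Arr T" "g \<in> Arr T" "Src T s = Src T g" "Src T f = Src T g"
    and FGe: "F = cls s f" "G = cls s g"
    using U_common_denominator[OF FG(1-3)] by blast
  have [simp]: "Tgt T f = Tgt T g" using FG unfolding FGe by simp
  show "AMap (shift_functor U) (F \<boxplus>\<^bsub>U\<^esub> G) = AMap (shift_functor U) F \<boxplus>\<^bsub>U\<^esub> AMap (shift_functor U) G"
    unfolding shift_sel_U FGe by (simp add: Sig_shift)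
qed

text \<open>The source of \<open>s\<close> need not be a shift. An isomorphism \<open>i\<close> from
  a shift makes it one, after which fullness of the shift un-shifts the whole denominator. It is
  used to lift equations and fractions along the shift of \<open>U\<close>.\<close>

lemma Sig_shift_refine:
  assumes s: "s \<in> Sig" "Tgt T s = ShO T A" "A \<in> Ob T"
  shows "\<exists>s' i. s' \<in> Sig \<and> Tgt T s' = A \<and> i \<in> Sig \<and> Src T i = ShO T (Src T s') \<and> Tgt T i = Src T s \<and> ShA T s' = s \<cdot> i"
proof -
  note [simp] = s
  obtain B i where i [simp]: "B \<in> Ob T" "is_iso T i" "Src T i = ShO T B" "Tgt T i = Src T s"
    using Sh_onto[of "Src T s"] by (simp (no_asm_use)) blast
  have iS [simp]: "i \<in> Sig" by (rule Sig_iso[OF i(2)])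
  obtain s' where s' [simp]: "s' \<in> Arr T" "Src T s' = B" "Tgt T s' = A" and e: "ShA T s' = s \<cdot> i"
    using Sh_full[of "s \<cdot> i" B A] by (simp (no_asm_use)) blast
  have "s' \<in> Sig" using Sig_shift_iff[OF s'(1)] unfolding e by simp
  then show ?thesis using e by (intro exI[of _ s'] exI[of _ i]) simp
qed

lemma ShU_fully_faithful: "fully_faithful U U (shift_functor U)"
  unfolding fully_faithful_def shift_sel_U
proof (intro conjI ballI impI)
  fix F G assume F: "F \<in> Arr U" and G: "G \<in> Arr U" and FG: "Src U F = Src U G \<and> Tgt U F = Tgt U G \<and> ShA U F = ShA U G"
  obtain s f g where [simp]: "s \<in> Sig" "f \<in> Arr T" "g \<in> Arr T" "Src T s = Src T g" "Src T f = Src T g"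
    and FGe: "F = cls s f" "G = cls s g"
    using U_common_denominator[OF F G] FG by blast
  have [simp]: "Tgt T f = Tgt T g" using FG unfolding FGe by simp
  have "cls (ShA T s) (ShA T f) = cls (ShA T s) (ShA T g)" using FG unfolding FGe by simp
  then obtain a where a [simp]: "a \<in> Sig" "Tgt T a = ShO T (Src T g)" and e: "ShA T f \<cdot> a = ShA T g \<cdot> a"
    using cls_same_denominator[of "ShA T s" "ShA T f" "ShA T g"] Sig_shift[of s] by (simp (no_asm_use)) blast
  obtain b i where b [simp]: "b \<in> Sig" "Tgt T b = Src T g" "i \<in> Sig" "Src T i = ShO T (Src T b)" "Tgt T i = Src T a"
    and eb: "ShA T b = a \<cdot> i" using Sig_shift_refine[of a "Src T g"] by (simp (no_asm_use)) blast
  have "ShA T (f \<cdot> b) = ShA T (g \<cdot> b)" by (simp add: eb e[THEN assoc_eq])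
  from Sh_faithful[OF this] have "f \<cdot> b = g \<cdot> b" by simp
  then show "F = G" unfolding FGe using cls_refine[of s b f] cls_refine[of s b g] by simp
next
  fix A B H assume "A \<in> Ob U" "B \<in> Ob U" and H: "H \<in> Hom U (ShO T A) (ShO T B)"
  then have [simp]: "A \<in> Ob T" "B \<in> Ob T" by simp_all
  obtain s h where sh [simp]: "s \<in> Sig" "h \<in> Arr T" "Src T s = Src T h" and He: "H = cls s h"
    using U_Arr_cases[of H] H by auto
  have [simp]: "Tgt T s = ShO T A" "Tgt T h = ShO T B" using H unfolding He by simp_all
  obtain t i where t [simp]: "t \<in> Sig" "Tgt T t = A" "i \<in> Sig" "Src T i = ShO T (Src T t)" "Tgt T i = Src T h"
    and et: "ShA T t = s \<cdot> i" using Sig_shift_refine[of s A] by (simp (no_asm_use)) blast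
  obtain g where g [simp]: "g \<in> Arr T" "Src T g = Src T t" "Tgt T g = B" and eg: "ShA T g = h \<cdot> i"
    using Sh_full[of "h \<cdot> i" "Src T t" B] by (simp (no_asm_use)) blast
  have "ShA U (cls t g) = H" unfolding He using cls_refine[of s i h] by (simp add: et eg)
  then show "\<exists>F\<in>Hom U A B. ShA U F = H" by (intro bexI[of _ "cls t g"]) simp_all
qed

lemma ShU_ess_surj: "ess_surj U U (shift_functor U)"
  unfolding ess_surj_def shift_sel_U
proof
  fix A assume "A \<in> Ob U"
  then obtain B i where "B \<in> Ob T" "is_iso T i" "Src T i = ShO T B" "Tgt T i = A" using Sh_onto[of A] by auto
  then show "\<exists>B\<in>Ob U. isomorphic U (ShO T B) A" using V.F_inv(1)[of i] is_iso_Arr[of T i]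
    unfolding isomorphic_def by (intro bexI[of _ B] bexI[of _ "V i"]) simp_all
qed

lemma ShU_equivalence: "additive_equivalence U U (shift_functor U)"
  unfolding additive_equivalence_def additive_functor_def
  using ShU.equivalence_functorI[OF ShU_fully_faithful ShU_ess_surj] ShU.is_functor U.additive_category_axioms ShU.F_Add
  by blast

sublocale U: shift_category U
  by unfold_locales (rule ShU_equivalence)

text \<open>Clearing denominators: write \<open>F\<close> as a fraction \<open>f\<close> over
  \<open>s\<close>. That \<open>V v\<close> kills it means that \<open>v \<cdot> f\<close> vanishes
  after some \<open>a\<close> in \<open>Sig\<close>, so \<open>f \<cdot> a\<close> lifts through
  \<open>u\<close> in \<open>T\<close>, and dividing by \<open>s \<cdot> a\<close> lifts
  \<open>F\<close>.\<close>

lemma V_weak_kernel: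
  assumes k: "weak_kernel T u v" and [simp]: "u \<in> Arr T" "v \<in> Arr T" "Tgt T u = Src T v"
  shows "weak_kernel U (V u) (V v)"
  unfolding weak_kernel_def
proof (intro conjI ballI impI)
  show "V v \<cdot>\<^bsub>U\<^esub> V u = Zero U (Src U (V u)) (Tgt U (V v))"
    using arg_cong[OF weak_kernelD[OF k], of V] by simp
  fix F assume [simp]: "F \<in> Arr U" and F: "Tgt U F = Src U (V v) \<and> V v \<cdot>\<^bsub>U\<^esub> F = Zero U (Src U F) (Tgt U (V v))"
  then have [simp]: "Tgt U F = Src T v" and vF: "V v \<cdot>\<^bsub>U\<^esub> F = Zero U (Src U F) (Tgt T v)" by simp_all
  obtain s f where sf [simp]: "s \<in> Sig" "f \<in> Arr T" "Src T f = Src T s" "Tgt T s = Src U F" "Tgt T f = Src T v"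
    and e: "F \<cdot>\<^bsub>U\<^esub> V s = V f" using U_fraction[of F] by (simp (no_asm_use)) blast
  have [simp]: "Src U F \<in> Ob T" using U.Src_in_Ob[of F] by simp
  have "V (v \<cdot> f) = V v \<cdot>\<^bsub>U\<^esub> (F \<cdot>\<^bsub>U\<^esub> V s)" by (simp add: e)
  also have "\<dots> = V (Zero T (Src T s) (Tgt T v))" by (simp add: vF[THEN U.assoc_eq])
  finally obtain a where a [simp]: "a \<in> Sig" "Tgt T a = Src T s" and ea: "(v \<cdot> f) \<cdot> a = Zero T (Src T s) (Tgt T v) \<cdot> a"
    using V_eq_iff[of "v \<cdot> f" "Zero T (Src T s) (Tgt T v)"] by (simp (no_asm_use) del: assoc Comp_Zero) blast
  have "v \<cdot> (f \<cdot> a) = Zero T (Src T a) (Tgt T v)" using ea by simp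
  then obtain g where g [simp]: "g \<in> Arr T" "Src T g = Src T a" "Tgt T g = Src T u" and eg: "f \<cdot> a = u \<cdot> g"
    using weak_kernel_factor[OF k, of "f \<cdot> a"] by (simp (no_asm_use)) blast
  note [simp] = V_Sig_iso
  have i: "is_iso U (V (s \<cdot> a))" by (rule V_Sig_iso) simp
  have "F = V u \<cdot>\<^bsub>U\<^esub> (V g \<cdot>\<^bsub>U\<^esub> inv_arr U (V (s \<cdot> a)))"
  proof (rule U.iso_cancel_right[OF i])
    have "F \<cdot>\<^bsub>U\<^esub> V (s \<cdot> a) = V (f \<cdot> a)" by (simp add: e[THEN U.assoc_eq])
    also have "\<dots> = V u \<cdot>\<^bsub>U\<^esub> V g" unfolding eg by simp
    finally show "F \<cdot>\<^bsub>U\<^esub> V (s \<cdot> a) = (V u \<cdot>\<^bsub>U\<^esub> (V g \<cdot>\<^bsub>U\<^esub> inv_arr U (V (s \<cdot> a)))) \<cdot>\<^bsub>U\<^esub> V (s \<cdot> a)"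
      using i by (simp del: V_simps(6))
  qed (use i in \<open>simp_all del: V_simps(6)\<close>)
  then show "\<exists>G\<in>Hom U (Src U F) (Src U (V u)). F = V u \<cdot>\<^bsub>U\<^esub> G"
    by (rule bexI) (use i in \<open>simp del: V_simps(6)\<close>)
qed

lemma V_exact:
  assumes t: "(u, v, w) \<in> Tri T"
  shows "exact_triangle U (V u, V v, V w)"
  using Tri_simps[OF t] Tri_exact[OF t] V_weak_kernel[of u v] V_weak_kernel[of v w] V_weak_kernel[of w "ShA T u"]
  by (simp add: V_ShA)

end

section \<open>The Verdier quotient is triangulated\<close>

context preadditive_category
begin

lemma weak_kernel_iso:
  assumes k: "weak_kernel C u v" and i [simp]: "is_iso C a" "is_iso C b" "is_iso C c"
    and [simp]: "u \<in> Arr C" "v \<in> Arr C" "Tgt C u = Src C v" "u' \<in> Arr C" "v' \<in> Arr C" "Tgt C u' = Src C v'"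
      "Src C a = Src C u" "Tgt C a = Src C u'" "Src C b = Src C v" "Tgt C b = Src C v'" "Src C c = Tgt C v" "Tgt C c = Tgt C v'"
    and e: "b \<cdot> u = u' \<cdot> a" "c \<cdot> v = v' \<cdot> b"
  shows "weak_kernel C u' v'"
  unfolding weak_kernel_def
proof (intro conjI ballI impI)
  note [simp] = i[THEN is_iso_Arr]
  show "v' \<cdot> u' = Zero C (Src C u') (Tgt C v')"
  proof (rule iso_cancel_right[OF i(1)])
    have "v' \<cdot> (u' \<cdot> a) = c \<cdot> (v \<cdot> u)" by (simp add: e(2)[THEN assoc_eq] e(1))
    then show "(v' \<cdot> u') \<cdot> a = Zero C (Src C u') (Tgt C v') \<cdot> a" by (simp add: weak_kernelD[OF k])
  qed simp_all
  fix f assume [simp]: "f \<in> Arr C" and f: "Tgt C f = Src C v' \<and> v' \<cdot> f = Zero C (Src C f) (Tgt C v')"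
  then have [simp]: "Tgt C f = Src C v'" and vf: "v' \<cdot> f = Zero C (Src C f) (Tgt C v')" by blast+
  have "v \<cdot> (inv_arr C b \<cdot> f) = Zero C (Src C f) (Tgt C v)"
    by (rule iso_cancel_left[OF i(3)]) (simp_all add: e(2)[THEN assoc_eq] vf)
  then obtain g where g [simp]: "g \<in> Arr C" "Src C g = Src C f" "Tgt C g = Src C u" and eg: "inv_arr C b \<cdot> f = u \<cdot> g"
    using weak_kernel_factor[OF k, of "inv_arr C b \<cdot> f"] by (simp (no_asm_use)) blast
  have "f = b \<cdot> (u \<cdot> g)" by (simp flip: eg)
  then have "f = u' \<cdot> (a \<cdot> g)" by (simp add: e(1)[THEN assoc_eq])
  then show "\<exists>g\<in>Hom C (Src C f) (Src C u'). f = u' \<cdot> g" by (rule bexI) simp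
qed

end

context shift_category
begin

lemma exact_triangle_iso:
  assumes t: "exact_triangle T t" and i: "isomorphic_triangles T t t'"
  shows "exact_triangle T t'"
proof -
  obtain u v w u' v' w' where tt: "t = (u, v, w)" "t' = (u', v', w')" by (cases t; cases t')
  obtain a b c where abc: "is_iso T a" "is_iso T b" "is_iso T c"
    and m: "triangle_morphism T (u, v, w) (u', v', w') (a, b, c)"
    and c: "candidate_triangle T (u, v, w)" "candidate_triangle T (u', v', w')"
    using i unfolding isomorphic_triangles_def tt by blast
  have e: "b \<cdot> u = u' \<cdot> a" "c \<cdot> v = v' \<cdot> b" "ShA T a \<cdot> w = w' \<cdot> c" using m by simp_all
  have ty [simp]: "u \<in> Arr T" "v \<in> Arr T" "w \<in> Arr T" "Tgt T u = Src T v" "Tgt T v = Src T w"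
     "Tgt T w = ShO T (Src T u)" "u' \<in> Arr T" "v' \<in> Arr T" "w' \<in> Arr T" "Tgt T u' = Src T v'"
     "Tgt T v' = Src T w'" "Tgt T w' = ShO T (Src T u')" "a \<in> Arr T" "b \<in> Arr T" "c \<in> Arr T"
     "Src T a = Src T u" "Src T b = Src T v" "Src T c = Src T w"
     "Tgt T a = Src T u'" "Tgt T b = Src T v'" "Tgt T c = Src T w'"
    using c m by simp_all
  have k: "weak_kernel T u v" "weak_kernel T v w" "weak_kernel T w (ShA T u)" using t unfolding tt by simp_all
  have "weak_kernel T u' v'" by (rule weak_kernel_iso[OF k(1) abc]) (simp_all add: e)
  moreover have "weak_kernel T v' w'" by (rule weak_kernel_iso[OF k(2) abc(2,3) Sh_iso(1)[OF abc(1)]]) (simp_all add: e)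
  moreover have "ShA T b \<cdot> ShA T u = ShA T u' \<cdot> ShA T a" using arg_cong[OF e(1), of "ShA T"] by simp
  then have "weak_kernel T w' (ShA T u')"
    by (intro weak_kernel_iso[OF k(3) abc(3) Sh_iso(1)[OF abc(1)] Sh_iso(1)[OF abc(2)]]) (simp_all add: e)
  ultimately show ?thesis using c unfolding tt by simp
qed

lemma isomorphic_triangles_rotate:
  assumes i: "isomorphic_triangles T (u, v, w) (u', v', w')"
  shows "isomorphic_triangles T (v, w, Neg T (ShA T u)) (v', w', Neg T (ShA T u'))"
proof -
  obtain a b c where abc: "is_iso T a" "is_iso T b" "is_iso T c"
    and m: "triangle_morphism T (u, v, w) (u', v', w') (a, b, c)"
    and c: "candidate_triangle T (u, v, w)" "candidate_triangle T (u', v', w')"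
    using i unfolding isomorphic_triangles_def by blast
  have e: "b \<cdot> u = u' \<cdot> a" and h: "a \<in> Hom T (Src T u) (Src T u')" "b \<in> Hom T (Src T v) (Src T v')"
    using m unfolding triangle_morphism.simps by blast+
  have "ShA T b \<cdot> ShA T u = ShA T u' \<cdot> ShA T a" using arg_cong[OF e, of "ShA T"] h c by simp
  then have "triangle_morphism T (v, w, Neg T (ShA T u)) (v', w', Neg T (ShA T u')) (b, c, ShA T a)"
    using m c by simp
  moreover have "candidate_triangle T (v, w, Neg T (ShA T u))" "candidate_triangle T (v', w', Neg T (ShA T u'))"
    using c by simp_all
  ultimately show ?thesis unfolding isomorphic_triangles_def using abc Sh_iso(1) by blast
qed

end

text \<open>The class \<open>D\<close> is part of \<open>U\<close>, and the equation for it mentions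
  \<open>U\<close>. This is not circular, as isomorphism of candidate triangles does not look at
  \<open>Tri\<close>.\<close>

locale verdier_tri = verdier T S U D
  for T :: "('o, 'm, 'x) tri_cat_scheme" (structure) and S :: "'o set" and U D +
  assumes D_eq: "D = {t. \<exists>(u, v, w) \<in> Tri T. isomorphic_triangles U (V u, V v, V w) t}"
begin

lemma U_Tri: "t \<in> Tri U \<longleftrightarrow> (\<exists>u v w. (u, v, w) \<in> Tri T \<and> isomorphic_triangles U (V u, V v, V w) t)"
proof -
  have "Tri U = D" by (simp add: U_eq)
  then show ?thesis unfolding D_eq by auto
qed

lemma V_candidate: "(u, v, w) \<in> Tri T \<Longrightarrow> candidate_triangle U (V u, V v, V w)"
  using V_exact by simp

lemma V_Tri:
  assumes "(u, v, w) \<in> Tri T"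
  shows "(V u, V v, V w) \<in> Tri U"
  unfolding U_Tri using assms U.isomorphic_triangles_refl[OF V_candidate[OF assms]] by blast

lemma V_triangle_morphism:
  assumes "triangle_morphism T (u, v, w) (u', v', w') (a, b, c)" "(u, v, w) \<in> Tri T" "(u', v', w') \<in> Tri T"
  shows "triangle_morphism U (V u, V v, V w) (V u', V v', V w') (V a, V b, V c)"
proof -
  note ty = Tri_simps[OF assms(2)] Tri_simps[OF assms(3)]
  have e: "b \<cdot> u = u' \<cdot> a" "c \<cdot> v = v' \<cdot> b" "ShA T a \<cdot> w = w' \<cdot> c"
    and h: "a \<in> Hom T (Src T u) (Src T u')" "b \<in> Hom T (Src T v) (Src T v')" "c \<in> Hom T (Src T w) (Src T w')"
    using assms(1) unfolding triangle_morphism.simps by blast+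
  show ?thesis using arg_cong[OF e(1), of V] arg_cong[OF e(2), of V] arg_cong[OF e(3), of V] h ty
    by (simp add: V_ShA)
qed

section \<open>The axioms TR1 to TR4 in the Verdier quotient\<close>

lemma U_TR1_iso: "\<lbrakk>t \<in> Tri U; isomorphic_triangles U t t'\<rbrakk> \<Longrightarrow> t' \<in> Tri U"
  unfolding U_Tri using U.isomorphic_triangles_trans by blast

lemma U_Tri_exact:
  assumes "t \<in> Tri U"
  shows "exact_triangle U t"
  using assms U.exact_triangle_iso[OF V_exact] unfolding U_Tri by blast

lemma U_TR1_ident:
  assumes [simp]: "A \<in> Ob T" and Z: "zero_object U Z"
  shows "(Ident U A, Zero U A Z, Zero U Z (ShO T A)) \<in> Tri U"
proof -
  obtain Z0 where Z0: "zero_object T Z0" using ex_zero_object by blast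
  then have [simp]: "Z0 \<in> Ob T" by (simp add: zero_object_def)
  have [simp]: "Z \<in> Ob T" using Z by (simp add: zero_object_def)
  have z: "Ident U Z = Zero U Z Z" using U.zero_object_iff[of Z] Z by simp
  have z0: "Ident U Z0 = Zero U Z0 Z0" using V.F_zero_object[OF Z0] U.zero_object_iff[of Z0] by simp
  \<comment> \<open>A zero object of \<open>U\<close> need not be zero in \<open>T\<close>, so
    \<open>TR1_ident\<close> of \<open>T\<close> is used with a zero object \<open>Z0\<close> of
    \<open>T\<close>, and \<open>Z0\<close> is compared with \<open>Z\<close> in
    \<open>U\<close>.\<close>
  have i: "is_iso U (Zero U Z0 Z)"
    by (rule U.is_isoI[of _ "Zero U Z Z0"]) (simp_all add: z z0)
  have "isomorphic_triangles U (V (Ident T A), V (Zero T A Z0), V (Zero T Z0 (ShO T A)))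
    (Ident U A, Zero U A Z, Zero U Z (ShO T A))"
    unfolding isomorphic_triangles_def
    by (intro conjI exI[of _ "Ident U A"] exI[of _ "Zero U Z0 Z"] i) simp_all
  then show ?thesis unfolding U_Tri using TR1_ident[OF assms(1) Z0] by blast
qed

text \<open>If \<open>u\<close> is the fraction \<open>f\<close> over \<open>s\<close>, then
  \<open>V s\<close> identifies \<open>V f\<close> with \<open>u\<close>, so the cone of
  \<open>f\<close> serves for \<open>u\<close> once its last arrow is followed by the shift of
  \<open>s\<close>.\<close>

lemma U_TR1_cone:
  assumes u: "u \<in> Arr U"
  shows "\<exists>v w. (u, v, w) \<in> Tri U"
proof -
  obtain s f where sf [simp]: "s \<in> Sig" "f \<in> Arr T" "Src T f = Src T s" "Tgt T s = Src U u" "Tgt T f = Tgt U u"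
    and e: "u \<cdot>\<^bsub>U\<^esub> V s = V f" using U_fraction[OF u] by blast
  obtain p d where t: "(f, p, d) \<in> Tri T" using TR1_cone[of f] by auto
  have [simp]: "p \<in> Arr T" "d \<in> Arr T" "Src T p = Tgt U u" "Tgt T p = Src T d" "Tgt T d = ShO T (Src T s)"
    using Tri_simps[OF t] by simp_all
  note [simp] = u V_Sig_iso
  have [simp]: "Tgt U u \<in> Ob T" using U.Tgt_in_Ob[OF u] by simp
  have "isomorphic_triangles U (V f, V p, V d) (u, V p, V (ShA T s) \<cdot>\<^bsub>U\<^esub> V d)"
    unfolding isomorphic_triangles_def
    by (intro conjI exI[of _ "V s"] exI[of _ "Ident U (Tgt U u)"] exI[of _ "Ident U (Src T d)"])
      (simp_all add: V_ShA e)
  then show ?thesis using U_TR1_iso[OF V_Tri[OF t]] by blast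
qed

lemma U_rotate:
  assumes "(u, v, w) \<in> Tri U"
  shows "(v, w, Neg U (ShA U u)) \<in> Tri U"
proof -
  obtain a b c where t: "(a, b, c) \<in> Tri T" and i: "isomorphic_triangles U (V a, V b, V c) (u, v, w)"
    using assms unfolding U_Tri by blast
  have "isomorphic_triangles U (V b, V c, V (Neg T (ShA T a))) (v, w, Neg U (ShA U u))"
    using U.isomorphic_triangles_rotate[OF i] Tri_simps[OF t] by (simp add: V_ShA)
  then show ?thesis unfolding U_Tri using rotate[OF t] by blast
qed

text \<open>The given triangle is only isomorphic to the image of one in \<open>T\<close>. That one
  is rotated backwards in \<open>T\<close>, and the isomorphism has to be given a new first
  component.\<close>

lemma U_unrotate:
  assumes c: "candidate_triangle U (u, v, w)" and r: "(v, w, Neg U (ShA U u)) \<in> Tri U"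
  shows "(u, v, w) \<in> Tri U"
proof -
  have ty [simp]: "u \<in> Arr U" "v \<in> Arr U" "w \<in> Arr U" "Tgt U u = Src U v" "Tgt U v = Src U w" "Tgt U w = ShO T (Src U u)"
    using c by simp_all
  have [simp]: "Src U u \<in> Ob T" using U.Src_in_Ob[OF ty(1)] by simp
  obtain a b c where t: "(a, b, c) \<in> Tri T" and i: "isomorphic_triangles U (V a, V b, V c) (v, w, Neg U (ShA U u))"
    using r unfolding U_Tri by blast
  note [simp] = Tri_simps[OF t]
  obtain i1 i2 i3 where i [simp]: "is_iso U i1" "is_iso U i2" "is_iso U i3"
    and m: "triangle_morphism U (V a, V b, V c) (v, w, Neg U (ShA U u)) (i1, i2, i3)"
    using i unfolding isomorphic_triangles_def by blast
  note [simp] = i[THEN is_iso_Arr]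
  have [simp]: "Src U i1 = Src T a" "Tgt U i1 = Src U v" "Src U i2 = Src T b" "Tgt U i2 = Src U w"
     "Src U i3 = Src T c" "Tgt U i3 = ShO T (Src U u)"
    using m by simp_all
  have e: "i2 \<cdot>\<^bsub>U\<^esub> V a = v \<cdot>\<^bsub>U\<^esub> i1" "i3 \<cdot>\<^bsub>U\<^esub> V b = w \<cdot>\<^bsub>U\<^esub> i2" "ShA U i1 \<cdot>\<^bsub>U\<^esub> V c = Neg U (ShA U u) \<cdot>\<^bsub>U\<^esub> i3"
    using m unfolding triangle_morphism.simps by blast+
  obtain A j where j [simp]: "A \<in> Ob T" "is_iso T j" "Src T j = ShO T A" "Tgt T j = Src T c"
    using Sh_onto[of "Src T c"] by (simp (no_asm_use)) blast
  note [simp] = is_iso_Arr[OF j(2)] V.F_inv(1)[OF j(2)]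
  obtain z where z [simp]: "z \<in> Arr T" "Src T z = A" "Tgt T z = Src T a" and ez: "ShA T z = Neg T (c \<cdot> j)"
    and t': "(z, a, inv_arr T j \<cdot> b) \<in> Tri T"
    using unrotate[OF t j(2,3,1)] by (simp (no_asm_use)) blast
  \<comment> \<open>The old third component \<open>i3\<close>, read through the identification
    \<open>j\<close> of its source with \<open>A[1]\<close>, is an arrow between shifts; un-shifting
    it in \<open>U\<close> gives the new first component.\<close>
  obtain k where k [simp]: "k \<in> Arr U" "Src U k = A" "Tgt U k = Src U u" and ek: "ShA U k = i3 \<cdot>\<^bsub>U\<^esub> V j"
    using U.Sh_full[of "i3 \<cdot>\<^bsub>U\<^esub> V j" A "Src U u"] by (simp (no_asm_use)) blast
  have ik [simp]: "is_iso U k" by (rule U.Sh_reflects_iso) (simp_all add: ek)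
  have "ShA U (i1 \<cdot>\<^bsub>U\<^esub> V z) = ShA U (u \<cdot>\<^bsub>U\<^esub> k)"
    by (simp add: V_ShA ez ek e(3)[THEN U.assoc_eq])
  from U.Sh_faithful[OF this] have 1: "i1 \<cdot>\<^bsub>U\<^esub> V z = u \<cdot>\<^bsub>U\<^esub> k" by simp
  have 2: "ShA U k \<cdot>\<^bsub>U\<^esub> V (inv_arr T j \<cdot> b) = w \<cdot>\<^bsub>U\<^esub> i2"
  proof -
    have "V j \<cdot>\<^bsub>U\<^esub> V (inv_arr T j \<cdot> b) = V (j \<cdot> (inv_arr T j \<cdot> b))" by (simp del: inv_cancel)
    then have "V j \<cdot>\<^bsub>U\<^esub> V (inv_arr T j \<cdot> b) = V b" by simp
    then show ?thesis by (simp add: ek e(2) del: V_simps(6))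
  qed
  have "isomorphic_triangles U (V z, V a, V (inv_arr T j \<cdot> b)) (u, v, w)"
    unfolding isomorphic_triangles_def
    by (intro conjI exI[of _ k] exI[of _ i1] exI[of _ i2]) (use 1 2 e(1) V_candidate[OF t'] in simp_all)
  then show ?thesis using t' unfolding U_Tri by blast
qed

text \<open>The square in \<open>U\<close> is resolved by one arrow \<open>u0\<close> of
  \<open>T\<close> that maps to \<open>u\<close> along denominators and to \<open>u'\<close> along
  numerators. TR3 in \<open>T\<close> maps the cone of \<open>u0\<close> to both cones; the first
  map becomes invertible in \<open>U\<close>, and the quotient of the two is the filler.\<close>

lemma V_TR3:
  assumes t: "(u, v, w) \<in> Tri T" "(u', v', w') \<in> Tri T"
    and [simp]: "a \<in> Arr U" "b \<in> Arr U" "Src U a = Src T u" "Tgt U a = Src T u'" "Src U b = Tgt T u" "Tgt U b = Tgt T u'"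
    and e: "b \<cdot>\<^bsub>U\<^esub> V u = V u' \<cdot>\<^bsub>U\<^esub> a"
  shows "\<exists>c. triangle_morphism U (V u, V v, V w) (V u', V v', V w') (a, b, c)"
proof -
  note [simp] = Tri_simps[OF t(1)] Tri_simps[OF t(2)]
  obtain s al0 where s [simp]: "s \<in> Sig" "al0 \<in> Arr T" "Src T al0 = Src T s" "Tgt T s = Src T u" "Tgt T al0 = Src T u'"
    and es: "a \<cdot>\<^bsub>U\<^esub> V s = V al0" using U_fraction[of a] by (simp (no_asm_use)) blast
  obtain r be where r [simp]: "r \<in> Sig" "be \<in> Arr T" "Src T be = Src T r" "Tgt T r = Src T v" "Tgt T be = Src T v'"
    and er: "b \<cdot>\<^bsub>U\<^esub> V r = V be" using U_fraction[of b] by (simp (no_asm_use)) blast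
  \<comment> \<open>The denominators \<open>s\<close> and \<open>r\<close> of \<open>a\<close> and
    \<open>b\<close> are unrelated. Completing \<open>u \<cdot> s\<close> against \<open>r\<close>
    makes the square over \<open>u\<close> commute in \<open>T\<close>.\<close>
  obtain p q where pq [simp]: "p \<in> Sig" "q \<in> Arr T" "Tgt T p = Src T s" "Tgt T q = Src T r" "Src T p = Src T q"
    and epq: "(u \<cdot> s) \<cdot> p = r \<cdot> q" using Ore[of "u \<cdot> s" r] by (simp (no_asm_use) del: assoc) blast
  have "V (be \<cdot> q) = (b \<cdot>\<^bsub>U\<^esub> V r) \<cdot>\<^bsub>U\<^esub> V q" by (simp add: er del: U.assoc)
  also have "\<dots> = b \<cdot>\<^bsub>U\<^esub> V (r \<cdot> q)" by simp
  also have "\<dots> = b \<cdot>\<^bsub>U\<^esub> (V u \<cdot>\<^bsub>U\<^esub> V (s \<cdot> p))" unfolding epq[symmetric] by simp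
  also have "\<dots> = V (u' \<cdot> (al0 \<cdot> p))" by (simp add: e[THEN U.assoc_eq] es[THEN U.assoc_eq])
  \<comment> \<open>The square over \<open>u'\<close> commutes only in \<open>U\<close> so far; a
    further refinement \<open>x\<close> makes it commute in \<open>T\<close>.\<close>
  finally obtain x where x [simp]: "x \<in> Sig" "Tgt T x = Src T q" and ex: "(be \<cdot> q) \<cdot> x = (u' \<cdot> (al0 \<cdot> p)) \<cdot> x"
    using V_eq_iff[of "be \<cdot> q" "u' \<cdot> (al0 \<cdot> p)"] by (simp (no_asm_use) del: assoc V_simps(6)) blast
  define si where "si = s \<cdot> (p \<cdot> x)"
  define al where "al = al0 \<cdot> (p \<cdot> x)"
  define u0 where "u0 = q \<cdot> x"
  have ty [simp]: "si \<in> Sig" "al \<in> Arr T" "u0 \<in> Arr T" "Src T si = Src T u0" "Src T al = Src T u0" "Tgt T si = Src T u"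
    "Tgt T al = Src T u'" "Tgt T u0 = Src T r"
    by (simp_all add: si_def al_def u0_def)
  have e1: "r \<cdot> u0 = u \<cdot> si" using arg_cong[OF epq, of "\<lambda>z. z \<cdot> x"] by (simp add: si_def u0_def)
  have e2: "be \<cdot> u0 = u' \<cdot> al" using ex by (simp add: al_def u0_def)
  have e3: "a \<cdot>\<^bsub>U\<^esub> V si = V al" by (simp add: si_def al_def es[THEN U.assoc_eq])
  obtain y z where t0: "(u0, y, z) \<in> Tri T" using TR1_cone[of u0] by auto
  have [simp]: "y \<in> Arr T" "z \<in> Arr T" "Src T y = Src T r" "Tgt T y = Src T z" "Tgt T z = ShO T (Src T u0)"
    using Tri_simps[OF t0] by simp_all
  obtain ga where ga [simp]: "ga \<in> Arr T" "Src T ga = Src T z" "Tgt T ga = Src T w"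
    and eg: "ga \<cdot> y = v \<cdot> r" "ShA T si \<cdot> z = w \<cdot> ga"
    using TR3_fill[OF t0 t(1), of si r] by (simp (no_asm_use) add: e1) blast
  obtain de where de [simp]: "de \<in> Arr T" "Src T de = Src T z" "Tgt T de = Src T w'"
    and ed: "de \<cdot> y = v' \<cdot> be" "ShA T al \<cdot> z = w' \<cdot> de"
    using TR3_fill[OF t0 t(2), of al be] by (simp (no_asm_use) add: e2) blast
  \<comment> \<open>The first two components \<open>si\<close> and \<open>r\<close> are
    denominators, so the five lemma for exact triangles in \<open>U\<close> makes the image of
    \<open>ga\<close> invertible.\<close>
  have "triangle_morphism T (u0, y, z) (u, v, w) (si, r, ga)"
    by (simp add: eg e1)
  from V_triangle_morphism[OF this t0 t(1)]
  have ig [simp]: "is_iso U (V ga)"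
    by (rule U.five_lemma[OF V_exact[OF t0] V_exact[OF t(1)]]) (simp_all add: V_Sig_iso)
  note [simp] = V_Sig_iso
  define c where "c = V de \<cdot>\<^bsub>U\<^esub> inv_arr U (V ga)"
  have c [simp]: "c \<in> Arr U" "Src U c = Src T w" "Tgt U c = Src T w'" by (simp_all add: c_def)
  have cg: "c \<cdot>\<^bsub>U\<^esub> V ga = V de" by (simp add: c_def)
  have "c \<cdot>\<^bsub>U\<^esub> V v = V v' \<cdot>\<^bsub>U\<^esub> b"
  proof (rule U.iso_cancel_right[of "V r"])
    have "(c \<cdot>\<^bsub>U\<^esub> V v) \<cdot>\<^bsub>U\<^esub> V r = c \<cdot>\<^bsub>U\<^esub> V (v \<cdot> r)" by simp
    also have "\<dots> = V (de \<cdot> y)" unfolding eg(1)[symmetric] by (simp add: cg[THEN U.assoc_eq])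
    also have "\<dots> = (V v' \<cdot>\<^bsub>U\<^esub> b) \<cdot>\<^bsub>U\<^esub> V r" unfolding ed(1) by (simp add: er)
    finally show "(c \<cdot>\<^bsub>U\<^esub> V v) \<cdot>\<^bsub>U\<^esub> V r = (V v' \<cdot>\<^bsub>U\<^esub> b) \<cdot>\<^bsub>U\<^esub> V r" .
  qed simp_all
  moreover have "ShA U a \<cdot>\<^bsub>U\<^esub> V w = V w' \<cdot>\<^bsub>U\<^esub> c"
  proof (rule U.iso_cancel_right[OF ig])
    have "(ShA U a \<cdot>\<^bsub>U\<^esub> V w) \<cdot>\<^bsub>U\<^esub> V ga = ShA U a \<cdot>\<^bsub>U\<^esub> V (w \<cdot> ga)" by simp
    also have "\<dots> = ShA U (a \<cdot>\<^bsub>U\<^esub> V si) \<cdot>\<^bsub>U\<^esub> V z" unfolding eg(2)[symmetric] by (simp add: V_ShA)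
    also have "\<dots> = V (ShA T al \<cdot> z)" unfolding e3 by (simp add: V_ShA)
    also have "\<dots> = (V w' \<cdot>\<^bsub>U\<^esub> c) \<cdot>\<^bsub>U\<^esub> V ga" unfolding ed(2) by (simp add: cg)
    finally show "(ShA U a \<cdot>\<^bsub>U\<^esub> V w) \<cdot>\<^bsub>U\<^esub> V ga = (V w' \<cdot>\<^bsub>U\<^esub> c) \<cdot>\<^bsub>U\<^esub> V ga" .
  qed simp_all
  ultimately show ?thesis using e by (intro exI[of _ c]) simp
qed

text \<open>The given isomorphisms with images of triangles of \<open>T\<close> carry
  \<open>a\<close> and \<open>b\<close> to a square between those images, where \<open>V_TR3\<close>
  applies; the filler is carried back.\<close>

lemma U_TR3:
  assumes t: "(u, v, w) \<in> Tri U" "(u', v', w') \<in> Tri U"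
    and a: "a \<in> Hom U (Src U u) (Src U u')" and b: "b \<in> Hom U (Tgt U u) (Tgt U u')"
    and e: "b \<cdot>\<^bsub>U\<^esub> u = u' \<cdot>\<^bsub>U\<^esub> a"
  shows "\<exists>c. triangle_morphism U (u, v, w) (u', v', w') (a, b, c)"
proof -
  obtain u0 v0 w0 where t0: "(u0, v0, w0) \<in> Tri T" and i0: "isomorphic_triangles U (V u0, V v0, V w0) (u, v, w)"
    using t(1) unfolding U_Tri by blast
  obtain u1 v1 w1 where t1: "(u1, v1, w1) \<in> Tri T" and i1: "isomorphic_triangles U (V u1, V v1, V w1) (u', v', w')"
    using t(2) unfolding U_Tri by blast
  obtain x y z where xyz [simp]: "is_iso U x" "is_iso U y" "is_iso U z"
    and m0: "triangle_morphism U (V u0, V v0, V w0) (u, v, w) (x, y, z)" and c0: "candidate_triangle U (u, v, w)"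
    using i0 unfolding isomorphic_triangles_def by blast
  obtain x' y' z' where xyz' [simp]: "is_iso U x'" "is_iso U y'" "is_iso U z'"
    and m1: "triangle_morphism U (V u1, V v1, V w1) (u', v', w') (x', y', z')" and c1: "candidate_triangle U (u', v', w')"
    using i1 unfolding isomorphic_triangles_def by blast
  note [simp] = Tri_simps[OF t0] Tri_simps[OF t1] xyz[THEN is_iso_Arr] xyz'[THEN is_iso_Arr]
  have [simp]: "u \<in> Arr U" "v \<in> Arr U" "w \<in> Arr U" "Tgt U u = Src U v" "Tgt U v = Src U w" "Tgt U w = ShO T (Src U u)"
    "u' \<in> Arr U" "v' \<in> Arr U" "w' \<in> Arr U" "Tgt U u' = Src U v'" "Tgt U v' = Src U w'" "Tgt U w' = ShO T (Src U u')"
    using c0 c1 by simp_all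
  have [simp]: "Src U x = Src T u0" "Tgt U x = Src U u" "Src U y = Src T v0" "Tgt U y = Src U v" "Src U z = Src T w0" "Tgt U z = Src U w"
    "Src U x' = Src T u1" "Tgt U x' = Src U u'" "Src U y' = Src T v1" "Tgt U y' = Src U v'" "Src U z' = Src T w1" "Tgt U z' = Src U w'"
    "a \<in> Arr U" "Src U a = Src U u" "Tgt U a = Src U u'" "b \<in> Arr U" "Src U b = Src U v" "Tgt U b = Src U v'"
    using m0 m1 a b by simp_all
  have e0: "y \<cdot>\<^bsub>U\<^esub> V u0 = u \<cdot>\<^bsub>U\<^esub> x" "z \<cdot>\<^bsub>U\<^esub> V v0 = v \<cdot>\<^bsub>U\<^esub> y" "ShA U x \<cdot>\<^bsub>U\<^esub> V w0 = w \<cdot>\<^bsub>U\<^esub> z"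
    using m0 unfolding triangle_morphism.simps by blast+
  have e1: "y' \<cdot>\<^bsub>U\<^esub> V u1 = u' \<cdot>\<^bsub>U\<^esub> x'" "z' \<cdot>\<^bsub>U\<^esub> V v1 = v' \<cdot>\<^bsub>U\<^esub> y'" "ShA U x' \<cdot>\<^bsub>U\<^esub> V w1 = w' \<cdot>\<^bsub>U\<^esub> z'"
    using m1 unfolding triangle_morphism.simps by blast+
  define a0 where "a0 = inv_arr U x' \<cdot>\<^bsub>U\<^esub> (a \<cdot>\<^bsub>U\<^esub> x)"
  define b0 where "b0 = inv_arr U y' \<cdot>\<^bsub>U\<^esub> (b \<cdot>\<^bsub>U\<^esub> y)"
  have ab [simp]: "a0 \<in> Arr U" "Src U a0 = Src T u0" "Tgt U a0 = Src T u1" "b0 \<in> Arr U" "Src U b0 = Src T v0" "Tgt U b0 = Src T v1"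
    by (simp_all add: a0_def b0_def)
  have xa: "x' \<cdot>\<^bsub>U\<^esub> a0 = a \<cdot>\<^bsub>U\<^esub> x" and yb: "y' \<cdot>\<^bsub>U\<^esub> b0 = b \<cdot>\<^bsub>U\<^esub> y" by (simp_all add: a0_def b0_def)
  have sxa: "ShA U x' \<cdot>\<^bsub>U\<^esub> ShA U a0 = ShA U a \<cdot>\<^bsub>U\<^esub> ShA U x" using arg_cong[OF xa, of "ShA U"] by simp
  have "b0 \<cdot>\<^bsub>U\<^esub> V u0 = V u1 \<cdot>\<^bsub>U\<^esub> a0"
    by (rule U.iso_cancel_left[of y'])
      (simp_all add: yb[THEN U.assoc_eq] e0 e1[THEN U.assoc_eq] xa e[THEN U.assoc_eq])
  then obtain c0 where c0: "triangle_morphism U (V u0, V v0, V w0) (V u1, V v1, V w1) (a0, b0, c0)"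
    using V_TR3[OF t0 t1, of a0 b0] by (simp (no_asm_use) del: triangle_morphism.simps) blast
  have [simp]: "c0 \<in> Arr U" "Src U c0 = Src T w0" "Tgt U c0 = Src T w1"
    using c0 by simp_all
  have ec: "c0 \<cdot>\<^bsub>U\<^esub> V v0 = V v1 \<cdot>\<^bsub>U\<^esub> b0" "ShA U a0 \<cdot>\<^bsub>U\<^esub> V w0 = V w1 \<cdot>\<^bsub>U\<^esub> c0"
    using c0 unfolding triangle_morphism.simps by blast+
  define c where "c = z' \<cdot>\<^bsub>U\<^esub> (c0 \<cdot>\<^bsub>U\<^esub> inv_arr U z)"
  have [simp]: "c \<in> Arr U" "Src U c = Src U w" "Tgt U c = Src U w'" by (simp_all add: c_def)
  have cz: "c \<cdot>\<^bsub>U\<^esub> z = z' \<cdot>\<^bsub>U\<^esub> c0" by (simp add: c_def)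
  have "c \<cdot>\<^bsub>U\<^esub> v = v' \<cdot>\<^bsub>U\<^esub> b"
  proof (rule U.iso_cancel_right[of y])
    have "(c \<cdot>\<^bsub>U\<^esub> v) \<cdot>\<^bsub>U\<^esub> y = c \<cdot>\<^bsub>U\<^esub> (z \<cdot>\<^bsub>U\<^esub> V v0)" by (simp add: e0)
    also have "\<dots> = v' \<cdot>\<^bsub>U\<^esub> (y' \<cdot>\<^bsub>U\<^esub> b0)" by (simp add: cz[THEN U.assoc_eq] ec e1[THEN U.assoc_eq])
    finally show "(c \<cdot>\<^bsub>U\<^esub> v) \<cdot>\<^bsub>U\<^esub> y = (v' \<cdot>\<^bsub>U\<^esub> b) \<cdot>\<^bsub>U\<^esub> y" by (simp add: yb)
  qed simp_all
  moreover have "ShA U a \<cdot>\<^bsub>U\<^esub> w = w' \<cdot>\<^bsub>U\<^esub> c"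
  proof (rule U.iso_cancel_right[of z])
    have "(ShA U a \<cdot>\<^bsub>U\<^esub> w) \<cdot>\<^bsub>U\<^esub> z = (ShA U a \<cdot>\<^bsub>U\<^esub> ShA U x) \<cdot>\<^bsub>U\<^esub> V w0" by (simp add: e0)
    also have "\<dots> = ShA U x' \<cdot>\<^bsub>U\<^esub> (V w1 \<cdot>\<^bsub>U\<^esub> c0)" unfolding sxa[symmetric] by (simp add: ec)
    finally show "(ShA U a \<cdot>\<^bsub>U\<^esub> w) \<cdot>\<^bsub>U\<^esub> z = (w' \<cdot>\<^bsub>U\<^esub> c) \<cdot>\<^bsub>U\<^esub> z" by (simp add: cz e1[THEN U.assoc_eq])
  qed simp_all
  ultimately show ?thesis using e by (intro exI[of _ c]) simp
qed

text \<open>A composable pair of \<open>U\<close> is isomorphic to the image of a composable pair of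
  \<open>T\<close>, whose octahedron is mapped by \<open>V\<close> and then transferred.\<close>

lemma U_TR4:
  assumes u: "u \<in> Arr U" "v \<in> Arr U" "Tgt U u = Src U v"
    and t: "(u, p, d) \<in> Tri U" "(v, q, e) \<in> Tri U" "(v \<cdot>\<^bsub>U\<^esub> u, r, k) \<in> Tri U"
  shows "\<exists>a b. (a, b, ShA U p \<cdot>\<^bsub>U\<^esub> e) \<in> Tri U \<and>
            triangle_morphism U (u, p, d) (v \<cdot>\<^bsub>U\<^esub> u, r, k) (Ident U (Src U u), v, a) \<and>
            triangle_morphism U (v \<cdot>\<^bsub>U\<^esub> u, r, k) (v, q, e) (u, Ident U (Tgt U v), b)"
proof -
  note [simp] = u V_Sig_iso
  obtain s f where s [simp]: "s \<in> Sig" "f \<in> Arr T" "Src T f = Src T s" "Tgt T s = Src U v" "Tgt T f = Tgt U v"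
    and es: "v \<cdot>\<^bsub>U\<^esub> V s = V f" using U_fraction[of v] by (simp (no_asm_use)) blast
  \<comment> \<open>Writing \<open>u\<close> and \<open>v\<close> as fractions separately would give
    numerators that do not compose. Dividing \<open>u\<close> by the denominator \<open>s\<close> of
    \<open>v\<close> first makes the numerator \<open>g\<close> end where \<open>f\<close>
    starts.\<close>
  define u1 where "u1 = inv_arr U (V s) \<cdot>\<^bsub>U\<^esub> u"
  have [simp]: "u1 \<in> Arr U" "Src U u1 = Src U u" "Tgt U u1 = Src T s" by (simp_all add: u1_def)
  obtain x g where x [simp]: "x \<in> Sig" "g \<in> Arr T" "Src T g = Src T x" "Tgt T x = Src U u" "Tgt T g = Src T s"
    and ex: "u1 \<cdot>\<^bsub>U\<^esub> V x = V g" using U_fraction[of u1] by (simp (no_asm_use)) blast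
  have [simp]: "Tgt U v \<in> Ob T" using U.Tgt_in_Ob[OF u(2)] by simp
  obtain p' d' where t1: "(g, p', d') \<in> Tri T" using TR1_cone[of g] by auto
  obtain q' e' where t2: "(f, q', e') \<in> Tri T" using TR1_cone[of f] by auto
  obtain r' k' where t3: "(f \<cdot> g, r', k') \<in> Tri T" using TR1_cone[of "f \<cdot> g"] by auto
  obtain a' b' where o: "(a', b', ShA T p' \<cdot> e') \<in> Tri T"
    "triangle_morphism T (g, p', d') (f \<cdot> g, r', k') (Ident T (Src T x), f, a')"
    "triangle_morphism T (f \<cdot> g, r', k') (f, q', e') (g, Ident T (Tgt U v), b')"
    using TR4[OF _ _ t1 t2 t3, of "Src T x" "Src T s" "Tgt U v"] by (simp (no_asm_use) del: triangle_morphism.simps) blast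
  have ty [simp]: "p' \<in> Arr T" "e' \<in> Arr T" "Tgt T p' = Src T d'" "Src T p' = Src T s" "Tgt T e' = ShO T (Src T s)"
    using Tri_simps[OF t1] Tri_simps[OF t2] by simp_all
  show ?thesis
  proof (rule U.octahedron_iso_invariant[where u = u and v = v and u' = "V g" and v' = "V f"
        and x = "inv_arr U (V x)" and y = "inv_arr U (V s)" and z = "Ident U (Tgt U v)"])
    show "exact_triangle U t" if "t \<in> Tri U" for t using U_Tri_exact[OF that] .
    show "t' \<in> Tri U" if "t \<in> Tri U" "isomorphic_triangles U t t'" for t t' using U_TR1_iso[OF that] .
    show "\<exists>c. triangle_morphism U (u, v, w) (u', v', w') (a, b, c)"
      if "(u, v, w) \<in> Tri U" "(u', v', w') \<in> Tri U" "a \<in> Hom U (Src U u) (Src U u')" "b \<in> Hom U (Tgt U u) (Tgt U u')"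
        "b \<cdot>\<^bsub>U\<^esub> u = u' \<cdot>\<^bsub>U\<^esub> a" for u v w u' v' w' a b
      using U_TR3[OF that] .
    show "(V g, V p', V d') \<in> Tri U" "(V f, V q', V e') \<in> Tri U" by (rule V_Tri, fact)+
    show "(V f \<cdot>\<^bsub>U\<^esub> V g, V r', V k') \<in> Tri U" using V_Tri[OF t3] by simp
    show "(V a', V b', ShA U (V p') \<cdot>\<^bsub>U\<^esub> V e') \<in> Tri U" using V_Tri[OF o(1)] by (simp add: V_ShA)
    show "triangle_morphism U (V g, V p', V d') (V f \<cdot>\<^bsub>U\<^esub> V g, V r', V k') (Ident U (Src U (V g)), V f, V a')"
      using V_triangle_morphism[OF o(2) t1 t3] by (simp del: triangle_morphism.simps)
    show "triangle_morphism U (V f \<cdot>\<^bsub>U\<^esub> V g, V r', V k') (V f, V q', V e') (V g, Ident U (Tgt U (V f)), V b')"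
      using V_triangle_morphism[OF o(3) t3 t2] by (simp del: triangle_morphism.simps)
    show "inv_arr U (V s) \<cdot>\<^bsub>U\<^esub> u = V g \<cdot>\<^bsub>U\<^esub> inv_arr U (V x)"
      unfolding ex[symmetric] u1_def[symmetric] by simp
    show "Ident U (Tgt U v) \<cdot>\<^bsub>U\<^esub> v = V f \<cdot>\<^bsub>U\<^esub> inv_arr U (V s)"
      unfolding es[symmetric] by simp
  qed (use t in simp_all)
qed

theorem U_triangulated: "triangulated_category U"
proof (intro triangulated_category.intro triangulated_category_axioms.intro)
  show "additive_category U" by (rule U.additive_category_axioms)
  show "additive_equivalence U U (shift_functor U)" by (rule ShU_equivalence)
  show "candidate_triangle U t" if "t \<in> Tri U" for t
    using that unfolding U_Tri isomorphic_triangles_def by blast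
  show "t' \<in> Tri U" if "t \<in> Tri U" "isomorphic_triangles U t t'" for t t' using U_TR1_iso that by blast
  show "(Ident U A, Zero U A Z, Zero U Z (ShO U A)) \<in> Tri U" if "A \<in> Ob U" "zero_object U Z" for A Z
    using U_TR1_ident[of A Z] that by simp
  show "\<exists>v w. (u, v, w) \<in> Tri U" if "u \<in> Arr U" for u using U_TR1_cone[OF that] .
  show "(u, v, w) \<in> Tri U \<longleftrightarrow> (v, w, Neg U (ShA U u)) \<in> Tri U" if "candidate_triangle U (u, v, w)" for u v w
    using U_rotate[of u v w] U_unrotate[OF that] by blast
  show "\<exists>c. triangle_morphism U (u, v, w) (u', v', w') (a, b, c)"
    if "(u, v, w) \<in> Tri U" "(u', v', w') \<in> Tri U" "a \<in> Hom U (Src U u) (Src U u')" "b \<in> Hom U (Tgt U u) (Tgt U u')"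
      "b \<cdot>\<^bsub>U\<^esub> u = u' \<cdot>\<^bsub>U\<^esub> a" for u v w u' v' w' a b
    using U_TR3[OF that] .
  show "\<exists>a b. (a, b, ShA U p \<cdot>\<^bsub>U\<^esub> e) \<in> Tri U \<and>
            triangle_morphism U (u, p, d) (v \<cdot>\<^bsub>U\<^esub> u, r, k) (Ident U X, v, a) \<and>
            triangle_morphism U (v \<cdot>\<^bsub>U\<^esub> u, r, k) (v, q, e) (u, Ident U Z, b)"
    if "u \<in> Hom U X Y" "v \<in> Hom U Y Z" "(u, p, d) \<in> Tri U" "(v, q, e) \<in> Tri U" "(v \<cdot>\<^bsub>U\<^esub> u, r, k) \<in> Tri U"
    for u X Y v Z p d q e r k
  proof -
    have "u \<in> Arr U" "v \<in> Arr U" "Tgt U u = Src U v" "X = Src U u" "Z = Tgt U v" using that(1,2) by auto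
    then show ?thesis using U_TR4[OF _ _ _ that(3-5)] by simp
  qed
qed

end

lemma verdier_quotient_locale:
  assumes "triangulated_category T" "triangulated_subcategory T S"
  shows "verdier_tri T S (verdier_quotient T S) (Tri (verdier_quotient T S))"
proof -
  interpret triangulated_category T by fact
  let ?P = "verdier_precat T S"
  let ?U = "verdier_quotient T S"
  let ?D = "{t. \<exists>(u, v, w) \<in> Tri T. isomorphic_triangles ?P
        (AMap (verdier_functor T S) u, AMap (verdier_functor T S) v, AMap (verdier_functor T S) w) t}"
  have U: "?U = ?P\<lparr>Tri := ?D\<rparr>" by (simp add: verdier_quotient_def)
  have D: "Tri ?U = ?D" by (simp add: verdier_quotient_def)
  have sel: "Ob ?U = Ob ?P" "Arr ?U = Arr ?P" "Src ?U = Src ?P" "Tgt ?U = Tgt ?P" "Ident ?U = Ident ?P" "Comp ?U = Comp ?P"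
    "ShO ?U = ShO ?P" "ShA ?U = ShA ?P" unfolding U by simp_all
  \<comment> \<open>The definition of the quotient measures isomorphism in the category with empty
    \<open>Tri\<close>; since the two records differ only in that field, the notion is the
    same.\<close>
  have iso: "isomorphic_triangles ?U t t' = isomorphic_triangles ?P t t'" for t t'
  proof -
    obtain u v w u' v' w' where "t = (u, v, w)" "t' = (u', v', w')" by (cases t; cases t')
    then show ?thesis unfolding isomorphic_triangles_def is_iso_def by (simp add: sel)
  qed
  show ?thesis
  proof
    show "triangulated_subcategory T S" by fact
    show "?U = ?P\<lparr>Tri := Tri ?U\<rparr>" unfolding D by (rule U)
    show "Tri ?U = {t. \<exists>(u, v, w) \<in> Tri T. isomorphic_triangles ?U
        (AMap (verdier_functor T S) u, AMap (verdier_functor T S) v, AMap (verdier_functor T S) w) t}"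
      unfolding iso by (rule D)
  qed
qed

section \<open>Transport of a triangulated structure\<close>

text \<open>The shift of \<open>R\<close> is compatible with \<open>F\<close> only up to the natural
  isomorphism \<open>theta\<close>. Therefore the image of a triangle of \<open>R\<close> has its
  third arrow followed by \<open>theta\<close>, and the triangles of \<open>R\<close> are those
  whose image so corrected is distinguished.\<close>

locale transported = R: additive_category R + U: triangulated_category U + F: add_functor R U F
  for R :: "('p, 'n, 'y) tri_cat_scheme" and U :: "('o, 'm, 'x) tri_cat_scheme" and F +
  fixes theta :: "'p \<Rightarrow> 'm"
  assumes F_fully_faithful: "fully_faithful R U F" and F_ess_surj: "ess_surj R U F"
    and ShR_Ob [simp]: "A \<in> Ob R \<Longrightarrow> ShO R A \<in> Ob R"
    and ShR_Arr [simp]: "f \<in> Arr R \<Longrightarrow> ShA R f \<in> Arr R"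
    and ShR_Src [simp]: "f \<in> Arr R \<Longrightarrow> Src R (ShA R f) = ShO R (Src R f)"
    and ShR_Tgt [simp]: "f \<in> Arr R \<Longrightarrow> Tgt R (ShA R f) = ShO R (Tgt R f)"
    and theta_iso [simp]: "A \<in> Ob R \<Longrightarrow> is_iso U (theta A)"
    and theta_Src [simp]: "A \<in> Ob R \<Longrightarrow> Src U (theta A) = OMap F (ShO R A)"
    and theta_Tgt [simp]: "A \<in> Ob R \<Longrightarrow> Tgt U (theta A) = ShO U (OMap F A)"
    and theta_natural: "f \<in> Arr R \<Longrightarrow> theta (Tgt R f) \<cdot>\<^bsub>U\<^esub> AMap F (ShA R f) = ShA U (AMap F f) \<cdot>\<^bsub>U\<^esub> theta (Src R f)"
    and Tri_R: "(u, v, w) \<in> Tri R \<longleftrightarrow> candidate_triangle R (u, v, w) \<and>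
      (AMap F u, AMap F v, theta (Src R u) \<cdot>\<^bsub>U\<^esub> AMap F w) \<in> Tri U"
begin

abbreviation F' where "F' \<equiv> AMap F"

lemma theta_Arr [simp]: "A \<in> Ob R \<Longrightarrow> theta A \<in> Arr U"
  by (rule is_iso_Arr[OF theta_iso])

lemmas F_eqI = F.fully_faithful_inj[OF F_fully_faithful]

lemma F_full:
  assumes "h \<in> Arr U" "Src U h = OMap F A" "Tgt U h = OMap F B" "A \<in> Ob R" "B \<in> Ob R"
  shows "\<exists>f. f \<in> Arr R \<and> Src R f = A \<and> Tgt R f = B \<and> F' f = h"
proof -
  obtain f where "f \<in> Arr R" "Src R f = A" "Tgt R f = B" "F' f = h"
    using F.fully_faithful_surj[OF F_fully_faithful assms(4,5,1)] assms(2,3) by auto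
  then show ?thesis by blast
qed

lemma F_onto:
  assumes "B \<in> Ob U"
  shows "\<exists>A i. A \<in> Ob R \<and> is_iso U i \<and> Src U i = OMap F A \<and> Tgt U i = B"
proof -
  obtain A where A: "A \<in> Ob R" "isomorphic U (OMap F A) B" using F_ess_surj assms by (auto simp: ess_surj_def)
  then obtain i where "i \<in> Hom U (OMap F A) B" "is_iso U i" unfolding isomorphic_def by blast
  with A show ?thesis unfolding Hom_def by blast
qed

lemma shift_sel_R: "OMap (shift_functor R) = ShO R" "AMap (shift_functor R) = ShA R"
  by (simp_all add: shift_functor_def)

text \<open>Naturality of \<open>theta\<close> determines \<open>F' (ShA R f)\<close> from
  \<open>F' f\<close>. Functoriality and additivity of the shift of \<open>R\<close> follow by
  cancelling \<open>theta\<close> and using that \<open>F\<close> is faithful.\<close>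

sublocale ShR: add_functor R R "shift_functor R"
proof
  show "is_functor R R (shift_functor R)"
    unfolding is_functor_def shift_sel_R
  proof (intro conjI ballI impI)
    fix A assume [simp]: "A \<in> Ob R"
    have "F' (ShA R (Ident R A)) = F' (Ident R (ShO R A))"
      by (rule U.iso_cancel_left[of "theta A"]) (use theta_natural[of "Ident R A"] in simp_all)
    then show "ShA R (Ident R A) = Ident R (ShO R A)" by (intro F_eqI) simp_all
  next
    fix f g assume [simp]: "f \<in> Arr R" "g \<in> Arr R" and e: "Tgt R f = Src R g"
    have [simp]: "Src R g = Tgt R f" using e by simp
    have "F' (ShA R (g \<cdot>\<^bsub>R\<^esub> f)) = F' (ShA R g \<cdot>\<^bsub>R\<^esub> ShA R f)"
    proof (rule U.iso_cancel_left[of "theta (Tgt R g)"])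
      have "theta (Tgt R g) \<cdot>\<^bsub>U\<^esub> F' (ShA R g \<cdot>\<^bsub>R\<^esub> ShA R f) = ShA U (F' g) \<cdot>\<^bsub>U\<^esub> (ShA U (F' f) \<cdot>\<^bsub>U\<^esub> theta (Src R f))"
        using theta_natural[of g] theta_natural[of f] by (simp add: theta_natural[of g, THEN U.assoc_eq])
      then show "theta (Tgt R g) \<cdot>\<^bsub>U\<^esub> F' (ShA R (g \<cdot>\<^bsub>R\<^esub> f)) = theta (Tgt R g) \<cdot>\<^bsub>U\<^esub> F' (ShA R g \<cdot>\<^bsub>R\<^esub> ShA R f)"
        using theta_natural[of "g \<cdot>\<^bsub>R\<^esub> f"] by simp
    qed simp_all
    then show "ShA R (g \<cdot>\<^bsub>R\<^esub> f) = ShA R g \<cdot>\<^bsub>R\<^esub> ShA R f" by (intro F_eqI) simp_all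
  qed (simp_all add: R.category_axioms)
next
  fix f g assume [simp]: "f \<in> Arr R" "g \<in> Arr R" "Src R f = Src R g" "Tgt R f = Tgt R g"
  have "F' (ShA R (f \<boxplus>\<^bsub>R\<^esub> g)) = F' (ShA R f \<boxplus>\<^bsub>R\<^esub> ShA R g)"
    by (rule U.iso_cancel_left[of "theta (Tgt R g)"])
      (use theta_natural[of f] theta_natural[of g] theta_natural[of "f \<boxplus>\<^bsub>R\<^esub> g"] in simp_all)
  then show "AMap (shift_functor R) (f \<boxplus>\<^bsub>R\<^esub> g) = AMap (shift_functor R) f \<boxplus>\<^bsub>R\<^esub> AMap (shift_functor R) g"
    unfolding shift_sel_R by (intro F_eqI) simp_all
qed

lemma ShR_equivalence: "additive_equivalence R R (shift_functor R)"
proof -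
  have "fully_faithful R R (shift_functor R)"
    unfolding fully_faithful_def shift_sel_R
  proof (intro conjI ballI impI)
    fix f g assume f: "f \<in> Arr R" "g \<in> Arr R" and fg: "Src R f = Src R g \<and> Tgt R f = Tgt R g \<and> ShA R f = ShA R g"
    have "ShA U (F' f) \<cdot>\<^bsub>U\<^esub> theta (Src R g) = ShA U (F' g) \<cdot>\<^bsub>U\<^esub> theta (Src R g)"
      using theta_natural[of f] theta_natural[of g] f fg by simp
    from U.iso_cancel_right[OF _ _ _ _ _ this] have "ShA U (F' f) = ShA U (F' g)" using f fg by simp
    from U.Sh_faithful[OF this] have "F' f = F' g" using f fg by simp
    then show "f = g" using f fg by (intro F_eqI) simp_all
  next
    fix A B h assume [simp]: "A \<in> Ob R" "B \<in> Ob R" and h: "h \<in> Hom R (ShO R A) (ShO R B)"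
    then have [simp]: "h \<in> Arr R" "Src R h = ShO R A" "Tgt R h = ShO R B" by simp_all
    obtain k where k [simp]: "k \<in> Arr U" "Src U k = OMap F A" "Tgt U k = OMap F B"
      and ek: "ShA U k = theta B \<cdot>\<^bsub>U\<^esub> (F' h \<cdot>\<^bsub>U\<^esub> inv_arr U (theta A))"
      using U.Sh_full[of "theta B \<cdot>\<^bsub>U\<^esub> (F' h \<cdot>\<^bsub>U\<^esub> inv_arr U (theta A))" "OMap F A" "OMap F B"] by (simp (no_asm_use)) blast
    obtain f where f [simp]: "f \<in> Arr R" "Src R f = A" "Tgt R f = B" and ef: "F' f = k"
      using F_full[of k A B] by (simp (no_asm_use)) blast
    have "F' (ShA R f) = F' h"
      by (rule U.iso_cancel_left[of "theta B"]) (use theta_natural[of f] in \<open>simp_all add: ef ek\<close>)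
    then have "ShA R f = h" by (intro F_eqI) simp_all
    then show "\<exists>f\<in>Hom R A B. ShA R f = h" by (intro bexI[of _ f]) simp_all
  qed
  moreover have "ess_surj R R (shift_functor R)"
    unfolding ess_surj_def shift_sel_R
  proof
    fix B assume [simp]: "B \<in> Ob R"
    obtain C i where i [simp]: "C \<in> Ob U" "is_iso U i" "Src U i = ShO U C" "Tgt U i = OMap F B"
      using U.Sh_onto[of "OMap F B"] by (simp (no_asm_use)) blast
    obtain A j where j [simp]: "A \<in> Ob R" "is_iso U j" "Src U j = OMap F A" "Tgt U j = C"
      using F_onto[of C] by (simp (no_asm_use)) blast
    note [simp] = is_iso_Arr[OF i(2)] is_iso_Arr[OF j(2)] U.Sh_iso(1)[OF j(2)]
    obtain f where f [simp]: "f \<in> Arr R" "Src R f = ShO R A" "Tgt R f = B"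
      and ef: "F' f = i \<cdot>\<^bsub>U\<^esub> (ShA U j \<cdot>\<^bsub>U\<^esub> theta A)"
      using F_full[of "i \<cdot>\<^bsub>U\<^esub> (ShA U j \<cdot>\<^bsub>U\<^esub> theta A)" "ShO R A" B] by (simp (no_asm_use)) blast
    have "is_iso R f" by (rule F.fully_faithful_reflects_iso[OF F_fully_faithful]) (simp_all add: ef)
    then show "\<exists>A\<in>Ob R. isomorphic R (ShO R A) B" unfolding isomorphic_def
      by (intro bexI[of _ A] bexI[of _ f]) simp_all
  qed
  ultimately have "equivalence_functor R R (shift_functor R)" by (rule ShR.equivalence_functorI)
  then show ?thesis unfolding additive_equivalence_def additive_functor_def
    using ShR.is_functor R.additive_category_axioms ShR.F_Add by blast
qed

sublocale R: shift_category R
  by unfold_locales (rule ShR_equivalence)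

abbreviation FT where "FT u v w \<equiv> (F' u, F' v, theta (Src R u) \<cdot>\<^bsub>U\<^esub> F' w)"

lemma FT_candidate:
  assumes "candidate_triangle R (u, v, w)"
  shows "candidate_triangle U (FT u v w)"
  using assms by simp

text \<open>Each square in \<open>R\<close> commutes exactly if its image does, by faithfulness; in
  the third square naturality of \<open>theta\<close> moves it to the left, where it
  cancels.\<close>

lemma FT_morphism:
  assumes t: "candidate_triangle R (u, v, w)" "candidate_triangle R (u', v', w')"
    and a: "a \<in> Hom R (Src R u) (Src R u')" "b \<in> Hom R (Src R v) (Src R v')" "c \<in> Hom R (Src R w) (Src R w')"
  shows "triangle_morphism R (u, v, w) (u', v', w') (a, b, c) \<longleftrightarrow>
    triangle_morphism U (FT u v w) (FT u' v' w') (F' a, F' b, F' c)"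
proof -
  have ty [simp]: "u \<in> Arr R" "v \<in> Arr R" "w \<in> Arr R" "Tgt R u = Src R v" "Tgt R v = Src R w" "Tgt R w = ShO R (Src R u)"
    "u' \<in> Arr R" "v' \<in> Arr R" "w' \<in> Arr R" "Tgt R u' = Src R v'" "Tgt R v' = Src R w'" "Tgt R w' = ShO R (Src R u')"
    "a \<in> Arr R" "Src R a = Src R u" "Tgt R a = Src R u'" "b \<in> Arr R" "Src R b = Src R v" "Tgt R b = Src R v'"
    "c \<in> Arr R" "Src R c = Src R w" "Tgt R c = Src R w'"
    using t a by simp_all
  have 1: "b \<cdot>\<^bsub>R\<^esub> u = u' \<cdot>\<^bsub>R\<^esub> a \<longleftrightarrow> F' b \<cdot>\<^bsub>U\<^esub> F' u = F' u' \<cdot>\<^bsub>U\<^esub> F' a"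
    using F_eqI[of "b \<cdot>\<^bsub>R\<^esub> u" "u' \<cdot>\<^bsub>R\<^esub> a"] F.F_simps(6)[of u b] F.F_simps(6)[of a u'] by (simp del: F.F_simps(6)) metis
  have 2: "c \<cdot>\<^bsub>R\<^esub> v = v' \<cdot>\<^bsub>R\<^esub> b \<longleftrightarrow> F' c \<cdot>\<^bsub>U\<^esub> F' v = F' v' \<cdot>\<^bsub>U\<^esub> F' b"
    using F_eqI[of "c \<cdot>\<^bsub>R\<^esub> v" "v' \<cdot>\<^bsub>R\<^esub> b"] F.F_simps(6)[of v c] F.F_simps(6)[of b v'] by (simp del: F.F_simps(6)) metis
  have 3: "ShA R a \<cdot>\<^bsub>R\<^esub> w = w' \<cdot>\<^bsub>R\<^esub> c \<longleftrightarrow>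
    ShA U (F' a) \<cdot>\<^bsub>U\<^esub> (theta (Src R u) \<cdot>\<^bsub>U\<^esub> F' w) = (theta (Src R u') \<cdot>\<^bsub>U\<^esub> F' w') \<cdot>\<^bsub>U\<^esub> F' c" (is "?l \<longleftrightarrow> ?r")
  proof -
    have e: "ShA U (F' a) \<cdot>\<^bsub>U\<^esub> (theta (Src R u) \<cdot>\<^bsub>U\<^esub> F' w) = theta (Src R u') \<cdot>\<^bsub>U\<^esub> F' (ShA R a \<cdot>\<^bsub>R\<^esub> w)"
      using theta_natural[of a] by (simp add: theta_natural[of a, simplified, THEN U.assoc_eq])
    have e': "(theta (Src R u') \<cdot>\<^bsub>U\<^esub> F' w') \<cdot>\<^bsub>U\<^esub> F' c = theta (Src R u') \<cdot>\<^bsub>U\<^esub> F' (w' \<cdot>\<^bsub>R\<^esub> c)" by simp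
    have "?r \<longleftrightarrow> F' (ShA R a \<cdot>\<^bsub>R\<^esub> w) = F' (w' \<cdot>\<^bsub>R\<^esub> c)" unfolding e e'
      using U.iso_cancel_left[of "theta (Src R u')" "F' (ShA R a \<cdot>\<^bsub>R\<^esub> w)" "F' (w' \<cdot>\<^bsub>R\<^esub> c)"] by (simp del: F.F_simps(6)) metis
    also have "\<dots> \<longleftrightarrow> ?l" using F_eqI[of "ShA R a \<cdot>\<^bsub>R\<^esub> w" "w' \<cdot>\<^bsub>R\<^esub> c"] by (simp del: F.F_simps(6)) metis
    finally show ?thesis by blast
  qed
  show ?thesis unfolding triangle_morphism.simps 1 2 3 by simp
qed

lemma FT_isomorphic:
  assumes "isomorphic_triangles R (u, v, w) (u', v', w')"
  shows "isomorphic_triangles U (FT u v w) (FT u' v' w')"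
proof -
  obtain a b c where abc: "is_iso R a" "is_iso R b" "is_iso R c"
    and m: "triangle_morphism R (u, v, w) (u', v', w') (a, b, c)"
    and c: "candidate_triangle R (u, v, w)" "candidate_triangle R (u', v', w')"
    using assms unfolding isomorphic_triangles_def by blast
  have "triangle_morphism U (FT u v w) (FT u' v' w') (F' a, F' b, F' c)"
    using FT_morphism[OF c, of a b c] m unfolding triangle_morphism.simps by blast
  then show ?thesis unfolding isomorphic_triangles_def
    using F.F_inv(1) abc FT_candidate[OF c(1)] FT_candidate[OF c(2)] by blast
qed

section \<open>The triangle axioms of \<open>R\<close>, read off in \<open>U\<close>\<close>

lemma R_TR1_iso:
  assumes "t \<in> Tri R" "isomorphic_triangles R t t'"
  shows "t' \<in> Tri R"
proof -
  obtain u v w u' v' w' where tt: "t = (u, v, w)" "t' = (u', v', w')" by (cases t; cases t')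
  have "FT u v w \<in> Tri U" using assms(1) Tri_R unfolding tt by blast
  then have "FT u' v' w' \<in> Tri U" using U.TR1_iso FT_isomorphic assms(2) unfolding tt by blast
  moreover have "candidate_triangle R (u', v', w')" using assms(2) unfolding tt isomorphic_triangles_def by blast
  ultimately show ?thesis unfolding tt Tri_R by blast
qed

lemma R_TR1_ident:
  assumes [simp]: "A \<in> Ob R" and Z: "zero_object R Z"
  shows "(Ident R A, Zero R A Z, Zero R Z (ShO R A)) \<in> Tri R"
proof -
  have [simp]: "Z \<in> Ob R" using Z by (simp add: zero_object_def)
  have "(Ident U (OMap F A), Zero U (OMap F A) (OMap F Z), Zero U (OMap F Z) (ShO U (OMap F A))) \<in> Tri U"
    by (rule U.TR1_ident[OF _ F.F_zero_object[OF Z]]) simp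
  then show ?thesis unfolding Tri_R by simp
qed

text \<open>The cone in \<open>U\<close> need not be in the image of \<open>F\<close>, so it is
  replaced along an isomorphism \<open>i\<close> from some image \<open>OMap F Z\<close>. The third
  arrow is lifted after dividing by \<open>theta\<close>, which the definition of
  \<open>Tri R\<close> puts back.\<close>

lemma R_TR1_cone:
  assumes u [simp]: "u \<in> Arr R"
  shows "\<exists>v w. (u, v, w) \<in> Tri R"
proof -
  obtain p q where t: "(F' u, p, q) \<in> Tri U" using U.TR1_cone[of "F' u"] by auto
  note U.Tri_simps[OF t]
  then have [simp]: "p \<in> Arr U" "q \<in> Arr U" "Src U p = OMap F (Tgt R u)" "Tgt U p = Src U q"
    "Tgt U q = ShO U (OMap F (Src R u))" by simp_all
  obtain Z i where i [simp]: "Z \<in> Ob R" "is_iso U i" "Src U i = OMap F Z" "Tgt U i = Src U q"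
    using F_onto[of "Src U q"] by (simp (no_asm_use)) blast
  note [simp] = is_iso_Arr[OF i(2)]
  obtain v where v [simp]: "v \<in> Arr R" "Src R v = Tgt R u" "Tgt R v = Z" and ev: "F' v = inv_arr U i \<cdot>\<^bsub>U\<^esub> p"
    using F_full[of "inv_arr U i \<cdot>\<^bsub>U\<^esub> p" "Tgt R u" Z] by (simp (no_asm_use)) blast
  obtain w where w [simp]: "w \<in> Arr R" "Src R w = Z" "Tgt R w = ShO R (Src R u)"
    and ew: "F' w = inv_arr U (theta (Src R u)) \<cdot>\<^bsub>U\<^esub> (q \<cdot>\<^bsub>U\<^esub> i)"
    using F_full[of "inv_arr U (theta (Src R u)) \<cdot>\<^bsub>U\<^esub> (q \<cdot>\<^bsub>U\<^esub> i)" Z "ShO R (Src R u)"] by (simp (no_asm_use)) blast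
  have "isomorphic_triangles U (F' u, p, q) (FT u v w)"
    unfolding isomorphic_triangles_def ev ew
    by (intro conjI exI[of _ "Ident U (OMap F (Src R u))"] exI[of _ "Ident U (OMap F (Tgt R u))"] exI[of _ "inv_arr U i"])
      (simp_all add: ev ew)
  then have "FT u v w \<in> Tri U" using U.TR1_iso[OF t] by blast
  then show ?thesis using Tri_R[of u v w] by (intro exI[of _ v] exI[of _ w]) simp
qed

text \<open>The image of the rotated triangle is not the rotation of the image, but
  \<open>theta\<close> on the third vertex is an isomorphism between them.\<close>

lemma R_TR2:
  assumes c: "candidate_triangle R (u, v, w)"
  shows "(u, v, w) \<in> Tri R \<longleftrightarrow> (v, w, Neg R (ShA R u)) \<in> Tri R"
proof -
  have [simp]: "u \<in> Arr R" "v \<in> Arr R" "w \<in> Arr R" "Tgt R u = Src R v" "Tgt R v = Src R w" "Tgt R w = ShO R (Src R u)"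
    using c by simp_all
  have c': "candidate_triangle R (v, w, Neg R (ShA R u))" by simp
  have n: "theta (Src R v) \<cdot>\<^bsub>U\<^esub> F' (ShA R u) = ShA U (F' u) \<cdot>\<^bsub>U\<^esub> theta (Src R u)"
    using theta_natural[of u] by simp
  have i: "isomorphic_triangles U (FT v w (Neg R (ShA R u))) (F' v, theta (Src R u) \<cdot>\<^bsub>U\<^esub> F' w, Neg U (ShA U (F' u)))"
    unfolding isomorphic_triangles_def
    by (intro conjI exI[of _ "Ident U (OMap F (Src R v))"] exI[of _ "Ident U (OMap F (Src R w))"] exI[of _ "theta (Src R u)"])
      (simp_all add: n)
  have "FT v w (Neg R (ShA R u)) \<in> Tri U \<longleftrightarrow> (F' v, theta (Src R u) \<cdot>\<^bsub>U\<^esub> F' w, Neg U (ShA U (F' u))) \<in> Tri U"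
    using U.TR1_iso i U.isomorphic_triangles_sym[OF i] by blast
  also have "\<dots> \<longleftrightarrow> FT u v w \<in> Tri U" using U.TR2[OF FT_candidate[OF c]] by blast
  finally show ?thesis unfolding Tri_R using c c' by blast
qed

lemma R_TR3:
  assumes t: "(u, v, w) \<in> Tri R" "(u', v', w') \<in> Tri R"
    and a: "a \<in> Hom R (Src R u) (Src R u')" "b \<in> Hom R (Tgt R u) (Tgt R u')" and e: "b \<cdot>\<^bsub>R\<^esub> u = u' \<cdot>\<^bsub>R\<^esub> a"
  shows "\<exists>c. triangle_morphism R (u, v, w) (u', v', w') (a, b, c)"
proof -
  have c: "candidate_triangle R (u, v, w)" "candidate_triangle R (u', v', w')"
    and t': "FT u v w \<in> Tri U" "FT u' v' w' \<in> Tri U"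
    using t unfolding Tri_R by blast+
  have [simp]: "u \<in> Arr R" "v \<in> Arr R" "w \<in> Arr R" "Tgt R u = Src R v" "Tgt R v = Src R w" "Tgt R w = ShO R (Src R u)"
    "u' \<in> Arr R" "v' \<in> Arr R" "w' \<in> Arr R" "Tgt R u' = Src R v'" "Tgt R v' = Src R w'" "Tgt R w' = ShO R (Src R u')"
    using c by simp_all
  have [simp]: "a \<in> Arr R" "Src R a = Src R u" "Tgt R a = Src R u'" "b \<in> Arr R" "Src R b = Src R v" "Tgt R b = Src R v'"
    using a by simp_all
  have e': "F' b \<cdot>\<^bsub>U\<^esub> F' u = F' u' \<cdot>\<^bsub>U\<^esub> F' a" using arg_cong[OF e, of F'] by simp
  obtain c0 where m: "triangle_morphism U (FT u v w) (FT u' v' w') (F' a, F' b, c0)"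
    using U.TR3[OF t' _ _ e'] by (simp (no_asm_use) del: triangle_morphism.simps) blast
  have [simp]: "c0 \<in> Arr U" "Src U c0 = OMap F (Src R w)" "Tgt U c0 = OMap F (Src R w')" using m by simp_all
  obtain c1 where c1 [simp]: "c1 \<in> Arr R" "Src R c1 = Src R w" "Tgt R c1 = Src R w'" and ec: "F' c1 = c0"
    using F_full[of c0 "Src R w" "Src R w'"] by (simp (no_asm_use)) blast
  have "triangle_morphism R (u, v, w) (u', v', w') (a, b, c1)"
    using FT_morphism[OF c, of a b c1] m unfolding ec by (simp del: triangle_morphism.simps)
  then show ?thesis by blast
qed

lemma R_TR4:
  assumes u [simp]: "u \<in> Arr R" "v \<in> Arr R" "Tgt R u = Src R v"
    and t: "(u, p, d) \<in> Tri R" "(v, q, e) \<in> Tri R" "(v \<cdot>\<^bsub>R\<^esub> u, r, k) \<in> Tri R"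
  shows "\<exists>a b. (a, b, ShA R p \<cdot>\<^bsub>R\<^esub> e) \<in> Tri R \<and>
            triangle_morphism R (u, p, d) (v \<cdot>\<^bsub>R\<^esub> u, r, k) (Ident R (Src R u), v, a) \<and>
            triangle_morphism R (v \<cdot>\<^bsub>R\<^esub> u, r, k) (v, q, e) (u, Ident R (Tgt R v), b)"
proof -
  have c: "candidate_triangle R (u, p, d)" "candidate_triangle R (v, q, e)" "candidate_triangle R (v \<cdot>\<^bsub>R\<^esub> u, r, k)"
    and t': "FT u p d \<in> Tri U" "FT v q e \<in> Tri U" "FT (v \<cdot>\<^bsub>R\<^esub> u) r k \<in> Tri U"
    using t unfolding Tri_R by blast+
  have ty [simp]: "p \<in> Arr R" "d \<in> Arr R" "q \<in> Arr R" "e \<in> Arr R" "r \<in> Arr R" "k \<in> Arr R"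
    "Src R p = Src R v" "Tgt R p = Src R d" "Tgt R d = ShO R (Src R u)"
    "Src R q = Tgt R v" "Tgt R q = Src R e" "Tgt R e = ShO R (Src R v)"
    "Src R r = Tgt R v" "Tgt R r = Src R k" "Tgt R k = ShO R (Src R u)"
    using c by simp_all
  have t3: "(F' v \<cdot>\<^bsub>U\<^esub> F' u, F' r, theta (Src R u) \<cdot>\<^bsub>U\<^esub> F' k) \<in> Tri U" using t'(3) by simp
  obtain a0 b0 where o: "(a0, b0, ShA U (F' p) \<cdot>\<^bsub>U\<^esub> (theta (Src R v) \<cdot>\<^bsub>U\<^esub> F' e)) \<in> Tri U"
    "triangle_morphism U (FT u p d) (F' v \<cdot>\<^bsub>U\<^esub> F' u, F' r, theta (Src R u) \<cdot>\<^bsub>U\<^esub> F' k) (Ident U (OMap F (Src R u)), F' v, a0)"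
    "triangle_morphism U (F' v \<cdot>\<^bsub>U\<^esub> F' u, F' r, theta (Src R u) \<cdot>\<^bsub>U\<^esub> F' k) (FT v q e) (F' u, Ident U (OMap F (Tgt R v)), b0)"
    using U.TR4[OF _ _ t'(1,2) t3, of "OMap F (Src R u)" "OMap F (Src R v)" "OMap F (Tgt R v)"]
    by (simp (no_asm_use) del: triangle_morphism.simps) blast
  have [simp]: "a0 \<in> Arr U" "Src U a0 = OMap F (Src R d)" "Tgt U a0 = OMap F (Src R k)"
     "b0 \<in> Arr U" "Src U b0 = OMap F (Src R k)" "Tgt U b0 = OMap F (Src R e)"
    using o(2,3) unfolding triangle_morphism.simps Hom_def by simp_all
  obtain a where a [simp]: "a \<in> Arr R" "Src R a = Src R d" "Tgt R a = Src R k" and ea: "F' a = a0"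
    using F_full[of a0 "Src R d" "Src R k"] by (simp (no_asm_use)) blast
  obtain b where b [simp]: "b \<in> Arr R" "Src R b = Src R k" "Tgt R b = Src R e" and eb: "F' b = b0"
    using F_full[of b0 "Src R k" "Src R e"] by (simp (no_asm_use)) blast
  have n: "theta (Src R d) \<cdot>\<^bsub>U\<^esub> F' (ShA R p) = ShA U (F' p) \<cdot>\<^bsub>U\<^esub> theta (Src R v)"
    using theta_natural[of p] by simp
  have "FT a b (ShA R p \<cdot>\<^bsub>R\<^esub> e) \<in> Tri U" using o(1) unfolding ea eb by (simp add: n[THEN U.assoc_eq])
  then have "(a, b, ShA R p \<cdot>\<^bsub>R\<^esub> e) \<in> Tri R" unfolding Tri_R by simp
  moreover have "triangle_morphism R (u, p, d) (v \<cdot>\<^bsub>R\<^esub> u, r, k) (Ident R (Src R u), v, a)"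
    using FT_morphism[OF c(1,3), of "Ident R (Src R u)" v a] o(2) unfolding ea by (simp del: triangle_morphism.simps)
  moreover have "triangle_morphism R (v \<cdot>\<^bsub>R\<^esub> u, r, k) (v, q, e) (u, Ident R (Tgt R v), b)"
    using FT_morphism[OF c(3,2), of u "Ident R (Tgt R v)" b] o(3) unfolding eb by (simp del: triangle_morphism.simps)
  ultimately show ?thesis by blast
qed

theorem R_triangulated: "triangulated_category R"
proof (intro triangulated_category.intro triangulated_category_axioms.intro)
  show "additive_category R" by (rule R.additive_category_axioms)
  show "additive_equivalence R R (shift_functor R)" by (rule ShR_equivalence)
  show "candidate_triangle R t" if "t \<in> Tri R" for t
    using that Tri_R by (cases t) blast
  show "t' \<in> Tri R" if "t \<in> Tri R" "isomorphic_triangles R t t'" for t t' using R_TR1_iso that by blast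
  show "(Ident R A, Zero R A Z, Zero R Z (ShO R A)) \<in> Tri R" if "A \<in> Ob R" "zero_object R Z" for A Z
    using R_TR1_ident that by blast
  show "\<exists>v w. (u, v, w) \<in> Tri R" if "u \<in> Arr R" for u using R_TR1_cone[OF that] .
  show "(u, v, w) \<in> Tri R \<longleftrightarrow> (v, w, Neg R (ShA R u)) \<in> Tri R" if "candidate_triangle R (u, v, w)" for u v w
    using R_TR2[OF that] .
  show "\<exists>c. triangle_morphism R (u, v, w) (u', v', w') (a, b, c)"
    if "(u, v, w) \<in> Tri R" "(u', v', w') \<in> Tri R" "a \<in> Hom R (Src R u) (Src R u')" "b \<in> Hom R (Tgt R u) (Tgt R u')"
      "b \<cdot>\<^bsub>R\<^esub> u = u' \<cdot>\<^bsub>R\<^esub> a" for u v w u' v' w' a b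
    using R_TR3[OF that] .
  show "\<exists>a b. (a, b, ShA R p \<cdot>\<^bsub>R\<^esub> e) \<in> Tri R \<and>
            triangle_morphism R (u, p, d) (v \<cdot>\<^bsub>R\<^esub> u, r, k) (Ident R X, v, a) \<and>
            triangle_morphism R (v \<cdot>\<^bsub>R\<^esub> u, r, k) (v, q, e) (u, Ident R Z, b)"
    if "u \<in> Hom R X Y" "v \<in> Hom R Y Z" "(u, p, d) \<in> Tri R" "(v, q, e) \<in> Tri R" "(v \<cdot>\<^bsub>R\<^esub> u, r, k) \<in> Tri R"
    for u X Y v Z p d q e r k
  proof -
    have "u \<in> Arr R" "v \<in> Arr R" "Tgt R u = Src R v" "X = Src R u" "Z = Tgt R v" using that(1,2) by auto
    then show ?thesis using R_TR4[OF _ _ _ that(3-5)] by simp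
  qed
qed

end

text \<open>Needed because a record and its extension by further fields have different types and
  cannot be equated.\<close>

lemma additive_category_cong:
  fixes C :: "('o, 'm, 'x) add_cat_scheme" and D :: "('o, 'm, 'y) add_cat_scheme"
  assumes "Ob D = Ob C" "Arr D = Arr C" "Src D = Src C" "Tgt D = Tgt C" "Ident D = Ident C" "Comp D = Comp C"
    "Add D = Add C" "Zero D = Zero C"
  shows "additive_category D \<longleftrightarrow> additive_category C"
  unfolding additive_category_def additive_category_axioms_def preadditive_category_def preadditive_category_axioms_def
    category_def zero_object_def biproduct_def hom_group_def
  by (simp add: assms)

text \<open>The shift on \<open>C\<close> is built from the one on \<open>U\<close>: a chosen
  preimage on objects, with \<open>theta\<close> recording the isomorphism, and on arrows the lift
  of the conjugate by \<open>theta\<close>. Naturality of \<open>theta\<close> then holds by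
  construction.\<close>

lemma transport_triangulated_structure:
  fixes C :: "('p, 'n) add_cat" and U :: "('o, 'm, 'x) tri_cat_scheme"
  assumes U: "triangulated_category U" and F: "additive_equivalence C U F"
  shows "has_triangulated_structure C"
proof -
  interpret U: triangulated_category U by fact
  have C: "additive_category C" "add_functor C U F"
    using F additive_functor_imp_locale[of C U F] by (simp_all add: additive_equivalence_def)
  interpret C: additive_category C by fact
  interpret F: add_functor C U F by fact
  have fully_faithful: "fully_faithful C U F" and es: "ess_surj C U F"
    using F.equivalence_functorD F by (simp_all add: additive_equivalence_def)
  have "\<exists>B. B \<in> Ob C \<and> (\<exists>h \<in> Hom U (OMap F B) (ShO U (OMap F A)). is_iso U h)" if "A \<in> Ob C" for A
    using es that unfolding ess_surj_def isomorphic_def by (metis F.F_simps(1) U.Sh_simps(1))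
  then obtain SO where SO: "\<And>A. A \<in> Ob C \<Longrightarrow> SO A \<in> Ob C \<and> (\<exists>h \<in> Hom U (OMap F (SO A)) (ShO U (OMap F A)). is_iso U h)"
    by metis
  then obtain theta where theta: "\<And>A. A \<in> Ob C \<Longrightarrow> theta A \<in> Hom U (OMap F (SO A)) (ShO U (OMap F A)) \<and> is_iso U (theta A)"
    by metis
  have [simp]: "SO A \<in> Ob C" "theta A \<in> Arr U" "Src U (theta A) = OMap F (SO A)" "Tgt U (theta A) = ShO U (OMap F A)" "is_iso U (theta A)"
    if "A \<in> Ob C" for A using SO[OF that] theta[OF that] by simp_all
  have "\<exists>g. g \<in> Hom C (SO (Src C f)) (SO (Tgt C f)) \<and>
     AMap F g = inv_arr U (theta (Tgt C f)) \<cdot>\<^bsub>U\<^esub> (ShA U (AMap F f) \<cdot>\<^bsub>U\<^esub> theta (Src C f))" if "f \<in> Arr C" for f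
  proof -
    obtain g where "g \<in> Arr C" "Src C g = SO (Src C f)" "Tgt C g = SO (Tgt C f)"
      "AMap F g = inv_arr U (theta (Tgt C f)) \<cdot>\<^bsub>U\<^esub> (ShA U (AMap F f) \<cdot>\<^bsub>U\<^esub> theta (Src C f))"
      by (rule F.fully_faithful_surj[OF fully_faithful, of "SO (Src C f)" "SO (Tgt C f)"
            "inv_arr U (theta (Tgt C f)) \<cdot>\<^bsub>U\<^esub> (ShA U (AMap F f) \<cdot>\<^bsub>U\<^esub> theta (Src C f))"]) (use \<open>f \<in> Arr C\<close> in simp_all)
    then show ?thesis by (intro exI[of _ g]) simp
  qed
  then obtain SA where SA: "\<And>f. f \<in> Arr C \<Longrightarrow> SA f \<in> Hom C (SO (Src C f)) (SO (Tgt C f)) \<and>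
     AMap F (SA f) = inv_arr U (theta (Tgt C f)) \<cdot>\<^bsub>U\<^esub> (ShA U (AMap F f) \<cdot>\<^bsub>U\<^esub> theta (Src C f))"
    by metis
  define R :: "('p, 'n) tri_cat" where "R = add_cat.extend C
    \<lparr>ShO = SO, ShA = SA, Tri = {(u, v, w). u \<in> Arr C \<and> v \<in> Arr C \<and> w \<in> Arr C \<and> Tgt C u = Src C v \<and>
       Tgt C v = Src C w \<and> Tgt C w = SO (Src C u) \<and> (AMap F u, AMap F v, theta (Src C u) \<cdot>\<^bsub>U\<^esub> AMap F w) \<in> Tri U}\<rparr>"
  have sel: "Ob R = Ob C" "Arr R = Arr C" "Src R = Src C" "Tgt R = Tgt C" "Ident R = Ident C" "Comp R = Comp C"
    "Add R = Add C" "Zero R = Zero C" "ShO R = SO" "ShA R = SA"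
    and trunc: "add_cat.truncate R = C"
    by (simp_all add: R_def add_cat.defs)
  have TriR: "(u, v, w) \<in> Tri R \<longleftrightarrow> candidate_triangle R (u, v, w) \<and>
      (AMap F u, AMap F v, theta (Src R u) \<cdot>\<^bsub>U\<^esub> AMap F w) \<in> Tri U" for u v w
    by (simp add: sel) (simp add: R_def add_cat.defs)
  have R: "additive_category R" using additive_category_cong[of R C, OF sel(1-8)] C(1) by blast
  interpret R: additive_category R by fact
  interpret FR: add_functor R U F
  proof
    show "is_functor R U F" using F.is_functor R.category_axioms by (simp add: is_functor_def sel)
    show "AMap F (f \<boxplus>\<^bsub>R\<^esub> g) = AMap F f \<boxplus>\<^bsub>U\<^esub> AMap F g"
      if "f \<in> Arr R" "g \<in> Arr R" "Src R f = Src R g" "Tgt R f = Tgt R g" for f g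
      using F.F_Add[of f g] that by (simp add: sel)
  qed
  have "transported R U F theta"
  proof (intro transported.intro transported_axioms.intro R U FR.add_functor_axioms)
    show "fully_faithful R U F" using fully_faithful by (simp add: fully_faithful_def sel)
    show "ess_surj R U F" using es by (simp add: ess_surj_def sel)
    show "theta (Tgt R f) \<cdot>\<^bsub>U\<^esub> AMap F (ShA R f) = ShA U (AMap F f) \<cdot>\<^bsub>U\<^esub> theta (Src R f)" if "f \<in> Arr R" for f
      using SA[of f] that by (simp add: sel)
    show "(u, v, w) \<in> Tri R \<longleftrightarrow> candidate_triangle R (u, v, w) \<and>
      (AMap F u, AMap F v, theta (Src R u) \<cdot>\<^bsub>U\<^esub> AMap F w) \<in> Tri U" for u v w by (rule TriR)
  qed (use SA in \<open>simp_all add: sel\<close>)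
  then interpret transported R U F theta .
  show ?thesis unfolding has_triangulated_structure_def using trunc R_triangulated by blast
qed

section \<open>The quotient by an ideal of morphisms factoring through given objects\<close>

context preadditive_category
begin

lemma Add_left_commute:
  assumes "f \<in> Arr C" "g \<in> Arr C" "h \<in> Arr C"
    "Src C f = Src C g" "Tgt C f = Tgt C g" "Src C g = Src C h" "Tgt C g = Tgt C h"
  shows "f \<boxplus> (g \<boxplus> h) = g \<boxplus> (f \<boxplus> h)"
  using assms Add_assoc[of f g h] Add_assoc[of g f h] Add_commute[of f g] by simp

lemmas Add_ac = Add_assoc Add_commute Add_left_commute

end

text \<open>Closure under biproducts makes sums of arrows through \<open>P\<close> factor through
  \<open>P\<close> again, and nonemptiness supplies the zero arrows. So the cosets in
  \<open>ideal_quotient\<close> are those of a subgroup.\<close>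

locale object_ideal = additive_category C
  for C :: "('o, 'm, 'x) add_cat_scheme" (structure) +
  fixes P :: "'o set"
  assumes P_Ob: "P \<subseteq> Ob C" and P_nonempty: "P \<noteq> {}"
    and P_biproduct: "\<lbrakk>W \<in> P; W' \<in> P\<rbrakk> \<Longrightarrow> \<exists>B \<in> P. biproduct C W W' B"
begin

abbreviation fac where "fac \<equiv> factoring C P"
abbreviation q where "q \<equiv> ideal_coset C P"
abbreviation Q where "Q \<equiv> ideal_quotient C P"

lemma fac_iff: "f \<in> fac X Y \<longleftrightarrow> (\<exists>g h. g \<in> Arr C \<and> h \<in> Arr C \<and> Src C g = X \<and> Tgt C g \<in> P \<and> Src C h = Tgt C g \<and> Tgt C h = Y \<and> f = h \<cdot> g)"
  unfolding factoring_def by auto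

lemma fac_Hom:
  assumes "f \<in> fac X Y"
  shows "f \<in> Arr C" "Src C f = X" "Tgt C f = Y"
  using assms unfolding fac_iff by auto

lemma fac_Zero [simp]:
  assumes [simp]: "X \<in> Ob C" "Y \<in> Ob C"
  shows "Zero C X Y \<in> fac X Y"
proof -
  obtain W where W: "W \<in> P" using P_nonempty by blast
  then have [simp]: "W \<in> Ob C" using P_Ob by blast
  show ?thesis unfolding fac_iff
    by (intro exI[of _ "Zero C X W"] exI[of _ "Zero C W Y"]) (simp add: W)
qed

lemma fac_Neg:
  assumes "f \<in> fac X Y"
  shows "Neg C f \<in> fac X Y"
proof -
  obtain g h where "g \<in> Arr C" "h \<in> Arr C" "Src C g = X" "Tgt C g \<in> P" "Src C h = Tgt C g" "Tgt C h = Y" "f = h \<cdot> g"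
    using assms unfolding fac_iff by blast
  then show ?thesis unfolding fac_iff by (intro exI[of _ g] exI[of _ "Neg C h"]) simp
qed

lemma fac_Comp_left:
  assumes "f \<in> fac X Y" "k \<in> Arr C" "Src C k = Y" "Tgt C k = Z"
  shows "k \<cdot> f \<in> fac X Z"
proof -
  obtain g h where "g \<in> Arr C" "h \<in> Arr C" "Src C g = X" "Tgt C g \<in> P" "Src C h = Tgt C g" "Tgt C h = Y" "f = h \<cdot> g"
    using assms(1) unfolding fac_iff by blast
  then show ?thesis using assms(2-) unfolding fac_iff by (intro exI[of _ g] exI[of _ "k \<cdot> h"]) simp
qed

lemma fac_Comp_right:
  assumes "f \<in> fac X Y" "k \<in> Arr C" "Tgt C k = X" "Src C k = Z"
  shows "f \<cdot> k \<in> fac Z Y"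
proof -
  obtain g h where "g \<in> Arr C" "h \<in> Arr C" "Src C g = X" "Tgt C g \<in> P" "Src C h = Tgt C g" "Tgt C h = Y" "f = h \<cdot> g"
    using assms(1) unfolding fac_iff by blast
  then show ?thesis using assms(2-) unfolding fac_iff by (intro exI[of _ "g \<cdot> k"] exI[of _ h]) simp
qed

lemma fac_Add:
  assumes "f \<in> fac X Y" "f' \<in> fac X Y"
  shows "f \<boxplus> f' \<in> fac X Y"
proof -
  obtain g h where gh [simp]: "g \<in> Arr C" "h \<in> Arr C" "Src C g = X" "Src C h = Tgt C g" "Tgt C h = Y"
    and W: "Tgt C g \<in> P" and f: "f = h \<cdot> g"
    using assms(1) unfolding fac_iff by blast
  obtain g' h' where gh' [simp]: "g' \<in> Arr C" "h' \<in> Arr C" "Src C g' = X" "Src C h' = Tgt C g'" "Tgt C h' = Y"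
    and W': "Tgt C g' \<in> P" and f': "f' = h' \<cdot> g'"
    using assms(2) unfolding fac_iff by blast
  obtain B where B: "B \<in> P" "biproduct C (Tgt C g) (Tgt C g') B" using P_biproduct[OF W W'] by blast
  obtain i j p r where [simp]: "i \<in> Arr C" "j \<in> Arr C" "p \<in> Arr C" "r \<in> Arr C" "Src C i = Tgt C g" "Src C j = Tgt C g'" "Src C p = B"
    "Src C r = B" "Tgt C i = B" "Tgt C j = B" "Tgt C p = Tgt C g" "Tgt C r = Tgt C g'"
    and e: "p \<cdot> i = Ident C (Tgt C g)" "r \<cdot> j = Ident C (Tgt C g')" "r \<cdot> i = Zero C (Tgt C g) (Tgt C g')" "p \<cdot> j = Zero C (Tgt C g') (Tgt C g)"
    using B(2) unfolding biproduct_def Hom_def by blast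
  have [simp]: "X \<in> Ob C" "Y \<in> Ob C" using Src_in_Ob[OF gh(1)] Tgt_in_Ob[OF gh(2)] by simp_all
  \<comment> \<open>The sum factors through the biproduct \<open>B\<close> of the two middle
    objects, as the mixed terms vanish.\<close>
  have "(h \<cdot> p \<boxplus> h' \<cdot> r) \<cdot> (i \<cdot> g \<boxplus> j \<cdot> g') = f \<boxplus> f'"
    by (simp add: f f' e[THEN assoc_eq])
  then show ?thesis unfolding fac_iff
    by (intro exI[of _ "i \<cdot> g \<boxplus> j \<cdot> g'"] exI[of _ "h \<cdot> p \<boxplus> h' \<cdot> r"]) (simp add: B)
qed

lemma q_eq: "q f = {h \<boxplus> f |h. h \<in> fac (Src C f) (Tgt C f)}"
  unfolding ideal_coset_def r_coset_def hom_group_def by auto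

lemma q_self:
  assumes "f \<in> Arr C"
  shows "f \<in> q f"
  unfolding q_eq using assms by (intro CollectI exI[of _ "Zero C (Src C f) (Tgt C f)"]) simp

lemma q_mem:
  assumes "g \<in> q f" "f \<in> Arr C"
  shows "g \<in> Arr C" "Src C g = Src C f" "Tgt C g = Tgt C f" "g \<boxplus> Neg C f \<in> fac (Src C f) (Tgt C f)"
proof -
  obtain h where h: "h \<in> fac (Src C f) (Tgt C f)" and g: "g = h \<boxplus> f" using assms(1) unfolding q_eq by blast
  note [simp] = fac_Hom[OF h] assms(2)
  show "g \<in> Arr C" "Src C g = Src C f" "Tgt C g = Tgt C f" unfolding g by simp_all
  show "g \<boxplus> Neg C f \<in> fac (Src C f) (Tgt C f)" unfolding g using h by (simp add: Add_assoc)
qed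

lemma q_memI:
  assumes "g \<in> Arr C" "f \<in> Arr C" "Src C g = Src C f" "Tgt C g = Tgt C f" "g \<boxplus> Neg C f \<in> fac (Src C f) (Tgt C f)"
  shows "g \<in> q f"
  unfolding q_eq using assms by (intro CollectI exI[of _ "g \<boxplus> Neg C f"]) (simp add: Add_assoc)

lemma q_eqI:
  assumes m: "g \<in> q f" and f [simp]: "f \<in> Arr C"
  shows "q g = q f"
proof -
  note [simp] = q_mem(1-3)[OF m f]
  have gf: "g \<boxplus> Neg C f \<in> fac (Src C f) (Tgt C f)" by (rule q_mem(4)[OF m f])
  show ?thesis
  proof (rule Set.set_eqI)
    fix k
    show "k \<in> q g \<longleftrightarrow> k \<in> q f"
    proof
      assume k: "k \<in> q g"
      have [simp]: "k \<in> Arr C" "Src C k = Src C f" "Tgt C k = Tgt C f" using q_mem(1-3)[OF k] by simp_all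
      have "(k \<boxplus> Neg C g) \<boxplus> (g \<boxplus> Neg C f) \<in> fac (Src C f) (Tgt C f)"
        using fac_Add q_mem(4)[OF k] gf by simp
      moreover have "(k \<boxplus> Neg C g) \<boxplus> (g \<boxplus> Neg C f) = k \<boxplus> ((Neg C g \<boxplus> g) \<boxplus> Neg C f)"
        by (simp add: Add_assoc del: Add_Neg)
      ultimately show "k \<in> q f" by (intro q_memI) simp_all
    next
      assume k: "k \<in> q f"
      have [simp]: "k \<in> Arr C" "Src C k = Src C f" "Tgt C k = Tgt C f" using q_mem(1-3)[OF k] by simp_all
      have "(k \<boxplus> Neg C f) \<boxplus> Neg C (g \<boxplus> Neg C f) \<in> fac (Src C f) (Tgt C f)"
        by (rule fac_Add) (use q_mem(4)[OF k] fac_Neg[OF gf] in simp_all)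
      moreover have "Neg C (g \<boxplus> Neg C f) = f \<boxplus> Neg C g"
      proof (rule Neg_unique[symmetric])
        have "(g \<boxplus> Neg C f) \<boxplus> (f \<boxplus> Neg C g) = g \<boxplus> ((Neg C f \<boxplus> f) \<boxplus> Neg C g)"
          by (simp add: Add_assoc del: Add_Neg)
        then show "(g \<boxplus> Neg C f) \<boxplus> (f \<boxplus> Neg C g) = Zero C (Src C (g \<boxplus> Neg C f)) (Tgt C (g \<boxplus> Neg C f))"
          by simp
      qed simp_all
      moreover have "(k \<boxplus> Neg C f) \<boxplus> (f \<boxplus> Neg C g) = k \<boxplus> ((Neg C f \<boxplus> f) \<boxplus> Neg C g)"
        by (simp add: Add_assoc del: Add_Neg)
      ultimately show "k \<in> q g" by (intro q_memI) simp_all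
    qed
  qed
qed

section \<open>The operations of the ideal quotient on cosets\<close>

lemma Q_sel [simp]: "Ob Q = Ob C" "Ident Q A = q (Ident C A)"
  by (simp_all add: ideal_quotient_def)

lemma q_Arr [simp]:
  assumes "f \<in> Arr C"
  shows "q f \<in> Arr Q"
proof -
  have "q f \<in> rcosets\<^bsub>hom_group C (Src C f) (Tgt C f)\<^esub> (fac (Src C f) (Tgt C f))"
    unfolding RCOSETS_def ideal_coset_def hom_group_def using assms by auto
  then show ?thesis unfolding ideal_quotient_def using assms by force
qed

lemma Q_Arr_cases:
  assumes "F \<in> Arr Q"
  shows "\<exists>f. f \<in> Arr C \<and> F = q f"
proof -
  obtain X Y where "F \<in> rcosets\<^bsub>hom_group C X Y\<^esub> (fac X Y)" using assms unfolding ideal_quotient_def by auto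
  then obtain f where f: "f \<in> Hom C X Y" "F = fac X Y #>\<^bsub>hom_group C X Y\<^esub> f"
    unfolding RCOSETS_def by (auto simp: hom_group_def)
  then have "F = q f" by (simp add: ideal_coset_def)
  then show ?thesis using f by auto
qed

lemma q_Src_Tgt [simp]:
  assumes "f \<in> Arr C"
  shows "Src Q (q f) = Src C f" "Tgt Q (q f) = Tgt C f"
proof -
  have "(SOME g. g \<in> q f) \<in> q f" using q_self[OF assms] by (rule someI)
  from q_mem[OF this assms] show "Src Q (q f) = Src C f" "Tgt Q (q f) = Tgt C f"
    by (simp_all add: ideal_quotient_def)
qed

lemma q_Comp [simp]:
  assumes [simp]: "f \<in> Arr C" "g \<in> Arr C" "Tgt C f = Src C g"
  shows "q g \<cdot>\<^bsub>Q\<^esub> q f = q (g \<cdot> f)"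
proof -
  have "q (b \<cdot> a) = q (g \<cdot> f)" if b: "b \<in> q g" and a: "a \<in> q f" for a b
  proof (rule q_eqI)
    note [simp] = q_mem(1-3)[OF a] q_mem(1-3)[OF b]
    \<comment> \<open>The difference of \<open>b \<cdot> a\<close> and \<open>g \<cdot> f\<close> is
      split by inserting \<open>b \<cdot> f\<close>; each of the two summands contains one factor
      from the ideal.\<close>
    have "b \<cdot> (a \<boxplus> Neg C f) \<in> fac (Src C f) (Tgt C g)"
      by (rule fac_Comp_left[OF q_mem(4)[OF a]]) simp_all
    moreover have "(b \<boxplus> Neg C g) \<cdot> f \<in> fac (Src C f) (Tgt C g)"
      by (rule fac_Comp_right[OF q_mem(4)[OF b]]) simp_all
    ultimately have "b \<cdot> (a \<boxplus> Neg C f) \<boxplus> (b \<boxplus> Neg C g) \<cdot> f \<in> fac (Src C f) (Tgt C g)" by (rule fac_Add)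
    moreover have "b \<cdot> (a \<boxplus> Neg C f) \<boxplus> (b \<boxplus> Neg C g) \<cdot> f = b \<cdot> a \<boxplus> ((Neg C (b \<cdot> f) \<boxplus> b \<cdot> f) \<boxplus> Neg C (g \<cdot> f))"
      by (simp add: Add_assoc del: Add_Neg)
    ultimately show "b \<cdot> a \<in> q (g \<cdot> f)" by (intro q_memI) simp_all
  qed simp
  then have "(\<Union>b \<in> q g. \<Union>a \<in> q f. q (b \<cdot> a)) = (\<Union>b \<in> q g. \<Union>a \<in> q f. q (g \<cdot> f))"
    by (intro SUP_cong refl)
  also have "\<dots> = q (g \<cdot> f)" using q_self[of f] q_self[of g] by auto
  finally have "(\<Union>b \<in> q g. \<Union>a \<in> q f. q (b \<cdot> a)) = q (g \<cdot> f)" .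
  then show ?thesis by (simp add: ideal_quotient_def)
qed

lemma q_Add [simp]:
  assumes [simp]: "f \<in> Arr C" "g \<in> Arr C" "Src C f = Src C g" "Tgt C f = Tgt C g"
  shows "q f \<boxplus>\<^bsub>Q\<^esub> q g = q (f \<boxplus> g)"
proof -
  have "(\<Union>a \<in> q f. \<Union>b \<in> q g. {a \<boxplus> b}) = q (f \<boxplus> g)"
  proof (intro subset_antisym subsetI)
    fix c assume "c \<in> (\<Union>a \<in> q f. \<Union>b \<in> q g. {a \<boxplus> b})"
    then obtain h k where h: "h \<in> fac (Src C g) (Tgt C g)" and k: "k \<in> fac (Src C g) (Tgt C g)"
      and c: "c = (h \<boxplus> f) \<boxplus> (k \<boxplus> g)"
      unfolding q_eq by auto
    have "c = (h \<boxplus> k) \<boxplus> (f \<boxplus> g)" unfolding c using fac_Hom[OF h] fac_Hom[OF k] by (simp add: Add_ac)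
    then show "c \<in> q (f \<boxplus> g)" using fac_Add[OF h k] unfolding q_eq by auto
  next
    fix c assume "c \<in> q (f \<boxplus> g)"
    then obtain h where h: "h \<in> fac (Src C g) (Tgt C g)" and c: "c = h \<boxplus> (f \<boxplus> g)"
      unfolding q_eq by auto
    have "c = (h \<boxplus> f) \<boxplus> g" unfolding c using fac_Hom[OF h] by (simp add: Add_assoc)
    moreover have "h \<boxplus> f \<in> q f" using h unfolding q_eq by auto
    ultimately show "c \<in> (\<Union>a \<in> q f. \<Union>b \<in> q g. {a \<boxplus> b})" using q_self[of g] by auto
  qed
  then show ?thesis by (simp add: ideal_quotient_def)
qed

lemma Q_Zero [simp]:
  assumes [simp]: "X \<in> Ob C" "Y \<in> Ob C"
  shows "Zero Q X Y = q (Zero C X Y)"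
proof -
  have "h \<boxplus> Zero C X Y = h" if "h \<in> fac X Y" for h using fac_Hom[OF that] by simp
  then have "q (Zero C X Y) = fac X Y" unfolding q_eq by force
  then show ?thesis by (simp add: ideal_quotient_def)
qed

sublocale Q: category Q
proof
  fix F assume "F \<in> Arr Q"
  then show "Src Q F \<in> Ob Q" "Tgt Q F \<in> Ob Q" using Q_Arr_cases[of F] by auto
next
  fix A assume "A \<in> Ob Q"
  then show "Ident Q A \<in> Hom Q A A" by simp
next
  fix F G X Y Z assume FG: "F \<in> Hom Q X Y" "G \<in> Hom Q Y Z"
  obtain f where "f \<in> Arr C" "F = q f" using Q_Arr_cases[of F] FG by auto
  moreover obtain g where "g \<in> Arr C" "G = q g" using Q_Arr_cases[of G] FG by auto
  ultimately show "G \<cdot>\<^bsub>Q\<^esub> F \<in> Hom Q X Z" using FG by simp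
next
  fix F X Y assume FG: "F \<in> Hom Q X Y"
  obtain f where f: "f \<in> Arr C" "F = q f" using Q_Arr_cases[of F] FG by auto
  then have "X = Src C f" "Y = Tgt C f" using FG by simp_all
  then show "F \<cdot>\<^bsub>Q\<^esub> Ident Q X = F" "Ident Q Y \<cdot>\<^bsub>Q\<^esub> F = F" using f by simp_all
next
  fix F G H W X Y Z assume FGH: "F \<in> Hom Q W X" "G \<in> Hom Q X Y" "H \<in> Hom Q Y Z"
  obtain f where "f \<in> Arr C" "F = q f" using Q_Arr_cases[of F] FGH by auto
  moreover obtain g where "g \<in> Arr C" "G = q g" using Q_Arr_cases[of G] FGH by auto
  moreover obtain h where "h \<in> Arr C" "H = q h" using Q_Arr_cases[of H] FGH by auto
  ultimately show "(H \<cdot>\<^bsub>Q\<^esub> G) \<cdot>\<^bsub>Q\<^esub> F = H \<cdot>\<^bsub>Q\<^esub> (G \<cdot>\<^bsub>Q\<^esub> F)" using FGH by simp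
qed

lemma Q_comm_group:
  assumes [simp]: "A \<in> Ob C" "B \<in> Ob C"
  shows "comm_group (hom_group Q A B)"
proof (rule comm_groupI)
  let ?G = "hom_group Q A B"
  have sel: "carrier ?G = Hom Q A B" "x \<otimes>\<^bsub>?G\<^esub> y = x \<boxplus>\<^bsub>Q\<^esub> y" "\<one>\<^bsub>?G\<^esub> = Zero Q A B" for x y by (simp_all add: hom_group_def)
  have rep: "\<exists>f. f \<in> Arr C \<and> x = q f \<and> Src C f = A \<and> Tgt C f = B" if x: "x \<in> carrier ?G" for x
  proof -
    have x': "x \<in> Arr Q" "Src Q x = A" "Tgt Q x = B" using x by (simp_all add: sel)
    obtain f where f: "f \<in> Arr C" "x = q f" using Q_Arr_cases[OF x'(1)] by blast
    then show ?thesis using x' by auto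
  qed
  {
    fix x y assume xy: "x \<in> carrier ?G" "y \<in> carrier ?G"
    obtain f where "f \<in> Arr C" "x = q f" "Src C f = A" "Tgt C f = B" using rep[OF xy(1)] by blast
    moreover obtain g where "g \<in> Arr C" "y = q g" "Src C g = A" "Tgt C g = B" using rep[OF xy(2)] by blast
    ultimately show "x \<otimes>\<^bsub>?G\<^esub> y \<in> carrier ?G" "x \<otimes>\<^bsub>?G\<^esub> y = y \<otimes>\<^bsub>?G\<^esub> x" by (simp_all add: sel Add_commute[of f g])
  }
  show "\<one>\<^bsub>?G\<^esub> \<in> carrier ?G" by (simp add: sel)
  {
    fix x y z assume xyz: "x \<in> carrier ?G" "y \<in> carrier ?G" "z \<in> carrier ?G"
    obtain f where "f \<in> Arr C" "x = q f" "Src C f = A" "Tgt C f = B" using rep[OF xyz(1)] by blast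
    moreover obtain g where "g \<in> Arr C" "y = q g" "Src C g = A" "Tgt C g = B" using rep[OF xyz(2)] by blast
    moreover obtain h where "h \<in> Arr C" "z = q h" "Src C h = A" "Tgt C h = B" using rep[OF xyz(3)] by blast
    ultimately show "x \<otimes>\<^bsub>?G\<^esub> y \<otimes>\<^bsub>?G\<^esub> z = x \<otimes>\<^bsub>?G\<^esub> (y \<otimes>\<^bsub>?G\<^esub> z)" by (simp add: sel Add_assoc)
  }
  {
    fix x assume x: "x \<in> carrier ?G"
    obtain f where f: "f \<in> Arr C" "x = q f" "Src C f = A" "Tgt C f = B" using rep[OF x] by blast
    then show "\<one>\<^bsub>?G\<^esub> \<otimes>\<^bsub>?G\<^esub> x = x" by (simp add: sel)
    show "\<exists>y\<in>carrier ?G. y \<otimes>\<^bsub>?G\<^esub> x = \<one>\<^bsub>?G\<^esub>" unfolding sel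
      by (rule bexI[of _ "q (Neg C f)"]) (use f in simp_all)
  }
qed

sublocale Q: preadditive_category Q
proof (intro preadditive_category.intro preadditive_category_axioms.intro)
  show "category Q" by (rule Q.category_axioms)
next
  show "comm_group (hom_group Q A B)" if "A \<in> Ob Q" "B \<in> Ob Q" for A B using Q_comm_group that by simp
next
  fix F X Y G Z H assume FGH: "F \<in> Hom Q X Y" "G \<in> Hom Q Y Z" "H \<in> Hom Q Y Z"
  obtain f where "f \<in> Arr C" "F = q f" using Q_Arr_cases[of F] FGH by auto
  moreover obtain g where "g \<in> Arr C" "G = q g" using Q_Arr_cases[of G] FGH by auto
  moreover obtain h where "h \<in> Arr C" "H = q h" using Q_Arr_cases[of H] FGH by auto
  ultimately show "(G \<boxplus>\<^bsub>Q\<^esub> H) \<cdot>\<^bsub>Q\<^esub> F = G \<cdot>\<^bsub>Q\<^esub> F \<boxplus>\<^bsub>Q\<^esub> H \<cdot>\<^bsub>Q\<^esub> F" using FGH by simp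
next
  fix F X Y G Z H assume FGH: "F \<in> Hom Q X Y" "G \<in> Hom Q X Y" "H \<in> Hom Q Y Z"
  obtain f where "f \<in> Arr C" "F = q f" using Q_Arr_cases[of F] FGH by auto
  moreover obtain g where "g \<in> Arr C" "G = q g" using Q_Arr_cases[of G] FGH by auto
  moreover obtain h where "h \<in> Arr C" "H = q h" using Q_Arr_cases[of H] FGH by auto
  ultimately show "H \<cdot>\<^bsub>Q\<^esub> (F \<boxplus>\<^bsub>Q\<^esub> G) = H \<cdot>\<^bsub>Q\<^esub> F \<boxplus>\<^bsub>Q\<^esub> H \<cdot>\<^bsub>Q\<^esub> G" using FGH by simp
qed

lemma proj_sel: "OMap (ideal_projection C P) A = A" "AMap (ideal_projection C P) = q"
  by (simp_all add: ideal_projection_def)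

lemma Q_additive: "additive_category Q"
proof -
  have "is_functor C Q (ideal_projection C P)"
    unfolding is_functor_def proj_sel by (simp add: category_axioms Q.category_axioms)
  then interpret pr: add_functor C Q "ideal_projection C P"
    by unfold_locales (simp_all add: proj_sel)
  show ?thesis by (rule pr.additive_image[OF additive_category_axioms]) (simp add: proj_sel)
qed

end

section \<open>Full subcategories\<close>

context preadditive_category
begin

lemma full_subcat_sel [simp]:
  "Ob (full_subcat C A) = Ob C \<inter> A" "f \<in> Arr (full_subcat C A) \<longleftrightarrow> f \<in> Arr C \<and> Src C f \<in> A \<and> Tgt C f \<in> A"
  "Src (full_subcat C A) = Src C" "Tgt (full_subcat C A) = Tgt C" "Ident (full_subcat C A) = Ident C"
  "Comp (full_subcat C A) = Comp C" "Add (full_subcat C A) = Add C" "Zero (full_subcat C A) = Zero C"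
  by (simp_all add: full_subcat_def)

lemma full_subcat_additive:
  assumes Z0: "zero_object C Z0" "Z0 \<in> A"
    and bi: "\<And>X Y. \<lbrakk>X \<in> Ob C \<inter> A; Y \<in> Ob C \<inter> A\<rbrakk> \<Longrightarrow> \<exists>B \<in> Ob C \<inter> A. biproduct C X Y B"
  shows "additive_category (full_subcat C A)"
proof (intro additive_category.intro additive_category_axioms.intro preadditive_category.intro preadditive_category_axioms.intro)
  let ?K = "full_subcat C A"
  show "category ?K" by unfold_locales auto
  show "comm_group (hom_group ?K X Y)" if "X \<in> Ob ?K" "Y \<in> Ob ?K" for X Y
  proof -
    have "Hom ?K X Y = Hom C X Y" using that by auto
    then have "hom_group ?K X Y = hom_group C X Y" by (simp add: hom_group_def del: Hom_def)
    then show ?thesis using comm_group_Hom that by simp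
  qed
  show "(G \<boxplus>\<^bsub>?K\<^esub> H) \<cdot>\<^bsub>?K\<^esub> F = G \<cdot>\<^bsub>?K\<^esub> F \<boxplus>\<^bsub>?K\<^esub> H \<cdot>\<^bsub>?K\<^esub> F"
    if "F \<in> Hom ?K X Y" "G \<in> Hom ?K Y Z" "H \<in> Hom ?K Y Z" for F X Y G Z H using that by simp
  show "H \<cdot>\<^bsub>?K\<^esub> (F \<boxplus>\<^bsub>?K\<^esub> G) = H \<cdot>\<^bsub>?K\<^esub> F \<boxplus>\<^bsub>?K\<^esub> H \<cdot>\<^bsub>?K\<^esub> G"
    if "F \<in> Hom ?K X Y" "G \<in> Hom ?K X Y" "H \<in> Hom ?K Y Z" for F X Y G Z H using that by simp
  show "\<exists>Z. zero_object ?K Z"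
  proof
    have h: "Hom ?K X Y = Hom C X Y" if "X \<in> A" "Y \<in> A" for X Y using that by auto
    show "zero_object ?K Z0" using Z0 unfolding zero_object_def by (simp add: h del: Hom_def)
  qed
  show "\<exists>B \<in> Ob ?K. biproduct ?K X Y B" if XY: "X \<in> Ob ?K" "Y \<in> Ob ?K" for X Y
  proof -
    obtain B where B: "B \<in> Ob C \<inter> A" "biproduct C X Y B" using bi[of X Y] XY by auto
    have h: "Hom ?K X B = Hom C X B" "Hom ?K Y B = Hom C Y B" "Hom ?K B X = Hom C B X" "Hom ?K B Y = Hom C B Y"
      using B XY by auto
    have "biproduct ?K X Y B" using B(2) unfolding biproduct_def h by simp
    then show ?thesis using B by auto
  qed
qed

end

section \<open>Perpendicular subcategories\<close>

context preadditive_category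
begin

lemma hom_vanish_iff:
  assumes A: "A \<subseteq> Ob C" and B: "B \<subseteq> Ob C"
  shows "hom_vanish C A B \<longleftrightarrow> (\<forall>f \<in> Arr C. Src C f \<in> A \<and> Tgt C f \<in> B \<longrightarrow> f = Zero C (Src C f) (Tgt C f))"
proof
  assume v: "hom_vanish C A B"
  show "\<forall>f \<in> Arr C. Src C f \<in> A \<and> Tgt C f \<in> B \<longrightarrow> f = Zero C (Src C f) (Tgt C f)"
  proof (intro ballI impI)
    fix f assume f: "f \<in> Arr C" "Src C f \<in> A \<and> Tgt C f \<in> B"
    then have "f \<in> Hom C (Src C f) (Tgt C f)" by simp
    also have "\<dots> = {Zero C (Src C f) (Tgt C f)}" using v f unfolding hom_vanish_def by blast
    finally show "f = Zero C (Src C f) (Tgt C f)" by blast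
  qed
next
  assume z: "\<forall>f \<in> Arr C. Src C f \<in> A \<and> Tgt C f \<in> B \<longrightarrow> f = Zero C (Src C f) (Tgt C f)"
  show "hom_vanish C A B" unfolding hom_vanish_def
  proof (intro ballI subset_antisym)
    fix V W assume VW: "V \<in> A" "W \<in> B"
    then show "Hom C V W \<subseteq> {Zero C V W}" unfolding Hom_def using z by blast
    have "V \<in> Ob C" "W \<in> Ob C" using VW A B by blast+
    then show "{Zero C V W} \<subseteq> Hom C V W" by simp
  qed
qed

lemma right_perp_iff:
  assumes "A \<subseteq> Ob C"
  shows "W \<in> right_perp C A \<longleftrightarrow> W \<in> Ob C \<and> (\<forall>f \<in> Arr C. Src C f \<in> A \<and> Tgt C f = W \<longrightarrow> f = Zero C (Src C f) W)"
  using hom_vanish_iff[OF assms, of "{W}"] unfolding right_perp_def by auto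

lemma left_perp_iff:
  assumes "A \<subseteq> Ob C"
  shows "W \<in> left_perp C A \<longleftrightarrow> W \<in> Ob C \<and> (\<forall>f \<in> Arr C. Tgt C f \<in> A \<and> Src C f = W \<longrightarrow> f = Zero C W (Tgt C f))"
  using hom_vanish_iff[OF _ assms, of "{W}"] unfolding left_perp_def by auto

lemma right_perp_Ob: "W \<in> right_perp C A \<Longrightarrow> W \<in> Ob C"
  and left_perp_Ob: "W \<in> left_perp C A \<Longrightarrow> W \<in> Ob C"
  by (simp_all add: right_perp_def left_perp_def)

lemma right_perpD:
  assumes "W \<in> right_perp C A" "f \<in> Arr C" "Src C f \<in> A" "Tgt C f = W"
  shows "f = Zero C (Src C f) W"
proof -
  have "Hom C (Src C f) W = {Zero C (Src C f) W}" using assms unfolding right_perp_def hom_vanish_def by blast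
  moreover have "f \<in> Hom C (Src C f) W" using assms by simp
  ultimately show ?thesis by blast
qed

lemma left_perpD:
  assumes "W \<in> left_perp C A" "f \<in> Arr C" "Tgt C f \<in> A" "Src C f = W"
  shows "f = Zero C W (Tgt C f)"
proof -
  have "Hom C W (Tgt C f) = {Zero C W (Tgt C f)}" using assms unfolding left_perp_def hom_vanish_def by blast
  moreover have "f \<in> Hom C W (Tgt C f)" using assms by simp
  ultimately show ?thesis by blast
qed

section \<open>Closure properties of perpendicular categories\<close>

lemma right_perp_zero_object:
  assumes "zero_object C Z" "A \<subseteq> Ob C"
  shows "Z \<in> right_perp C A"
  unfolding right_perp_iff[OF assms(2)] using zero_object_Zero(2)[OF assms(1)] assms(1) by (simp add: zero_object_def)

lemma left_perp_zero_object:
  assumes "zero_object C Z" "A \<subseteq> Ob C"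
  shows "Z \<in> left_perp C A"
  unfolding left_perp_iff[OF assms(2)] using zero_object_Zero(1)[OF assms(1)] assms(1) by (simp add: zero_object_def)

lemma right_perp_biproduct:
  assumes b: "biproduct C W W' B" and W: "W \<in> right_perp C A" "W' \<in> right_perp C A" and A: "A \<subseteq> Ob C"
  shows "B \<in> right_perp C A"
proof -
  obtain i j p r where [simp]: "i \<in> Arr C" "j \<in> Arr C" "p \<in> Arr C" "r \<in> Arr C" "Src C i = W" "Src C j = W'" "Src C p = B"
    "Src C r = B" "Tgt C i = B" "Tgt C j = B" "Tgt C p = W" "Tgt C r = W'" and e: "i \<cdot> p \<boxplus> j \<cdot> r = Ident C B"
    using b unfolding biproduct_def Hom_def by blast
  have [simp]: "B \<in> Ob C" using Tgt_in_Ob[of i] by simp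
  have [simp]: "W \<in> Ob C" "W' \<in> Ob C" using W right_perp_Ob by blast+
  have "f = Zero C (Src C f) B" if [simp]: "f \<in> Arr C" "Tgt C f = B" and f: "Src C f \<in> A" for f
  proof -
    have "f = (i \<cdot> p \<boxplus> j \<cdot> r) \<cdot> f" unfolding e by simp
    also have "\<dots> = i \<cdot> (p \<cdot> f) \<boxplus> j \<cdot> (r \<cdot> f)" by simp
    also have "p \<cdot> f = Zero C (Src C f) W" using right_perpD[OF W(1), of "p \<cdot> f"] f by simp
    also have "r \<cdot> f = Zero C (Src C f) W'" using right_perpD[OF W(2), of "r \<cdot> f"] f by simp
    finally show ?thesis by simp
  qed
  then show ?thesis unfolding right_perp_iff[OF A] by simp
qed

lemma left_perp_biproduct:
  assumes b: "biproduct C W W' B" and W: "W \<in> left_perp C A" "W' \<in> left_perp C A" and A: "A \<subseteq> Ob C"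
  shows "B \<in> left_perp C A"
proof -
  obtain i j p r where [simp]: "i \<in> Arr C" "j \<in> Arr C" "p \<in> Arr C" "r \<in> Arr C" "Src C i = W" "Src C j = W'" "Src C p = B"
    "Src C r = B" "Tgt C i = B" "Tgt C j = B" "Tgt C p = W" "Tgt C r = W'" and e: "i \<cdot> p \<boxplus> j \<cdot> r = Ident C B"
    using b unfolding biproduct_def Hom_def by blast
  have [simp]: "B \<in> Ob C" using Tgt_in_Ob[of i] by simp
  have [simp]: "W \<in> Ob C" "W' \<in> Ob C" using W left_perp_Ob by blast+
  have "f = Zero C B (Tgt C f)" if [simp]: "f \<in> Arr C" "Src C f = B" and f: "Tgt C f \<in> A" for f
  proof -
    have "f = f \<cdot> (i \<cdot> p \<boxplus> j \<cdot> r)" unfolding e by simp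
    also have "\<dots> = (f \<cdot> i) \<cdot> p \<boxplus> (f \<cdot> j) \<cdot> r" by simp
    also have "f \<cdot> i = Zero C W (Tgt C f)" using left_perpD[OF W(1), of "f \<cdot> i"] f by simp
    also have "f \<cdot> j = Zero C W' (Tgt C f)" using left_perpD[OF W(2), of "f \<cdot> j"] f by simp
    finally show ?thesis by simp
  qed
  then show ?thesis unfolding left_perp_iff[OF A] by simp
qed

lemma right_perp_iso:
  assumes i: "is_iso C i" "Src C i \<in> right_perp C A" and A: "A \<subseteq> Ob C"
  shows "Tgt C i \<in> right_perp C A"
proof -
  note [simp] = i(1) is_iso_Arr[OF i(1)]
  have "f = Zero C (Src C f) (Tgt C i)" if [simp]: "f \<in> Arr C" "Tgt C f = Tgt C i" and f: "Src C f \<in> A" for f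
  proof -
    have "inv_arr C i \<cdot> f = Zero C (Src C f) (Src C i)" using right_perpD[OF i(2), of "inv_arr C i \<cdot> f"] f by simp
    then show ?thesis by - (rule iso_cancel_left[of "inv_arr C i"], simp_all)
  qed
  then show ?thesis unfolding right_perp_iff[OF A] by simp
qed

end

lemma torsion_pairD:
  assumes "torsion_pair T A B"
  shows "A \<subseteq> Ob T" "B \<subseteq> Ob T" "hom_vanish T A B" "Ob T = star T A B" "A = left_perp T B" "B = right_perp T A"
proof -
  note c = assms[unfolded torsion_pair_def]
  show "A \<subseteq> Ob T" by (rule c[THEN conjunct1])
  note c = c[THEN conjunct2]
  show "B \<subseteq> Ob T" by (rule c[THEN conjunct1])
  note c = c[THEN conjunct2]
  show "hom_vanish T A B" by (rule c[THEN conjunct1])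
  note c = c[THEN conjunct2]
  show "Ob T = star T A B" by (rule c[THEN conjunct1])
  note c = c[THEN conjunct2]
  show "A = left_perp T B" by (rule c[THEN conjunct1])
  show "B = right_perp T A" by (rule c[THEN conjunct2])
qed

context triangulated_category
begin

text \<open>An arrow from \<open>A\<close> to the middle vertex dies in the last one, so it lifts to
  the first, where it is zero. The left-hand version is dual and uses the weak cokernel.\<close>

lemma right_perp_extension:
  assumes t: "(u, v, w) \<in> Tri T" and W: "Src T u \<in> right_perp T A" "Tgt T v \<in> right_perp T A" and A: "A \<subseteq> Ob T"
  shows "Tgt T u \<in> right_perp T A"
proof -
  note [simp] = Tri_simps[OF t]
  have "f = Zero T (Src T f) (Tgt T u)" if [simp]: "f \<in> Arr T" "Tgt T f = Tgt T u" and f: "Src T f \<in> A" for f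
  proof -
    have "v \<cdot> f = Zero T (Src T f) (Tgt T v)" using right_perpD[OF W(2), of "v \<cdot> f"] f by simp
    then obtain g where g [simp]: "g \<in> Arr T" "Src T g = Src T f" "Tgt T g = Src T u" and e: "f = u \<cdot> g"
      using weak_kernel_factor[OF Tri_weak_kernel[OF t], of f] by (simp (no_asm_use)) blast
    have "g = Zero T (Src T f) (Src T u)" using right_perpD[OF W(1), of g] f by simp
    then show ?thesis unfolding e by simp
  qed
  then show ?thesis unfolding right_perp_iff[OF A] by simp
qed

lemma left_perp_extension:
  assumes t: "(u, v, w) \<in> Tri T" and W: "Src T u \<in> left_perp T A" "Tgt T v \<in> left_perp T A" and A: "A \<subseteq> Ob T"
  shows "Tgt T u \<in> left_perp T A"
proof -
  note [simp] = Tri_simps[OF t]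
  have "f = Zero T (Tgt T u) (Tgt T f)" if [simp]: "f \<in> Arr T" "Src T f = Tgt T u" and f: "Tgt T f \<in> A" for f
  proof -
    have "f \<cdot> u = Zero T (Src T u) (Tgt T f)" using left_perpD[OF W(1), of "f \<cdot> u"] f by simp
    then obtain g where g [simp]: "g \<in> Arr T" "Src T g = Tgt T v" "Tgt T g = Tgt T f" and e: "f = g \<cdot> v"
      using Tri_cokernel[OF t, of f] by (simp (no_asm_use)) blast
    have "g = Zero T (Tgt T v) (Tgt T f)" using left_perpD[OF W(2), of g] f by simp
    then show ?thesis unfolding e by simp
  qed
  then show ?thesis unfolding left_perp_iff[OF A] by simp
qed

lemma shift_setE:
  assumes "W \<in> shift_set T A"
  obtains B i where "B \<in> A" "is_iso T i" "i \<in> Arr T" "Src T i = W" "Tgt T i = ShO T B"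
  using assms unfolding shift_set_def isomorphic_def Hom_def by blast

lemma shift_set_ShO:
  assumes "B \<in> A" "A \<subseteq> Ob T"
  shows "ShO T B \<in> shift_set T A"
proof -
  have B: "B \<in> Ob T" using assms by blast
  then show ?thesis using assms(1) isomorphic_refl[of "ShO T B"] unfolding shift_set_def by auto
qed

lemma shift_set_Ob: "shift_set T A \<subseteq> Ob T"
  unfolding shift_set_def by blast

lemma left_perp_shift_set:
  assumes W: "W \<in> left_perp T A" and A: "A \<subseteq> Ob T"
  shows "ShO T W \<in> left_perp T (shift_set T A)"
proof -
  have [simp]: "W \<in> Ob T" using left_perp_Ob[OF W] .
  have "f = Zero T (ShO T W) (Tgt T f)" if [simp]: "f \<in> Arr T" "Src T f = ShO T W" and f: "Tgt T f \<in> shift_set T A" for f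
  proof -
    obtain B i where B: "B \<in> A" and i [simp]: "is_iso T i" "i \<in> Arr T" "Src T i = Tgt T f" "Tgt T i = ShO T B"
      using shift_setE[OF f] by blast
    have [simp]: "B \<in> Ob T" using A B by blast
    obtain g where g [simp]: "g \<in> Arr T" "Src T g = W" "Tgt T g = B" and e: "ShA T g = i \<cdot> f"
      using Sh_full[of "i \<cdot> f" W B] by (simp (no_asm_use)) blast
    have "g = Zero T W B" using left_perpD[OF W, of g] B by simp
    then have "i \<cdot> f = Zero T (ShO T W) (ShO T B)" unfolding e[symmetric] by simp
    then show ?thesis by - (rule iso_cancel_left[of i], simp_all)
  qed
  then show ?thesis unfolding left_perp_iff[OF shift_set_Ob] by simp
qed

text \<open>The left-hand side involves a choice of objects; the right-hand side is a perpendicular category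
  and so inherits its closure properties.\<close>

lemma shift_set_torsion_class:
  assumes X: "X = left_perp T (right_perp T X)"
  shows "shift_set T X = left_perp T (ShO T ` right_perp T X)"
proof (intro subset_antisym subsetI)
  have O: "ShO T ` right_perp T X \<subseteq> Ob T" "right_perp T X \<subseteq> Ob T" using right_perp_Ob by auto
  {
    fix W assume W: "W \<in> shift_set T X"
    obtain B i where B: "B \<in> X" and i [simp]: "is_iso T i" "i \<in> Arr T" "Src T i = W" "Tgt T i = ShO T B"
      using shift_setE[OF W] by blast
    have B': "B \<in> left_perp T (right_perp T X)" using B by (simp flip: X)
    have [simp]: "B \<in> Ob T" "W \<in> Ob T" using left_perp_Ob[OF B'] Src_in_Ob[OF i(2)] by simp_all
    have "f = Zero T W (Tgt T f)" if [simp]: "f \<in> Arr T" "Src T f = W" and f: "Tgt T f \<in> ShO T ` right_perp T X" for f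
    proof -
      obtain R where R: "R \<in> right_perp T X" and [simp]: "Tgt T f = ShO T R" using f by blast
      have [simp]: "R \<in> Ob T" using right_perp_Ob[OF R] .
      obtain g where g [simp]: "g \<in> Arr T" "Src T g = B" "Tgt T g = R" and e: "ShA T g = f \<cdot> inv_arr T i"
        using Sh_full[of "f \<cdot> inv_arr T i" B R] by (simp (no_asm_use)) blast
      have "g = Zero T B R" using left_perpD[OF B', of g] R by simp
      then have "f \<cdot> inv_arr T i = Zero T (ShO T B) (ShO T R)" unfolding e[symmetric] by simp
      then show ?thesis by - (rule iso_cancel_right[of "inv_arr T i"], simp_all)
    qed
    then show "W \<in> left_perp T (ShO T ` right_perp T X)" unfolding left_perp_iff[OF O(1)] by simp
  }
  fix W assume W: "W \<in> left_perp T (ShO T ` right_perp T X)"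
  have [simp]: "W \<in> Ob T" using left_perp_Ob[OF W] .
  \<comment> \<open>Every \<open>W\<close> is the shift of some \<open>B\<close> up to isomorphism.
    Un-shifting shows that \<open>B\<close> is left orthogonal to \<open>right_perp T X\<close>, and
    the hypothesis on \<open>X\<close> turns this into membership.\<close>
  obtain B i where i [simp]: "B \<in> Ob T" "is_iso T i" "Src T i = ShO T B" "Tgt T i = W"
    using Sh_onto[of W] by (simp (no_asm_use)) blast
  note [simp] = is_iso_Arr[OF i(2)]
  have "f = Zero T B (Tgt T f)" if [simp]: "f \<in> Arr T" "Src T f = B" and f: "Tgt T f \<in> right_perp T X" for f
  proof (rule Sh_faithful)
    have "ShA T f \<cdot> inv_arr T i = Zero T W (ShO T (Tgt T f))" using left_perpD[OF W, of "ShA T f \<cdot> inv_arr T i"] f by simp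
    then show "ShA T f = ShA T (Zero T B (Tgt T f))" by - (rule iso_cancel_right[of "inv_arr T i"], simp_all)
  qed simp_all
  then have "B \<in> left_perp T (right_perp T X)" unfolding left_perp_iff[OF O(2)] by simp
  then have B: "B \<in> X" by (simp flip: X)
  have "isomorphic T W (ShO T B)" unfolding isomorphic_def by (rule bexI[of _ "inv_arr T i"]) simp_all
  then show "W \<in> shift_set T X" using B unfolding shift_set_def by auto
qed

lemma torsion_pair_triangle:
  assumes "torsion_pair T A B" "W \<in> Ob T"
  shows "\<exists>u v w. (u, v, w) \<in> Tri T \<and> Src T u \<in> A \<and> Tgt T u = W \<and> Tgt T v \<in> B"
proof -
  have "W \<in> star T A B" using assms(2) torsion_pairD(4)[OF assms(1)] by (rule subst[rotated])
  then show ?thesis unfolding star_def by blast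
qed

end

section \<open>The equivalence\<close>

locale torsion_setting = verdier_tri T S U D
  for T :: "('o, 'm, 'x) tri_cat_scheme" (structure) and S :: "'o set" and U D +
  fixes X Y :: "'o set"
  assumes XY: "torsion_pair (full_tri_subcat T S) X Y"
    and TX: "torsion_pair T X (right_perp T X)"
    and TY: "torsion_pair T (left_perp T Y) Y"
begin

abbreviation Z where "Z \<equiv> right_perp T X \<inter> left_perp T (shift_set T Y)"
abbreviation P where "P \<equiv> shift_set T X \<inter> Y"
abbreviation K where "K \<equiv> full_subcat T Z"

lemma full_tri_sel: "Ob (full_tri_subcat T S) = Ob T \<inter> S" "Zero (full_tri_subcat T S) = Zero T"
  "Hom (full_tri_subcat T S) A B = {f \<in> Hom T A B. A \<in> S \<and> B \<in> S}"
  "Tri (full_tri_subcat T S) \<subseteq> Tri T" "Src (full_tri_subcat T S) = Src T" "Tgt (full_tri_subcat T S) = Tgt T"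
  by (auto simp: full_tri_subcat_def full_subcat_def)

section \<open>Consequences of the three torsion pairs\<close>

lemma X_S: "X \<subseteq> S" and Y_S: "Y \<subseteq> S"
  using torsion_pairD(1,2)[OF XY] unfolding full_tri_sel(1) by blast+

lemma X_Ob: "X \<subseteq> Ob T" and Y_Ob: "Y \<subseteq> Ob T"
  by (rule torsion_pairD(1)[OF TX], rule torsion_pairD(2)[OF TY])

lemma X_eq: "X = left_perp T (right_perp T X)" and Y_eq: "Y = right_perp T (left_perp T Y)"
  by (rule torsion_pairD(5)[OF TX], rule torsion_pairD(6)[OF TY])

lemma XY_zero:
  assumes f: "f \<in> Arr T" "Src T f \<in> X" "Tgt T f \<in> Y"
  shows "f = Zero T (Src T f) (Tgt T f)"
proof -
  have "Hom (full_tri_subcat T S) (Src T f) (Tgt T f) = {Zero T (Src T f) (Tgt T f)}"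
    using torsion_pairD(3)[OF XY] f unfolding hom_vanish_def full_tri_sel(2) by blast
  moreover have "Src T f \<in> S" "Tgt T f \<in> S" using f X_S Y_S by blast+
  then have "f \<in> Hom (full_tri_subcat T S) (Src T f) (Tgt T f)" using f(1) unfolding full_tri_sel(3) by simp
  ultimately show ?thesis by blast
qed

lemma S_triangle:
  assumes W: "W \<in> S"
  shows "\<exists>u v w. (u, v, w) \<in> Tri T \<and> Src T u \<in> X \<and> Tgt T u = W \<and> Tgt T v \<in> Y"
proof -
  have "W \<in> Ob (full_tri_subcat T S)" using W S_Ob[OF W] unfolding full_tri_sel(1) by blast
  then have "W \<in> star (full_tri_subcat T S) X Y" using torsion_pairD(4)[OF XY] by (rule subst[rotated])
  then show ?thesis using full_tri_sel(4) unfolding star_def full_tri_sel(5,6) by blast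
qed

lemma shift_X: "shift_set T X = left_perp T (ShO T ` right_perp T X)"
  by (rule shift_set_torsion_class[OF X_eq])

lemma shift_perp_Ob: "ShO T ` right_perp T X \<subseteq> Ob T"
  using right_perp_Ob by auto

lemma Y_right_perp:
  assumes W: "W \<in> Y"
  shows "W \<in> right_perp T X"
  unfolding right_perp_iff[OF X_Ob]
proof (intro conjI ballI impI)
  show "W \<in> Ob T" using W Y_Ob by blast
  show "f = Zero T (Src T f) W" if "f \<in> Arr T" "Src T f \<in> X \<and> Tgt T f = W" for f
    using XY_zero[of f] that W by metis
qed

lemma X_left_perp:
  assumes W: "W \<in> X"
  shows "W \<in> left_perp T Y"
  unfolding left_perp_iff[OF Y_Ob]
proof (intro conjI ballI impI)
  show "W \<in> Ob T" using W X_Ob by blast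
  show "f = Zero T W (Tgt T f)" if "f \<in> Arr T" "Tgt T f \<in> Y \<and> Src T f = W" for f
    using XY_zero[of f] that W by metis
qed

text \<open>Vanishing of Hom from \<open>X\<close> to \<open>Y\<close> has two readings:
  \<open>Y\<close> lies in \<open>right_perp T X\<close>, and \<open>X\<close> lies in
  \<open>left_perp T Y\<close>. Shifting the second puts the objects of \<open>X[1]\<close> to the
  left of \<open>Y[1]\<close>.\<close>

lemma P_sub_Z: "P \<subseteq> Z"
proof
  fix W assume W: "W \<in> P"
  then have "W \<in> right_perp T X" using Y_right_perp by blast
  moreover have "W \<in> left_perp T (shift_set T Y)"
  proof -
    obtain A i where A: "A \<in> X" and i [simp]: "is_iso T i" "i \<in> Arr T" "Src T i = W" "Tgt T i = ShO T A"
      using shift_setE[of W X] W by blast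
    have [simp]: "A \<in> Ob T" "W \<in> Ob T" using A X_Ob Src_in_Ob[OF i(2)] by auto
    have SA: "ShO T A \<in> left_perp T (shift_set T Y)" by (rule left_perp_shift_set[OF X_left_perp[OF A] Y_Ob])
    have "f = Zero T W (Tgt T f)" if [simp]: "f \<in> Arr T" "Src T f = W" and f: "Tgt T f \<in> shift_set T Y" for f
    proof -
      have "f \<cdot> inv_arr T i = Zero T (ShO T A) (Tgt T f)" using left_perpD[OF SA, of "f \<cdot> inv_arr T i"] f by simp
      then show ?thesis by - (rule iso_cancel_right[of "inv_arr T i"], simp_all)
    qed
    then show ?thesis unfolding left_perp_iff[OF shift_set_Ob] by simp
  qed
  ultimately show "W \<in> Z" by blast
qed

lemma left_Y_Ob: "left_perp T Y \<subseteq> Ob T"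
  using left_perp_Ob by blast

text \<open>As an intersection of two perpendicular categories \<open>P\<close> contains the zero
  objects and is closed under biproducts.\<close>

lemma P_iff: "W \<in> P \<longleftrightarrow> W \<in> left_perp T (ShO T ` right_perp T X) \<and> W \<in> right_perp T (left_perp T Y)"
  unfolding Y_eq[symmetric] shift_X by simp

lemma P_zero_object:
  assumes "zero_object T W"
  shows "W \<in> P"
  unfolding P_iff
  using left_perp_zero_object[OF assms shift_perp_Ob] right_perp_zero_object[OF assms left_Y_Ob] by (rule conjI)

lemma P_biproduct_closed:
  assumes b: "biproduct T W W' B" and W: "W \<in> P" "W' \<in> P"
  shows "B \<in> P"
proof -
  have W1: "W \<in> left_perp T (ShO T ` right_perp T X)" "W' \<in> left_perp T (ShO T ` right_perp T X)"
    and W2: "W \<in> right_perp T (left_perp T Y)" "W' \<in> right_perp T (left_perp T Y)"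
    using W unfolding P_iff by simp_all
  show ?thesis unfolding P_iff
    using left_perp_biproduct[OF b W1 shift_perp_Ob] right_perp_biproduct[OF b W2 left_Y_Ob] by (rule conjI)
qed

lemma Z_biproduct_closed:
  assumes "biproduct T W W' B" "W \<in> Z" "W' \<in> Z"
  shows "B \<in> Z"
proof
  show "B \<in> right_perp T X" by (rule right_perp_biproduct[OF assms(1) _ _ X_Ob]) (use assms(2,3) in simp_all)
  show "B \<in> left_perp T (shift_set T Y)"
    by (rule left_perp_biproduct[OF assms(1) _ _ shift_set_Ob]) (use assms(2,3) in simp_all)
qed

lemma K_additive: "additive_category K"
proof -
  obtain Z0 where Z0: "zero_object T Z0" using ex_zero_object by blast
  show ?thesis
  proof (rule full_subcat_additive[OF Z0])
    show "Z0 \<in> Z" using P_zero_object[OF Z0] P_sub_Z by blast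
    show "\<exists>B \<in> Ob T \<inter> Z. biproduct T V W B" if "V \<in> Ob T \<inter> Z" "W \<in> Ob T \<inter> Z" for V W
    proof -
      have "V \<in> Ob T" "W \<in> Ob T" using that by blast+
      then obtain B where B: "B \<in> Ob T" "biproduct T V W B" using ex_biproduct by blast
      then show ?thesis using Z_biproduct_closed[OF B(2)] that by blast
    qed
  qed
qed

sublocale K: object_ideal K P
proof (intro object_ideal.intro object_ideal_axioms.intro)
  show "additive_category K" by (rule K_additive)
  show "P \<subseteq> Ob K" using P_sub_Z Y_Ob by auto
  show "P \<noteq> {}" using ex_zero_object P_zero_object by blast
  show "\<exists>B \<in> P. biproduct K W W' B" if W: "W \<in> P" "W' \<in> P" for W W'
  proof -
    have "W \<in> Ob T" "W' \<in> Ob T" using W Y_Ob by blast+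
    then obtain B where B: "B \<in> Ob T" "biproduct T W W' B" using ex_biproduct by blast
    have BP: "B \<in> P" using P_biproduct_closed[OF B(2) W] .
    have h: "Hom K W B = Hom T W B" "Hom K W' B = Hom T W' B" "Hom K B W = Hom T B W" "Hom K B W' = Hom T B W'"
      using BP W P_sub_Z by auto
    have "biproduct K W W' B" using B(2) unfolding biproduct_def h by simp
    then show ?thesis using BP by blast
  qed
qed

text \<open>The arrow from a zero object to an object of \<open>S\<close> has its cone in
  \<open>S\<close>, so it is a denominator; it equalises the identity and the zero endomorphism,
  which therefore coincide in \<open>U\<close>.\<close>

lemma V_zero_through_S:
  assumes [simp]: "g \<in> Arr T" "h \<in> Arr T" "Tgt T g = Src T h" and W: "Tgt T g \<in> S"
  shows "V (h \<cdot> g) = V (Zero T (Src T g) (Tgt T h))"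
proof -
  obtain Z0 where Z0: "zero_object T Z0" using ex_zero_object by blast
  have WS: "Src T h \<in> S" using W by simp
  have [simp]: "Z0 \<in> Ob T" using Z0 by (simp add: zero_object_def)
  obtain v w where t: "(Zero T Z0 (Src T h), v, w) \<in> Tri T" using TR1_cone[of "Zero T Z0 (Src T h)"] by auto
  have s: "Zero T Z0 (Src T h) \<in> Sig" using Sig_iff[OF t] S_cone[OF t] S_zero_object[OF Z0] WS by simp
  have "V (Ident T (Src T h)) = V (Zero T (Src T h) (Src T h))"
    using V_eq_iff[of "Ident T (Src T h)" "Zero T (Src T h) (Src T h)"] s
    by (auto intro: exI[of _ "Zero T Z0 (Src T h)"] simp del: V_simps V_add_simps)
  then have "Ident U (Src T h) = Zero U (Src T h) (Src T h)" by simp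
  then have "V h \<cdot>\<^bsub>U\<^esub> (Ident U (Src T h) \<cdot>\<^bsub>U\<^esub> V g) = V h \<cdot>\<^bsub>U\<^esub> (Zero U (Src T h) (Src T h) \<cdot>\<^bsub>U\<^esub> V g)" by (rule arg_cong)
  then show ?thesis by simp
qed

section \<open>The functor induced by \<open>V\<close> on the ideal quotient: well-definedness,
  density, fullness, faithfulness\<close>

definition F :: "('o, 'm set, 'o, ('m \<times> 'm) set) ftor" where
  "F = \<lparr>OMap = (\<lambda>A. A), AMap = (\<lambda>A. V (SOME f. f \<in> A))\<rparr>"

text \<open>\<open>F\<close> evaluates \<open>V\<close> at an arbitrary representative.
  Representatives of one coset differ by an arrow through \<open>P\<close>, which lies in
  \<open>S\<close> because \<open>Y\<close> does, so \<open>V\<close> does not see the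
  difference.\<close>

lemma F_q:
  assumes f: "f \<in> Arr K"
  shows "AMap F (K.q f) = V f"
proof -
  have eq: "V g = V f" if g: "g \<in> K.q f" for g
  proof -
    obtain h where h: "h \<in> K.fac (Src T f) (Tgt T f)" and gh: "g = h \<boxplus> f"
      using g unfolding K.q_eq by auto
    obtain a b where [simp]: "a \<in> Arr T" "b \<in> Arr T" "Src T a = Src T f" "Src T b = Tgt T a" "Tgt T b = Tgt T f"
      and W: "Tgt T a \<in> P" and hab: "h = b \<cdot> a"
      using h unfolding K.fac_iff by auto
    have [simp]: "f \<in> Arr T" using f by simp
    have "V h = V (Zero T (Src T f) (Tgt T f))" unfolding hab using V_zero_through_S[of a b] W Y_S by auto
    then have "V h \<boxplus>\<^bsub>U\<^esub> V f = V f" by simp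
    moreover have "V g = V h \<boxplus>\<^bsub>U\<^esub> V f" unfolding gh hab by (subst V.F_Add) simp_all
    ultimately show ?thesis by simp
  qed
  have "(SOME g. g \<in> K.q f) \<in> K.q f" using K.q_self[OF f] by (rule someI)
  from eq[OF this] show ?thesis by (simp add: F_def)
qed

lemma F_OMap [simp]: "OMap F A = A"
  by (simp add: F_def)

sublocale F: add_functor K.Q U F
proof (intro add_functor.intro add_functor_axioms.intro cat_functor.intro cat_functor_axioms.intro)
  show "category K.Q" by (rule K.Q.category_axioms)
  show "preadditive_category K.Q" by (rule K.Q.preadditive_category_axioms)
  show "category U" by (rule U.category_axioms)
  show "preadditive_category U" by (rule U.preadditive_category_axioms)
  show "is_functor K.Q U F"
    unfolding is_functor_def
  proof (intro conjI ballI impI)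
    fix G assume "G \<in> Arr K.Q"
    then obtain f where f: "f \<in> Arr K" "G = K.q f" using K.Q_Arr_cases by blast
    then show "AMap F G \<in> Hom U (OMap F (Src K.Q G)) (OMap F (Tgt K.Q G))" using F_q[OF f(1)] by simp
  next
    fix A assume A: "A \<in> Ob K.Q"
    then have "Ident T A \<in> Arr K" by simp
    from F_q[OF this] show "AMap F (Ident K.Q A) = Ident U (OMap F A)" using A by simp
  next
    fix G H assume GH: "G \<in> Arr K.Q" "H \<in> Arr K.Q" "Tgt K.Q G = Src K.Q H"
    obtain f where f: "f \<in> Arr K" "G = K.q f" using K.Q_Arr_cases GH(1) by blast
    obtain g where g: "g \<in> Arr K" "H = K.q g" using K.Q_Arr_cases GH(2) by blast
    have e: "Tgt T f = Src T g" using GH(3) f g by simp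
    have "g \<cdot> f \<in> Arr K" using f(1) g(1) e by simp
    from F_q[OF this] show "AMap F (H \<cdot>\<^bsub>K.Q\<^esub> G) = AMap F H \<cdot>\<^bsub>U\<^esub> AMap F G"
      using K.q_Comp[OF f(1) g(1)] e F_q[OF f(1)] F_q[OF g(1)] f g by simp
  qed (use K.Q.category_axioms U.category_axioms in simp_all)
  fix G H assume GH: "G \<in> Arr K.Q" "H \<in> Arr K.Q" "Src K.Q G = Src K.Q H" "Tgt K.Q G = Tgt K.Q H"
  obtain f where f: "f \<in> Arr K" "G = K.q f" using K.Q_Arr_cases GH(1) by blast
  obtain g where g: "g \<in> Arr K" "H = K.q g" using K.Q_Arr_cases GH(2) by blast
  have e: "Src T f = Src T g" "Tgt T f = Tgt T g" using GH(3,4) f g by simp_all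
  have "f \<boxplus> g \<in> Arr K" using f(1) g(1) e by simp
  from F_q[OF this] show "AMap F (G \<boxplus>\<^bsub>K.Q\<^esub> H) = AMap F G \<boxplus>\<^bsub>U\<^esub> AMap F H"
    using K.q_Add[OF f(1) g(1)] e F_q[OF f(1)] F_q[OF g(1)] f g by simp
qed

lemma F_ess_surj: "ess_surj K.Q U F"
  unfolding ess_surj_def
proof
  fix M assume "M \<in> Ob U"
  then have [simp]: "M \<in> Ob T" by simp
  obtain x m n where t1: "(x, m, n) \<in> Tri T" and x: "Src T x \<in> X" "Tgt T x = M" "Tgt T m \<in> right_perp T X"
    using torsion_pair_triangle[OF TX, of M] by auto
  note [simp] = Tri_simps[OF t1] x(2)
  have [simp]: "Src T m = M" unfolding Tri_simps(4)[OF t1, symmetric] by (rule x(2))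
  have m: "m \<in> Sig" using Sig_iff[OF rotate[OF t1]] S_shift[of "Src T x"] x(1) X_S by auto
  \<comment> \<open>The second truncation has to remove a part in \<open>Y[1]\<close>, while the
    torsion pair at hand is the one for \<open>Y\<close>. So it is applied to an object
    \<open>T0\<close> whose shift is the first truncation, and its triangle is shifted.\<close>
  obtain T0 i where i [simp]: "T0 \<in> Ob T" "is_iso T i" "Src T i = ShO T T0" "Tgt T i = Src T n"
    using Sh_onto[of "Src T n"] by (simp (no_asm_use)) blast
  note [simp] = is_iso_Arr[OF i(2)]
  obtain l y w where t2: "(l, y, w) \<in> Tri T" and l: "Src T l \<in> left_perp T Y" "Tgt T l = T0" "Tgt T y \<in> Y"
    using torsion_pair_triangle[OF TY, of T0] by auto
  note ty2 [simp] = Tri_simps[OF t2]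
  have [simp]: "Src T y = T0" using l(2) by simp
  have t3: "(w, Neg T (ShA T l), Neg T (ShA T y)) \<in> Tri T" using rotate[OF rotate[OF t2]] .
  let ?L = "ShO T (Src T l)"
  have "?L \<in> left_perp T (shift_set T Y)" by (rule left_perp_shift_set[OF l(1) Y_Ob])
  \<comment> \<open>The second truncation does not spoil the first: \<open>?L\<close> is an
    extension of \<open>ShO T T0\<close> by the \<open>Y\<close>-part of \<open>T0\<close>, and both
    are right orthogonal to \<open>X\<close>.\<close>
  moreover have "?L \<in> right_perp T X"
  proof -
    have "Src T w \<in> right_perp T X" using Y_right_perp[OF l(3)] by simp
    moreover have "Tgt T (inv_arr T i) \<in> right_perp T X"
      by (rule right_perp_iso[OF is_iso_inv[OF i(2)] _ X_Ob]) (use x(3) in simp)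
    then have "Tgt T (Neg T (ShA T l)) \<in> right_perp T X" using l(2) by simp
    ultimately show ?thesis using right_perp_extension[OF t3 _ _ X_Ob] by simp
  qed
  ultimately have L: "?L \<in> Ob K.Q" by (simp add: left_perp_Ob[OF l(1)])
  have "Neg T (ShA T l) \<in> Sig" using Sig_iff[OF rotate[OF t3]] Sig_iff[OF t3] Sig_iff[OF rotate[OF rotate[OF rotate[OF t2]]]]
     S_shift[of "Tgt T y"] l(3) Y_S by auto
  then have "is_iso U (V (Neg T (ShA T l)))" by (rule V_Sig_iso)
  moreover have "is_iso U (V i)" using V.F_inv(1)[OF i(2)] .
  moreover have "is_iso U (inv_arr U (V m))" using U.is_iso_inv[OF V_Sig_iso[OF m]] .
  ultimately have iso: "is_iso U (inv_arr U (V m) \<cdot>\<^bsub>U\<^esub> (V i \<cdot>\<^bsub>U\<^esub> V (Neg T (ShA T l))))"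
    using V_Sig_iso[OF m] l(2) by (intro U.is_iso_Comp) simp_all
  have "inv_arr U (V m) \<cdot>\<^bsub>U\<^esub> (V i \<cdot>\<^bsub>U\<^esub> V (Neg T (ShA T l))) \<in> Hom U ?L M"
    using V_Sig_iso[OF m] l(2) by simp
  then have "isomorphic U ?L M" unfolding isomorphic_def using iso by blast
  then show "\<exists>A\<in>Ob K.Q. isomorphic U (OMap F A) M" using L by (intro bexI[of _ ?L]) simp_all
qed

text \<open>Up to isomorphism the target of \<open>v\<close> is \<open>C'[1]\<close> with
  \<open>C'\<close> in \<open>S\<close>. Shifting the torsion triangle of \<open>C'\<close> gives a
  triangle with vertices in \<open>X[1]\<close>, \<open>C'[1]\<close> and \<open>Y[1]\<close>;
  arrows from \<open>M\<close> to the last vertex vanish, so \<open>v\<close> lifts to the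
  first.\<close>

lemma factor_through_shift:
  assumes M: "M \<in> left_perp T (shift_set T Y)" and v [simp]: "v \<in> Arr T" "Src T v = M" and C: "Tgt T v \<in> S"
  shows "\<exists>m j X0. X0 \<in> X \<and> m \<in> Arr T \<and> j \<in> Arr T \<and> Src T m = M \<and> Tgt T m = ShO T X0 \<and> Src T j = ShO T X0 \<and>
    Tgt T j = Tgt T v \<and> v = j \<cdot> m"
proof -
  have [simp]: "M \<in> Ob T" using left_perp_Ob[OF M] .
  obtain C' i where i [simp]: "C' \<in> Ob T" "is_iso T i" "Src T i = ShO T C'" "Tgt T i = Tgt T v"
    using Sh_onto[of "Tgt T v"] by (simp (no_asm_use)) blast
  note [simp] = is_iso_Arr[OF i(2)]
  have "isomorphic T (Tgt T v) (ShO T C')" unfolding isomorphic_def by (rule bexI[of _ "inv_arr T i"]) simp_all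
  then have "C' \<in> S" using S_iso[OF C] S_shift[of C'] by simp
  then obtain x y w where t: "(x, y, w) \<in> Tri T" and x: "Src T x \<in> X" "Tgt T x = C'" "Tgt T y \<in> Y"
    using S_triangle by blast
  note [simp] = Tri_simps[OF t]
  have [simp]: "Src T y = C'" using x(2) by simp
  have t': "(Neg T (ShA T x), Neg T (ShA T y), Neg T (ShA T w)) \<in> Tri T" using rotate[OF rotate[OF rotate[OF t]]] .
  have "Neg T (ShA T y) \<cdot> (inv_arr T i \<cdot> v) = Zero T M (ShO T (Tgt T y))"
    using left_perpD[OF M, of "Neg T (ShA T y) \<cdot> (inv_arr T i \<cdot> v)"] shift_set_ShO[OF x(3) Y_Ob] by simp
  then obtain m where m [simp]: "m \<in> Arr T" "Src T m = M" "Tgt T m = ShO T (Src T x)"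
    and e: "inv_arr T i \<cdot> v = Neg T (ShA T x) \<cdot> m"
    using weak_kernel_factor[OF Tri_weak_kernel[OF t'], of "inv_arr T i \<cdot> v"] by (simp (no_asm_use) del: Comp_Neg) blast
  have [simp]: "Tgt T x = C'" by (rule x(2))
  have "v = i \<cdot> (inv_arr T i \<cdot> v)" by simp
  also have "\<dots> = (i \<cdot> Neg T (ShA T x)) \<cdot> m" unfolding e by simp
  finally have "v = (i \<cdot> Neg T (ShA T x)) \<cdot> m" .
  moreover have "i \<cdot> Neg T (ShA T x) \<in> Arr T" "Src T (i \<cdot> Neg T (ShA T x)) = ShO T (Src T x)"
    "Tgt T (i \<cdot> Neg T (ShA T x)) = Tgt T v" by simp_all
  ultimately show ?thesis using x(1) m by blast
qed

lemma right_perp_shift: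
  assumes N: "N \<in> right_perp T X" and X0: "X0 \<in> X" and [simp]: "f \<in> Arr T" "Src T f = ShO T X0" "Tgt T f = ShO T N"
  shows "f = Zero T (ShO T X0) (ShO T N)"
proof -
  have [simp]: "N \<in> Ob T" "X0 \<in> Ob T" using right_perp_Ob[OF N] X0 X_Ob by auto
  obtain g where g [simp]: "g \<in> Arr T" "Src T g = X0" "Tgt T g = N" and e: "ShA T g = f"
    using Sh_full[of f X0 N] by (simp (no_asm_use)) blast
  have "g = Zero T X0 N" using right_perpD[OF N, of g] X0 by simp
  then show ?thesis unfolding e[symmetric] by simp
qed

lemma V_full_on_Z:
  assumes M: "M \<in> Z" and N: "N \<in> Z" and H [simp]: "H \<in> Arr U" "Src U H = M" "Tgt U H = N"
  shows "\<exists>g. g \<in> Arr T \<and> Src T g = M \<and> Tgt T g = N \<and> V g = H"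
proof -
  have [simp]: "M \<in> Ob T" "N \<in> Ob T" using M N right_perp_Ob by blast+
  obtain s f where sf [simp]: "s \<in> Sig" "f \<in> Arr T" "Src T f = Src T s" "Tgt T s = M" "Tgt T f = N"
    and e: "H \<cdot>\<^bsub>U\<^esub> V s = V f" using U_fraction[OF H(1)] by (simp (no_asm_use)) blast
  obtain v c where t: "(s, v, c) \<in> Tri T" using TR1_cone[of s] by auto
  note [simp] = Tri_simps[OF t]
  have [simp]: "Src T v = M" using Tri_simps(4)[OF t] by simp
  have C: "Tgt T v \<in> S" using Sig_iff[OF t] by simp
  obtain m j X0 where X0: "X0 \<in> X" and [simp]: "m \<in> Arr T" "j \<in> Arr T" "Src T m = M" "Tgt T m = ShO T X0" "Src T j = ShO T X0"
    "Tgt T j = Tgt T v" and v: "v = j \<cdot> m"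
    using factor_through_shift[of M v] M C by auto
  \<comment> \<open>The arrow \<open>s'\<close> has cone \<open>ShO T X0\<close>, so it is a
    denominator; since \<open>v\<close> kills it, it factors through \<open>s\<close>, and the
    fraction can be rewritten over \<open>s'\<close>.\<close>
  obtain s' n where t': "(s', m, n) \<in> Tri T" using ex_fiber[of m] by auto
  note ty' [simp] = Tri_simps[OF t']
  have [simp]: "Tgt T s' = M" "Src T n = ShO T X0" using Tri_simps(4,5)[OF t'] by simp_all
  have [simp]: "X0 \<in> Ob T" using X0 X_Ob by blast
  have s' [simp]: "s' \<in> Sig" using Sig_iff[OF t'] S_shift[of X0] X0 X_S by auto
  have "v \<cdot> s' = Zero T (Src T s') (Tgt T v)" unfolding v using Tri_comp[OF t'] by simp
  then obtain h where h [simp]: "h \<in> Arr T" "Src T h = Src T s'" "Tgt T h = Src T s" and s'h: "s' = s \<cdot> h"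
    using weak_kernel_factor[OF Tri_weak_kernel[OF t], of s'] by (simp (no_asm_use)) blast
  \<comment> \<open>The obstruction to extending \<open>f \<cdot> h\<close> along \<open>s'\<close>.
    It goes from \<open>X0[1]\<close> to \<open>N[1]\<close>, so it is the shift of an arrow from
    \<open>X0\<close> to \<open>N\<close>, and such arrows are zero.\<close>
  have "ShA T (f \<cdot> h) \<cdot> n = Zero T (ShO T X0) (ShO T N)"
    by (rule right_perp_shift) (use N X0 in auto)
  then obtain g where g [simp]: "g \<in> Arr T" "Src T g = M" "Tgt T g = N" and fg: "f \<cdot> h = g \<cdot> s'"
    using Tri_cokernel_shift[OF t', of "f \<cdot> h"] by (simp (no_asm_use)) blast
  have "V g \<cdot>\<^bsub>U\<^esub> V s' = V (f \<cdot> h)" unfolding fg by simp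
  also have "\<dots> = H \<cdot>\<^bsub>U\<^esub> V (s \<cdot> h)" by (simp add: e[THEN U.assoc_eq])
  also have "\<dots> = H \<cdot>\<^bsub>U\<^esub> V s'" unfolding s'h[symmetric] ..
  finally have "V g \<cdot>\<^bsub>U\<^esub> V s' = H \<cdot>\<^bsub>U\<^esub> V s'" .
  from U.iso_cancel_right[OF V_Sig_iso[OF s'] _ _ _ _ this] have "V g = H" by simp
  then show ?thesis using g by blast
qed

lemma V_zero_factors_through_P:
  assumes M: "M \<in> Z" and N: "N \<in> Z" and g [simp]: "g \<in> Arr T" "Src T g = M" "Tgt T g = N"
    and z: "V g = V (Zero T M N)"
  shows "g \<in> K.fac M N"
proof -
  have [simp]: "M \<in> Ob T" "N \<in> Ob T" using M N right_perp_Ob by blast+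
  obtain a where a [simp]: "a \<in> Sig" "Tgt T a = M" and ga: "g \<cdot> a = Zero T M N \<cdot> a"
    using V_eq_iff[of g "Zero T M N"] z by (simp (no_asm_use) del: V_add_simps Comp_Zero) blast
  obtain v c where t: "(a, v, c) \<in> Tri T" using TR1_cone[of a] by auto
  note [simp] = Tri_simps[OF t]
  have [simp]: "Src T v = M" using Tri_simps(4)[OF t] by simp
  have C: "Tgt T v \<in> S" using Sig_iff[OF t] by simp
  have ga': "g \<cdot> a = Zero T (Src T a) N" using ga by simp
  obtain g1 where g1 [simp]: "g1 \<in> Arr T" "Src T g1 = Src T c" "Tgt T g1 = N" and gv: "g = g1 \<cdot> v"
    using Tri_cokernel[OF t _ _ ga'] by (simp (no_asm_use)) blast
  obtain m j X0 where X0: "X0 \<in> X" and [simp]: "m \<in> Arr T" "j \<in> Arr T" "Src T m = M" "Tgt T m = ShO T X0" "Src T j = ShO T X0"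
    "Tgt T j = Tgt T v" and v: "v = j \<cdot> m"
    using factor_through_shift[of M v] M C by auto
  have X0S: "ShO T X0 \<in> S" using S_shift[of X0] X0 X_S X_Ob by auto
  \<comment> \<open>This is the torsion triangle of \<open>ShO T X0\<close> itself, not a shifted
    one. Arrows from its \<open>X\<close>-part to \<open>N\<close> vanish, so
    \<open>g1 \<cdot> j\<close> factors through its \<open>Y\<close>-part.\<close>
  obtain x y w where t1: "(x, y, w) \<in> Tri T" and x: "Src T x \<in> X" "Tgt T x = ShO T X0" "Tgt T y \<in> Y"
    using S_triangle[OF X0S] by blast
  note ty1 [simp] = Tri_simps[OF t1] x(2)
  have [simp]: "Src T y = ShO T X0" unfolding Tri_simps(4)[OF t1, symmetric] by (rule x(2))
  have "(g1 \<cdot> j) \<cdot> x = Zero T (Src T x) N"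
    using right_perpD[of N X "(g1 \<cdot> j) \<cdot> x"] N x(1) by simp
  then obtain g2 where g2 [simp]: "g2 \<in> Arr T" "Src T g2 = Src T w" "Tgt T g2 = N" and e2: "g1 \<cdot> j = g2 \<cdot> y"
    using Tri_cokernel[OF t1, of "g1 \<cdot> j"] by (simp (no_asm_use)) blast
  \<comment> \<open>In the rotated triangle the \<open>Y\<close>-part stands between
    \<open>ShO T X0\<close> and the shift of the \<open>X\<close>-part; \<open>X[1]\<close> is
    closed under extensions because it is a left perpendicular category.\<close>
  have "Tgt T y \<in> left_perp T (ShO T ` right_perp T X)"
    by (rule left_perp_extension[OF rotate[OF t1] _ _ shift_perp_Ob])
      (use shift_X shift_set_ShO[OF X0 X_Ob] shift_set_ShO[OF x(1) X_Ob] in simp_all)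
  then have P: "Tgt T y \<in> P" using x(3) shift_X by blast
  have "g = g2 \<cdot> (y \<cdot> m)" unfolding gv v by (simp add: e2[THEN assoc_eq])
  moreover have "y \<cdot> m \<in> Arr K" "g2 \<in> Arr K" using M N P P_sub_Z by auto
  ultimately show ?thesis using P unfolding K.fac_iff by (intro exI[of _ "y \<cdot> m"] exI[of _ g2]) simp
qed

lemma F_fully_faithful: "fully_faithful K.Q U F"
  unfolding fully_faithful_def
proof (intro conjI ballI impI)
  fix G H assume G: "G \<in> Arr K.Q" and H: "H \<in> Arr K.Q"
    and GH: "Src K.Q G = Src K.Q H \<and> Tgt K.Q G = Tgt K.Q H \<and> AMap F G = AMap F H"
  obtain f where f: "f \<in> Arr K" "G = K.q f" using K.Q_Arr_cases G by blast
  obtain g where g: "g \<in> Arr K" "H = K.q g" using K.Q_Arr_cases H by blast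
  have [simp]: "f \<in> Arr T" "g \<in> Arr T" using f(1) g(1) by simp_all
  have [simp]: "Src T f = Src T g" "Tgt T f = Tgt T g" using GH f g by simp_all
  have "V f = V g" using GH F_q[OF f(1)] F_q[OF g(1)] f(2) g(2) by simp
  \<comment> \<open>Additivity of \<open>V\<close> reduces faithfulness to arrows with zero
    image.\<close>
  then have "V (f \<boxplus> Neg T g) = V (Zero T (Src T g) (Tgt T g))" by simp
  then have "f \<boxplus> Neg T g \<in> K.fac (Src T g) (Tgt T g)"
    by (intro V_zero_factors_through_P) (use g(1) in simp_all)
  moreover have "f = (f \<boxplus> Neg T g) \<boxplus> g" by (simp add: Add_assoc)
  ultimately have "f \<in> K.q g" unfolding K.q_eq by auto
  then show "G = H" using K.q_eqI[OF _ g(1)] f(2) g(2) by simp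
next
  fix A B H assume A: "A \<in> Ob K.Q" "B \<in> Ob K.Q" and H: "H \<in> Hom U (OMap F A) (OMap F B)"
  obtain g where g: "g \<in> Arr T" "Src T g = A" "Tgt T g = B" "V g = H"
    using V_full_on_Z[of A B H] A H by auto
  then have gK: "g \<in> Arr K" using A by simp
  then show "\<exists>G\<in>Hom K.Q A B. AMap F G = H" using F_q[OF gK] g by (intro bexI[of _ "K.q g"]) simp_all
qed

lemma F_equivalence: "additive_equivalence K.Q U F"
  unfolding additive_equivalence_def additive_functor_def
  using F.equivalence_functorI[OF F_fully_faithful F_ess_surj] K.Q_additive U.additive_category_axioms F.is_functor F.F_Add
  by blast

end

theorem theorem1p1:
  fixes T :: "('o, 'm) tri_cat" and S X Y Z P :: "'o set"
    and U :: "('o, ('m \<times> 'm) set) tri_cat"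
  assumes "triangulated_category T"
    and "thick_subcategory T S"
    and "U = verdier_quotient T S"
    and "torsion_pair (full_tri_subcat T S) X Y"
    and "torsion_pair T X (right_perp T X)"
    and "torsion_pair T (left_perp T Y) Y"
    and "Z = right_perp T X \<inter> left_perp T (shift_set T Y)"
    and "P = shift_set T X \<inter> Y"
  shows "(\<exists>F. additive_equivalence (ideal_quotient (full_subcat T Z) P) U F \<and>
            functor_eq (full_subcat T Z)
              (F \<circ>\<^sub>F ideal_projection (full_subcat T Z) P) (verdier_functor T S \<circ>\<^sub>F id_functor)) \<and>
         has_triangulated_structure (ideal_quotient (full_subcat T Z) P)"
proof -
  have "verdier_tri T S U (Tri U)"
    using verdier_quotient_locale[of T S] assms(1-3) by (simp add: thick_subcategory_def)
  then interpret torsion_setting T S U "Tri U" X Y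
    by (intro torsion_setting.intro torsion_setting_axioms.intro assms)
  \<comment> \<open>All functors here are the identity on objects; on arrows the equation is
    \<open>F_q\<close>.\<close>
  have eq: "functor_eq (full_subcat T Z)
      (F \<circ>\<^sub>F ideal_projection (full_subcat T Z) P) (verdier_functor T S \<circ>\<^sub>F id_functor)"
    unfolding functor_eq_def comp_functor_def id_functor_def assms(7,8)
    using F_q by (simp add: K.proj_sel)
  show ?thesis
    using F_equivalence eq transport_triangulated_structure[OF U_triangulated F_equivalence]
    unfolding assms(7,8) by blast
qed

end
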